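(* Let $2\le p<\infty$ and $\frac1p+\frac1q=1$. Let $f:[0,T]\times M^p\to\mathbb R^d$, $g:[0,T]\times M^p\to\mathbb R^{d\times m}$, $h:[0,T]\times M^p\times\mathbb R_0\to\mathbb R^{d\times n}$ be deterministic functionals satisfying the standing assumptions described in the context, let $(\eta,x)\in M^p$, and let $X$ be the unique strong solution of $$dX(t)=f(t,X_t,X(t))dt+g(t,X_t,X(t))dW(t)+\int_{\mathbb R_0}h(t,X_t,X(t))(z)\tilde N(dt,dz),\quad t\in[0,T],\qquad (X_0,X(0))=(\eta,x).$$ Let $F\in C^{1,1,2}([0,T]\times L^p\times\mathbb R^d)$, $F:[0,T]\times L^p\times\mathbb R^d\to\mathbb R$, be such that the forward integral $$\int_0^t{}_q\langle DF(s,X_s,X(s)),dX_s\rangle_p:=\lim_{\epsilon\searrow0}\frac1\epsilon\int_0^t{}_q\langle DF(s,X_s,X(s)),X_{s+\epsilon}-X_s\rangle_p\,ds$$ is well defined as a limit in probability uniformly on compacts. Assume additionally that $X_s\in W^{1,p}([-r,0];\mathbb R^d)$ for every $s\in[0,T]$. Then, $P$-a.s., $$\int_0^t{}_q\langle DF(s,X_s,X(s)),dX_s\rangle_p=\int_0^t{}_q\langle DF(s,X_s,X(s)),\nabla_\theta^+X_s\rangle_p\,ds=\int_0^t\mathcal SF(s,X_s,X(s))\,ds.$$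
   Context: Fix $T\in(0,\infty)$ and a finite delay $r>0$. $(\Omega,\mathcal F,\mathbb F=\{\mathcal F_t\}_{t\in[0,T]},P)$ is a complete filtered probability space satisfying the usual hypotheses, $\mathcal F_s:=\mathcal F_0$ for $s\in[-r,0]$. $W$ is an $m$-dimensional Brownian motion with respect to $\mathbb F$; $N=(N^1,\dots,N^n)^{\mathsf T}$ are the jump measures of $n$ independent Lévy processes with respect to $\mathbb F$, with Lévy measures $\nu=(\nu_1,\dots,\nu_n)$ on $\mathbb R_0=\mathbb R\setminus\{0\}$; $\tilde N^j(dt,dz)=N^j(dt,dz)-\nu_j(dz)dt$. $L^p:=L^p([-r,0];\mathbb R^d)$, $M^p:=L^p\times\mathbb R^d$ with $\|(\eta,v)\|^p_{M^p}=\|\eta\|^p_{L^p}+|v|^p$; $L^q$ is identified with $(L^p)^*$ through ${}_q\langle a,b\rangle_p=\int_{-r}^0a(\theta)\cdot b(\theta)d\theta$. The segment of a process $Y$ is $Y_t(\theta)=Y(t+\theta)$, $\theta\in[-r,0]$. $X$ is extended by $X(t):=X(T)$ for $t>T$ and taken càdlàg on $[0,T]$. $\nabla_\theta^+\psi$ denotes the (componentwise) right weak derivative of $\psi\in W^{1,p}([-r,0];\mathbb R^d)$. Standing assumptions on $f,g,h$. For every adapted $Y$ with $E\int_{-r}^T|Y(t)|^pdt<\infty$, $h(t,Y_t,Y(t))(z)$ has a predictable version and $f(t,Y_t,Y(t))$, $g(t,Y_t,Y(t))$ have progressively measurable versions. There are $L,K>0$ such that for all $t\in[0,T]$ and all $\mathcal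 F_t$-measurable $M^p$-valued $\Xi_i=(\eta_i,x_i)$ with $E\|\Xi_i\|_{M^p}^p<\infty$, $i=1,2$, $\|f(t,\Xi_1)-f(t,\Xi_2)\|^p_{L^p(\Omega)}+\|g(t,\Xi_1)-g(t,\Xi_2)\|^p_{L^p(\Omega)}+\|h(t,\Xi_1)-h(t,\Xi_2)\|^p_{L^p(\Omega,L^p(\nu))}+\|h(t,\Xi_1)-h(t,\Xi_2)\|^p_{L^p(\Omega,L^2(\nu))}\le L\,E\|\Xi_1-\Xi_2\|^p_{M^p}$ and $\|f(t,\Xi_1)\|^p_{L^p(\Omega)}+\|g(t,\Xi_1)\|^p_{L^p(\Omega)}+\|h(t,\Xi_1)\|^p_{L^p(\Omega,L^p(\nu))}+\|h(t,\Xi_1)\|^p_{L^p(\Omega,L^2(\nu))}\le K(1+E\|\Xi_1\|^p_{M^p})$. Here $\|H\|^a_{L^a(\nu)}=\sum_{j}\|H^{,j}\|^a_{L^a(\nu_j,\mathbb R^d)}$ ($H^{,j}$ the $j$-th column) and $\|\mathcal H\|^p_{L^p(\Omega,L^a(\nu))}=E[\|\mathcal H\|^p_{L^a(\nu)}]$. Under these assumptions the equation has a unique strong solution, i.e. an adapted $X$ with $E\int_{-r}^T|X(t)|^pdt<\infty$ satisfying the integral form of the equation (with progressive/predictable versions of the integrands). $F\in C^{1,1,2}([0,T]\times L^p\times\mathbb R^d)$ means: $F$ is continuously differentiable in $t$, Fréchet differentiable with continuous derivative in the second variable (derivative $DF(t,\psi,v)\in(L^p)^*\cong L^q$), and twice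 continuously differentiable in the third variable, all these derivatives being continuous on $[0,T]\times L^p\times\mathbb R^d$. Convergence uniformly on compacts in probability of $Z^\epsilon\to Z$ means $\sup_{0\le s\le t}|Z^\epsilon(s)-Z(s)|\to0$ in probability for each $t\in[0,T]$. The operator $\mathcal S$ is the generator of the left-shift semigroup acting on the segment variable: for $(\psi,v)\in M^p$ let $\tilde\psi(\theta)=\psi(\theta)$ for $\theta\in[-r,0)$, $\tilde\psi(\theta)=v$ for $\theta\ge0$, and $\tilde\psi_\epsilon(\theta)=\tilde\psi(\theta+\epsilon)$, $\theta\in[-r,0]$; then $\mathcal SF(s,\psi,v):=\lim_{\epsilon\downarrow0}\frac1\epsilon\big[F(s,\tilde\psi_\epsilon,v)-F(s,\psi,v)\big]$ whenever the limit exists. *)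

theory Defs
  imports "HOL-Probability.Probability"
begin

section \<open>The spaces \<open>L\<^sup>p\<close> and \<open>M\<^sup>p\<close>\<close>

text \<open>Elements of \<open>L\<^sup>p([-r,0])\<close> are represented by functions on the real line; only their values
  on \<open>[-r,0]\<close>, up to Lebesgue-null sets, matter.  Functionals on \<open>L\<^sup>p\<close> are functionals on
  representatives.  That they respect almost-everywhere equality need not be imposed separately: it
  follows from Frechet differentiability for \<open>F\<close> (see \<open>has_Lp_deriv\<close>) and from the Lipschitz condition,
  applied to constant random variables, for \<open>f\<close>, \<open>g\<close>, \<open>h\<close>.\<close>

definition Lp :: "real \<Rightarrow> real \<Rightarrow> (real \<Rightarrow> 'b::euclidean_space) set" where
  "Lp p r = {\<psi>. \<psi> \<in> borel_measurable (lebesgue_on {-r..0}) \<and>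
                 integrable (lebesgue_on {-r..0}) (\<lambda>\<theta>. norm (\<psi> \<theta>) powr p)}"

definition Lp_norm :: "real \<Rightarrow> real \<Rightarrow> (real \<Rightarrow> 'b::euclidean_space) \<Rightarrow> real" where
  "Lp_norm p r \<psi> = (LINT \<theta>|lebesgue_on {-r..0}. norm (\<psi> \<theta>) powr p) powr (1 / p)"

definition Lp_dist ::
    "real \<Rightarrow> real \<Rightarrow> (real \<Rightarrow> 'b::euclidean_space) \<Rightarrow> (real \<Rightarrow> 'b) \<Rightarrow> real" where
  "Lp_dist p r \<phi> \<psi> = Lp_norm p r (\<lambda>\<theta>. \<phi> \<theta> - \<psi> \<theta>)"

definition pairing ::
    "real \<Rightarrow> (real \<Rightarrow> 'b::euclidean_space) \<Rightarrow> (real \<Rightarrow> 'b) \<Rightarrow> real" where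
  "pairing r a b = (LINT \<theta>|lebesgue_on {-r..0}. a \<theta> \<bullet> b \<theta>)"

definition Mp_norm ::
    "real \<Rightarrow> real \<Rightarrow> (real \<Rightarrow> 'b::euclidean_space) \<Rightarrow> 'b \<Rightarrow> real" where
  "Mp_norm p r \<psi> v = (Lp_norm p r \<psi> powr p + norm v powr p) powr (1 / p)"

definition Mp_open ::
    "real \<Rightarrow> real \<Rightarrow> ((real \<Rightarrow> 'b::euclidean_space) \<times> 'b) set \<Rightarrow> bool" where
  "Mp_open p r U \<longleftrightarrow> U \<subseteq> Lp p r \<times> UNIV \<and>
     (\<forall>(\<psi>, v)\<in>U. \<exists>e>0. \<forall>\<psi>'\<in>Lp p r. \<forall>v'.
        Mp_norm p r (\<lambda>\<theta>. \<psi>' \<theta> - \<psi> \<theta>) (v' - v) < e \<longrightarrow> (\<psi>', v') \<in> U)"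

definition Mp_borel ::
    "real \<Rightarrow> real \<Rightarrow> ((real \<Rightarrow> 'b::euclidean_space) \<times> 'b) measure" where
  "Mp_borel p r = sigma (Lp p r \<times> UNIV) {U. Mp_open p r U}"

definition segment :: "(real \<Rightarrow> 'a \<Rightarrow> 'b) \<Rightarrow> real \<Rightarrow> 'a \<Rightarrow> real \<Rightarrow> 'b" where
  "segment Y t \<omega> = (\<lambda>\<theta>. Y (t + \<theta>) \<omega>)"


section \<open>Weak derivatives\<close>

text \<open>\<open>W\<^sup>1\<^sup>,\<^sup>p\<close> is defined with continuously differentiable test functions of compact support in the
  open interval, as in Brezis (\<open>C\<close>-infinity test functions give the same space).  Passing
  a one-sided derivative onto a differentiable test function produces the ordinary derivative of
  the latter, so the right weak derivative is characterised by the same integration-by-parts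
  identity as the weak derivative.\<close>

definition test_function :: "real \<Rightarrow> (real \<Rightarrow> real) \<Rightarrow> bool" where
  "test_function r \<phi> \<longleftrightarrow> (\<forall>x. \<phi> differentiable (at x)) \<and> continuous_on UNIV (deriv \<phi>) \<and>
     compact (closure {x. \<phi> x \<noteq> 0}) \<and> closure {x. \<phi> x \<noteq> 0} \<subseteq> {-r<..<0}"

definition has_weak_deriv ::
    "real \<Rightarrow> (real \<Rightarrow> 'b::euclidean_space) \<Rightarrow> (real \<Rightarrow> 'b) \<Rightarrow> bool" where
  "has_weak_deriv r \<psi> u \<longleftrightarrow> (\<forall>\<phi>. test_function r \<phi> \<longrightarrow>
     (LINT \<theta>|lebesgue_on {-r..0}. deriv \<phi> \<theta> *\<^sub>R \<psi> \<theta>) =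
     - (LINT \<theta>|lebesgue_on {-r..0}. \<phi> \<theta> *\<^sub>R u \<theta>))"

definition W1p :: "real \<Rightarrow> real \<Rightarrow> (real \<Rightarrow> 'b::euclidean_space) set" where
  "W1p p r = {\<psi> \<in> Lp p r. \<exists>u\<in>Lp p r. has_weak_deriv r \<psi> u}"

definition weak_deriv ::
    "real \<Rightarrow> real \<Rightarrow> (real \<Rightarrow> 'b::euclidean_space) \<Rightarrow> real \<Rightarrow> 'b" where
  "weak_deriv p r \<psi> = (SOME u. u \<in> Lp p r \<and> has_weak_deriv r \<psi> u)"


section \<open>Functionals of class \<open>C\<^sup>1\<^sup>,\<^sup>1\<^sup>,\<^sup>2\<close>\<close>

text \<open>Frechet derivative in the \<open>L\<^sup>p\<close>-variable, represented by \<open>a \<in> L\<^sup>q\<close>.  The case of an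
  increment \<open>\<phi>\<close> of norm zero shows that \<open>G\<close> does not distinguish a.e. equal arguments.\<close>

definition has_Lp_deriv ::
    "real \<Rightarrow> real \<Rightarrow> ((real \<Rightarrow> 'b::euclidean_space) \<Rightarrow> real) \<Rightarrow> (real \<Rightarrow> 'b) \<Rightarrow> (real \<Rightarrow> 'b) \<Rightarrow> bool"
  where
  "has_Lp_deriv p r G a \<psi> \<longleftrightarrow> (\<forall>e>0. \<exists>c>0. \<forall>\<phi>\<in>Lp p r. Lp_norm p r \<phi> < c \<longrightarrow>
     \<bar>G (\<lambda>\<theta>. \<psi> \<theta> + \<phi> \<theta>) - G \<psi> - pairing r a \<phi>\<bar> \<le> e * Lp_norm p r \<phi>)"

definition Lp_deriv ::
    "real \<Rightarrow> real \<Rightarrow> real \<Rightarrow> ((real \<Rightarrow> 'b::euclidean_space) \<Rightarrow> real) \<Rightarrow> (real \<Rightarrow> 'b) \<Rightarrow> real \<Rightarrow> 'b"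
  where
  "Lp_deriv p q r G \<psi> = (SOME a. a \<in> Lp q r \<and> has_Lp_deriv p r G a \<psi>)"

text \<open>Continuity on \<open>[0,T] \<times> L\<^sup>p \<times> \<real>\<^sup>d\<close>, with the distance \<open>\<delta>\<close> on the codomain.\<close>

definition jointly_continuous ::
    "real \<Rightarrow> real \<Rightarrow> real \<Rightarrow> ('c \<Rightarrow> 'c \<Rightarrow> real)
      \<Rightarrow> (real \<Rightarrow> (real \<Rightarrow> 'b::euclidean_space) \<Rightarrow> 'b \<Rightarrow> 'c) \<Rightarrow> bool" where
  "jointly_continuous p r T \<delta> G \<longleftrightarrow>
     (\<forall>t\<in>{0..T}. \<forall>\<psi>\<in>Lp p r. \<forall>v. \<forall>e>0. \<exists>c>0. \<forall>t'\<in>{0..T}. \<forall>\<psi>'\<in>Lp p r. \<forall>v'.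
        \<bar>t' - t\<bar> < c \<and> Lp_dist p r \<psi>' \<psi> < c \<and> dist v' v < c \<longrightarrow> \<delta> (G t' \<psi>' v') (G t \<psi> v) < e)"

definition C112 ::
    "real \<Rightarrow> real \<Rightarrow> real \<Rightarrow> real \<Rightarrow> (real \<Rightarrow> (real \<Rightarrow> real^'d) \<Rightarrow> real^'d \<Rightarrow> real) \<Rightarrow> bool" where
  "C112 p q r T F \<longleftrightarrow>
     (\<exists>Ft. jointly_continuous p r T dist Ft \<and>
        (\<forall>t\<in>{0..T}. \<forall>\<psi>\<in>Lp p r. \<forall>v.
           ((\<lambda>s. F s \<psi> v) has_real_derivative Ft t \<psi> v) (at t within {0..T}))) \<and>
     (\<forall>t\<in>{0..T}. \<forall>\<psi>\<in>Lp p r. \<forall>v. \<exists>a\<in>Lp q r. has_Lp_deriv p r (\<lambda>\<phi>. F t \<phi> v) a \<psi>) \<and>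
     jointly_continuous p r T (Lp_dist q r) (\<lambda>t \<psi> v. Lp_deriv p q r (\<lambda>\<phi>. F t \<phi> v) \<psi>) \<and>
     (\<exists>Fv Fvv. jointly_continuous p r T dist Fv \<and> jointly_continuous p r T dist Fvv \<and>
        (\<forall>t\<in>{0..T}. \<forall>\<psi>\<in>Lp p r. \<forall>v.
           ((\<lambda>w. F t \<psi> w) has_derivative (\<lambda>k. (Fv t \<psi> v :: real^'d) \<bullet> k)) (at v) \<and>
           ((\<lambda>w. Fv t \<psi> w) has_derivative (\<lambda>k. (Fvv t \<psi> v :: real^'d^'d) *v k)) (at v)))"


section \<open>The generator of the left shift\<close>

definition left_shift :: "(real \<Rightarrow> 'b) \<Rightarrow> 'b \<Rightarrow> real \<Rightarrow> real \<Rightarrow> 'b" where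
  "left_shift \<psi> v \<epsilon> = (\<lambda>\<theta>. if \<theta> + \<epsilon> < 0 then \<psi> (\<theta> + \<epsilon>) else v)"

definition has_shift_gen ::
    "(real \<Rightarrow> (real \<Rightarrow> 'b) \<Rightarrow> 'b \<Rightarrow> real) \<Rightarrow> real \<Rightarrow> (real \<Rightarrow> 'b) \<Rightarrow> 'b \<Rightarrow> real \<Rightarrow> bool" where
  "has_shift_gen F s \<psi> v l \<longleftrightarrow>
     ((\<lambda>\<epsilon>. (F s (left_shift \<psi> v \<epsilon>) v - F s \<psi> v) / \<epsilon>) \<longlongrightarrow> l) (at_right 0)"

definition shift_gen ::
    "(real \<Rightarrow> (real \<Rightarrow> 'b) \<Rightarrow> 'b \<Rightarrow> real) \<Rightarrow> real \<Rightarrow> (real \<Rightarrow> 'b) \<Rightarrow> 'b \<Rightarrow> real" where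
  "shift_gen F s \<psi> v = (THE l. has_shift_gen F s \<psi> v l)"


section \<open>Filtrations and measurability of processes\<close>

text \<open>A filtration is indexed by all reals as in the library.  It is constant on \<open>[-r,0]\<close>; its
  members with indices outside \<open>[-r,T]\<close> play no role.\<close>

definition usual_filtration :: "real \<Rightarrow> real \<Rightarrow> 'a measure \<Rightarrow> (real \<Rightarrow> 'a measure) \<Rightarrow> bool" where
  "usual_filtration r T M \<F> \<longleftrightarrow> filtration (space M) \<F> \<and>
     (\<forall>t. subalgebra M (\<F> t)) \<and>
     (\<forall>t\<in>{-r..0}. sets (\<F> t) = sets (\<F> 0)) \<and>
     null_sets M \<subseteq> sets (\<F> 0) \<and>
     (\<forall>t\<in>{0..<T}. sets (\<F> t) = (\<Inter>u\<in>{t<..T}. sets (\<F> u)))"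

definition adapted :: "real \<Rightarrow> real \<Rightarrow> (real \<Rightarrow> 'a measure) \<Rightarrow> (real \<Rightarrow> 'a \<Rightarrow> 'b::topological_space) \<Rightarrow> bool"
  where
  "adapted a T \<F> Y \<longleftrightarrow> (\<forall>t\<in>{a..T}. Y t \<in> borel_measurable (\<F> t))"

definition progressive :: "real \<Rightarrow> (real \<Rightarrow> 'a measure) \<Rightarrow> (real \<Rightarrow> 'a \<Rightarrow> 'b::topological_space) \<Rightarrow> bool"
  where
  "progressive T \<F> Y \<longleftrightarrow>
     (\<forall>t\<in>{0..T}. (\<lambda>(s, \<omega>). Y s \<omega>) \<in> borel_measurable (restrict_space borel {0..t} \<Otimes>\<^sub>M \<F> t))"

definition predictable_sigma :: "real \<Rightarrow> 'a measure \<Rightarrow> (real \<Rightarrow> 'a measure) \<Rightarrow> (real \<times> 'a) measure" where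
  "predictable_sigma T M \<F> = sigma ({0..T} \<times> space M)
     ({{0} \<times> A | A. A \<in> sets (\<F> 0)} \<union>
      {{s<..t} \<times> A | s t A. 0 \<le> s \<and> s \<le> t \<and> t \<le> T \<and> A \<in> sets (\<F> s)})"

definition R0 :: "real measure" where
  "R0 = restrict_space borel (- {0})"

definition predictable ::
    "real \<Rightarrow> 'a measure \<Rightarrow> (real \<Rightarrow> 'a measure) \<Rightarrow> (real \<Rightarrow> 'a \<Rightarrow> real \<Rightarrow> 'b::topological_space) \<Rightarrow> bool"
  where
  "predictable T M \<F> H \<longleftrightarrow>
     (\<lambda>((t, \<omega>), z). H t \<omega> z) \<in> borel_measurable (predictable_sigma T M \<F> \<Otimes>\<^sub>M R0)"

definition cadlag_on :: "real \<Rightarrow> (real \<Rightarrow> 'b::topological_space) \<Rightarrow> bool" where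
  "cadlag_on T y \<longleftrightarrow>
     (\<forall>t\<in>{0..<T}. (y \<longlongrightarrow> y t) (at_right t)) \<and> (\<forall>t\<in>{0<..T}. \<exists>l. (y \<longlongrightarrow> l) (at_left t))"

text \<open>Adapted (and jointly measurable) processes \<open>Y\<close> on \<open>[-r,T]\<close> with
  \<open>E \<integral> |Y(t)|\<^sup>p dt < \<infinity>\<close>.\<close>

definition Lp_adapted ::
    "real \<Rightarrow> real \<Rightarrow> real \<Rightarrow> 'a measure \<Rightarrow> (real \<Rightarrow> 'a measure) \<Rightarrow> (real \<Rightarrow> 'a \<Rightarrow> 'b::euclidean_space) \<Rightarrow> bool"
  where
  "Lp_adapted p r T M \<F> Y \<longleftrightarrow> adapted (-r) T \<F> Y \<and>
     (\<lambda>(t, \<omega>). Y t \<omega>) \<in> borel_measurable (lebesgue_on {-r..T} \<Otimes>\<^sub>M M) \<and>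
     (\<integral>\<^sup>+\<omega>. (\<integral>\<^sup>+t. ennreal (norm (Y t \<omega>) powr p) \<partial>lebesgue_on {-r..T}) \<partial>M) < \<infinity>"


section \<open>Brownian motion, Levy processes and their jump measures\<close>

definition indep_of :: "'a measure \<Rightarrow> 'a measure \<Rightarrow> ('a \<Rightarrow> 'b::topological_space) \<Rightarrow> bool" where
  "indep_of M A Y \<longleftrightarrow>
     prob_space.indep_set M (sets A) {Y -` B \<inter> space M | B. B \<in> sets borel}"

definition brownian_motion ::
    "real \<Rightarrow> 'a measure \<Rightarrow> (real \<Rightarrow> 'a measure) \<Rightarrow> (real \<Rightarrow> 'a \<Rightarrow> real^'m) \<Rightarrow> bool" where
  "brownian_motion T M \<F> W \<longleftrightarrow> adapted 0 T \<F> W \<and>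
     (AE \<omega> in M. W 0 \<omega> = 0) \<and>
     (AE \<omega> in M. continuous_on {0..T} (\<lambda>t. W t \<omega>)) \<and>
     (\<forall>s t. 0 \<le> s \<and> s < t \<and> t \<le> T \<longrightarrow>
        indep_of M (\<F> s) (\<lambda>\<omega>. W t \<omega> - W s \<omega>) \<and>
        prob_space.indep_vars M (\<lambda>_. borel) (\<lambda>i \<omega>. (W t \<omega> - W s \<omega>) $ i) UNIV \<and>
        (\<forall>i. distributed M lborel (\<lambda>\<omega>. (W t \<omega> - W s \<omega>) $ i)
               (\<lambda>x. ennreal (normal_density 0 (sqrt (t - s)) x))))"

definition levy_process ::
    "real \<Rightarrow> 'a measure \<Rightarrow> (real \<Rightarrow> 'a measure) \<Rightarrow> (real \<Rightarrow> 'a \<Rightarrow> real) \<Rightarrow> bool" where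
  "levy_process T M \<F> Z \<longleftrightarrow> adapted 0 T \<F> Z \<and>
     (AE \<omega> in M. Z 0 \<omega> = 0) \<and>
     (AE \<omega> in M. cadlag_on T (\<lambda>t. Z t \<omega>)) \<and>
     (\<forall>s t. 0 \<le> s \<and> s \<le> t \<and> t \<le> T \<longrightarrow>
        indep_of M (\<F> s) (\<lambda>\<omega>. Z t \<omega> - Z s \<omega>) \<and>
        distr M borel (\<lambda>\<omega>. Z t \<omega> - Z s \<omega>) = distr M borel (Z (t - s)))"

definition jump :: "(real \<Rightarrow> real) \<Rightarrow> real \<Rightarrow> real" where
  "jump y s = y s - Lim (at_left s) y"

text \<open>The counting measure of the points \<open>(s, \<Delta>y(s))\<close>, \<open>0 < s \<le> T\<close>, \<open>\<Delta>y(s) \<noteq> 0\<close>.\<close>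

definition jump_measure :: "real \<Rightarrow> (real \<Rightarrow> real) \<Rightarrow> (real \<times> real) measure" where
  "jump_measure T y =
     distr (count_space {s \<in> {0<..T}. jump y s \<noteq> 0}) (borel \<Otimes>\<^sub>M R0) (\<lambda>s. (s, jump y s))"

definition levy_measure_of :: "real \<Rightarrow> 'a measure \<Rightarrow> (real \<Rightarrow> 'a \<Rightarrow> real) \<Rightarrow> real measure \<Rightarrow> bool" where
  "levy_measure_of T M Z \<nu> \<longleftrightarrow> sets \<nu> = sets R0 \<and>
     (\<forall>A\<in>sets R0. \<forall>t\<in>{0..T}.
        (\<integral>\<^sup>+\<omega>. emeasure (jump_measure T (\<lambda>s. Z s \<omega>)) ({0<..t} \<times> A) \<partial>M) = ennreal t * emeasure \<nu> A)"

definition independent_processes :: "real \<Rightarrow> 'a measure \<Rightarrow> ('j \<Rightarrow> real \<Rightarrow> 'a \<Rightarrow> real) \<Rightarrow> bool" where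
  "independent_processes T M Z \<longleftrightarrow>
     prob_space.indep_vars M (\<lambda>_. Pi\<^sub>M {0..T} (\<lambda>_. borel)) (\<lambda>j \<omega>. \<lambda>t\<in>{0..T}. Z j t \<omega>) UNIV"

text \<open>The vector of the compensated measures \<open>\<N> j ((a,b] \<times> A) - (b - a) \<nu>\<^sub>j(A)\<close>.\<close>

definition compensated ::
    "('n \<Rightarrow> (real \<times> real) measure) \<Rightarrow> ('n \<Rightarrow> real measure) \<Rightarrow> real \<Rightarrow> real \<Rightarrow> real set \<Rightarrow> real^'n" where
  "compensated \<N> \<nu> a b A = (\<chi> j. measure (\<N> j) ({a<..b} \<times> A) - (b - a) * measure (\<nu> j) A)"


section \<open>Stochastic integrals\<close>

text \<open>A simple integrand is a finite sum of terms \<open>1\<^bsub>(a i, b i]\<^esub>(s) \<xi> i\<close> with bounded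
  \<open>\<F> (a i)\<close>-measurable \<open>\<xi> i\<close>; in the jump case each term carries an additional factor
  \<open>1\<^bsub>A i\<^esub>(z)\<close> with \<open>A i\<close> bounded away from zero.  The stochastic integrals are the \<open>L\<^sup>2(\<Omega>)\<close>-limits
  of the integrals of simple integrands approximating the integrand in \<open>L\<^sup>2\<close>.\<close>

definition simple_coeffs ::
    "real \<Rightarrow> 'a measure \<Rightarrow> (real \<Rightarrow> 'a measure) \<Rightarrow> nat \<Rightarrow> (nat \<Rightarrow> real) \<Rightarrow> (nat \<Rightarrow> real)
      \<Rightarrow> (nat \<Rightarrow> 'a \<Rightarrow> 'b::real_normed_vector) \<Rightarrow> bool" where
  "simple_coeffs T M \<F> k a b \<xi> \<longleftrightarrow>
     (\<forall>i<k. 0 \<le> a i \<and> a i \<le> b i \<and> b i \<le> T \<and>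
        \<xi> i \<in> borel_measurable (\<F> (a i)) \<and> bounded (\<xi> i ` space M))"

definition is_brownian_integral ::
    "real \<Rightarrow> 'a measure \<Rightarrow> (real \<Rightarrow> 'a measure) \<Rightarrow> (real \<Rightarrow> 'a \<Rightarrow> real^'m)
      \<Rightarrow> (real \<Rightarrow> 'a \<Rightarrow> real^'m^'d) \<Rightarrow> (real \<Rightarrow> 'a \<Rightarrow> real^'d) \<Rightarrow> bool" where
  "is_brownian_integral T M \<F> W G I \<longleftrightarrow> adapted 0 T \<F> I \<and>
     (AE \<omega> in M. continuous_on {0..T} (\<lambda>t. I t \<omega>)) \<and>
     (\<exists>k a b \<xi>. (\<forall>l. simple_coeffs T M \<F> (k l) (a l) (b l) (\<xi> l)) \<and>
        ((\<lambda>l::nat. \<integral>\<^sup>+\<omega>. (\<integral>\<^sup>+s. ennreal ((norm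
             ((\<Sum>i<k l. indicator {a l i<..b l i} s *\<^sub>R \<xi> l i \<omega>) - G s \<omega>))\<^sup>2)
             \<partial>lebesgue_on {0..T}) \<partial>M) \<longlonglongrightarrow> 0) \<and>
        (\<forall>t\<in>{0..T}. ((\<lambda>l. \<integral>\<^sup>+\<omega>. ennreal ((norm
             ((\<Sum>i<k l. \<xi> l i \<omega> *v (W (min t (b l i)) \<omega> - W (min t (a l i)) \<omega>)) - I t \<omega>))\<^sup>2)
             \<partial>M) \<longlonglongrightarrow> 0)))"

definition is_jump_integral ::
    "real \<Rightarrow> 'a measure \<Rightarrow> (real \<Rightarrow> 'a measure) \<Rightarrow> ('n \<Rightarrow> 'a \<Rightarrow> (real \<times> real) measure)
      \<Rightarrow> ('n \<Rightarrow> real measure) \<Rightarrow> (real \<Rightarrow> 'a \<Rightarrow> real \<Rightarrow> real^'n^'d) \<Rightarrow> (real \<Rightarrow> 'a \<Rightarrow> real^'d) \<Rightarrow> bool" where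
  "is_jump_integral T M \<F> \<N> \<nu> H J \<longleftrightarrow> adapted 0 T \<F> J \<and>
     (AE \<omega> in M. cadlag_on T (\<lambda>t. J t \<omega>)) \<and>
     (\<exists>k a b A \<xi>. (\<forall>l. simple_coeffs T M \<F> (k l) (a l) (b l) (\<xi> l) \<and>
           (\<forall>i<k l. A l i \<in> sets R0 \<and> 0 \<notin> closure (A l i))) \<and>
        ((\<lambda>l::nat. \<integral>\<^sup>+\<omega>. (\<integral>\<^sup>+s. (\<Sum>j\<in>UNIV. \<integral>\<^sup>+z. ennreal ((norm (column j
             ((\<Sum>i<k l. (indicator {a l i<..b l i} s * indicator (A l i) z) *\<^sub>R \<xi> l i \<omega>) - H s \<omega> z)))\<^sup>2)
             \<partial>\<nu> j) \<partial>lebesgue_on {0..T}) \<partial>M) \<longlonglongrightarrow> 0) \<and>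
        (\<forall>t\<in>{0..T}. ((\<lambda>l. \<integral>\<^sup>+\<omega>. ennreal ((norm
             ((\<Sum>i<k l. \<xi> l i \<omega> *v
                 compensated (\<lambda>j. \<N> j \<omega>) \<nu> (min t (a l i)) (min t (b l i)) (A l i)) - J t \<omega>))\<^sup>2)
             \<partial>M) \<longlonglongrightarrow> 0)))"


section \<open>The stochastic functional differential equation\<close>

text \<open>A version of an integrand is a process that agrees with it \<open>dt \<otimes> P\<close>-almost everywhere.\<close>

definition is_version ::
    "real \<Rightarrow> 'a measure \<Rightarrow> (real \<Rightarrow> (real \<Rightarrow> 'b) \<Rightarrow> 'b \<Rightarrow> 'c) \<Rightarrow> (real \<Rightarrow> 'a \<Rightarrow> 'b)
      \<Rightarrow> (real \<Rightarrow> 'a \<Rightarrow> 'c) \<Rightarrow> bool" where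
  "is_version T M f Y f' \<longleftrightarrow>
     (AE (t, \<omega>) in lebesgue_on {0..T} \<Otimes>\<^sub>M M. f' t \<omega> = f t (segment Y t \<omega>) (Y t \<omega>))"

definition is_jump_version ::
    "real \<Rightarrow> 'a measure \<Rightarrow> ('n \<Rightarrow> real measure) \<Rightarrow> (real \<Rightarrow> (real \<Rightarrow> 'b) \<Rightarrow> 'b \<Rightarrow> real \<Rightarrow> real^'n^'d)
      \<Rightarrow> (real \<Rightarrow> 'a \<Rightarrow> 'b) \<Rightarrow> (real \<Rightarrow> 'a \<Rightarrow> real \<Rightarrow> real^'n^'d) \<Rightarrow> bool" where
  "is_jump_version T M \<nu> h Y h' \<longleftrightarrow>
     (AE (t, \<omega>) in lebesgue_on {0..T} \<Otimes>\<^sub>M M. \<forall>j. AE z in \<nu> j.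
        column j (h' t \<omega> z) = column j (h t (segment Y t \<omega>) (Y t \<omega>) z))"

definition ennreal_powr :: "ennreal \<Rightarrow> real \<Rightarrow> ennreal" where
  "ennreal_powr x a = (if x = \<infinity> then \<infinity> else ennreal (enn2real x powr a))"

text \<open>\<open>E |Y|\<^sup>p\<close>\<close>

definition E_powr :: "'a measure \<Rightarrow> real \<Rightarrow> ('a \<Rightarrow> 'b::real_normed_vector) \<Rightarrow> ennreal" where
  "E_powr M p Y = (\<integral>\<^sup>+\<omega>. ennreal (norm (Y \<omega>) powr p) \<partial>M)"

text \<open>\<open>nu_powr\<close> is the \<open>a\<close>-th power of the \<open>L\<^sup>a(\<nu>)\<close>-norm, \<open>E_nu_powr\<close> the \<open>p\<close>-th power of the
  \<open>L\<^sup>p(\<Omega>, L\<^sup>a(\<nu>))\<close>-norm.\<close>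

definition nu_powr :: "('n::finite \<Rightarrow> real measure) \<Rightarrow> real \<Rightarrow> (real \<Rightarrow> real^'n^'d) \<Rightarrow> ennreal" where
  "nu_powr \<nu> a H = (\<Sum>j\<in>UNIV. \<integral>\<^sup>+z. ennreal (norm (column j (H z)) powr a) \<partial>\<nu> j)"

definition E_nu_powr ::
    "'a measure \<Rightarrow> ('n::finite \<Rightarrow> real measure) \<Rightarrow> real \<Rightarrow> real \<Rightarrow> ('a \<Rightarrow> real \<Rightarrow> real^'n^'d) \<Rightarrow> ennreal" where
  "E_nu_powr M \<nu> p a H = (\<integral>\<^sup>+\<omega>. ennreal_powr (nu_powr \<nu> a (H \<omega>)) (p / a) \<partial>M)"

text \<open>\<open>E \<parallel>(\<eta>, x)\<parallel>\<^sup>p\<close> in the norm of \<open>M\<^sup>p\<close>\<close>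

definition E_Mp_powr ::
    "'a measure \<Rightarrow> real \<Rightarrow> real \<Rightarrow> ('a \<Rightarrow> real \<Rightarrow> 'b::euclidean_space) \<Rightarrow> ('a \<Rightarrow> 'b) \<Rightarrow> ennreal" where
  "E_Mp_powr M p r \<eta> x = (\<integral>\<^sup>+\<omega>. ennreal (Mp_norm p r (\<eta> \<omega>) (x \<omega>) powr p) \<partial>M)"

definition Mp_rv ::
    "real \<Rightarrow> real \<Rightarrow> 'a measure \<Rightarrow> 'a measure
      \<Rightarrow> ('a \<Rightarrow> real \<Rightarrow> 'b::euclidean_space) \<Rightarrow> ('a \<Rightarrow> 'b) \<Rightarrow> bool" where
  "Mp_rv p r M A \<eta> x \<longleftrightarrow> (\<lambda>\<omega>. (\<eta> \<omega>, x \<omega>)) \<in> A \<rightarrow>\<^sub>M Mp_borel p r \<and> E_Mp_powr M p r \<eta> x < \<infinity>"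

definition standing_assumptions ::
    "real \<Rightarrow> real \<Rightarrow> real \<Rightarrow> 'a measure \<Rightarrow> (real \<Rightarrow> 'a measure) \<Rightarrow> ('n \<Rightarrow> real measure)
      \<Rightarrow> (real \<Rightarrow> (real \<Rightarrow> real^'d) \<Rightarrow> real^'d \<Rightarrow> real^'d)
      \<Rightarrow> (real \<Rightarrow> (real \<Rightarrow> real^'d) \<Rightarrow> real^'d \<Rightarrow> real^'m^'d)
      \<Rightarrow> (real \<Rightarrow> (real \<Rightarrow> real^'d) \<Rightarrow> real^'d \<Rightarrow> real \<Rightarrow> real^'n^'d) \<Rightarrow> bool" where
  "standing_assumptions p r T M \<F> \<nu> f g h \<longleftrightarrow>
     (\<forall>t\<in>{0..T}. \<forall>\<psi>\<in>Lp p r. \<forall>v. h t \<psi> v \<in> borel_measurable R0) \<and>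
     (\<forall>Y. Lp_adapted p r T M \<F> Y \<longrightarrow>
        (\<exists>h'. predictable T M \<F> h' \<and> is_jump_version T M \<nu> h Y h') \<and>
        (\<exists>f'. progressive T \<F> f' \<and> is_version T M f Y f') \<and>
        (\<exists>g'. progressive T \<F> g' \<and> is_version T M g Y g')) \<and>
     (\<exists>L>0. \<forall>t\<in>{0..T}. \<forall>\<eta>1 x1 \<eta>2 x2. Mp_rv p r M (\<F> t) \<eta>1 x1 \<and> Mp_rv p r M (\<F> t) \<eta>2 x2 \<longrightarrow>
        E_powr M p (\<lambda>\<omega>. f t (\<eta>1 \<omega>) (x1 \<omega>) - f t (\<eta>2 \<omega>) (x2 \<omega>)) +
        E_powr M p (\<lambda>\<omega>. g t (\<eta>1 \<omega>) (x1 \<omega>) - g t (\<eta>2 \<omega>) (x2 \<omega>)) +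
        E_nu_powr M \<nu> p p (\<lambda>\<omega> z. h t (\<eta>1 \<omega>) (x1 \<omega>) z - h t (\<eta>2 \<omega>) (x2 \<omega>) z) +
        E_nu_powr M \<nu> p 2 (\<lambda>\<omega> z. h t (\<eta>1 \<omega>) (x1 \<omega>) z - h t (\<eta>2 \<omega>) (x2 \<omega>) z)
        \<le> ennreal L * E_Mp_powr M p r (\<lambda>\<omega> \<theta>. \<eta>1 \<omega> \<theta> - \<eta>2 \<omega> \<theta>) (\<lambda>\<omega>. x1 \<omega> - x2 \<omega>)) \<and>
     (\<exists>K>0. \<forall>t\<in>{0..T}. \<forall>\<eta> x. Mp_rv p r M (\<F> t) \<eta> x \<longrightarrow>
        E_powr M p (\<lambda>\<omega>. f t (\<eta> \<omega>) (x \<omega>)) + E_powr M p (\<lambda>\<omega>. g t (\<eta> \<omega>) (x \<omega>)) +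
        E_nu_powr M \<nu> p p (\<lambda>\<omega>. h t (\<eta> \<omega>) (x \<omega>)) + E_nu_powr M \<nu> p 2 (\<lambda>\<omega>. h t (\<eta> \<omega>) (x \<omega>))
        \<le> ennreal K * (1 + E_Mp_powr M p r \<eta> x))"

definition strong_solution ::
    "real \<Rightarrow> real \<Rightarrow> real \<Rightarrow> 'a measure \<Rightarrow> (real \<Rightarrow> 'a measure) \<Rightarrow> (real \<Rightarrow> 'a \<Rightarrow> real^'m)
      \<Rightarrow> ('n \<Rightarrow> 'a \<Rightarrow> (real \<times> real) measure) \<Rightarrow> ('n \<Rightarrow> real measure)
      \<Rightarrow> (real \<Rightarrow> (real \<Rightarrow> real^'d) \<Rightarrow> real^'d \<Rightarrow> real^'d)
      \<Rightarrow> (real \<Rightarrow> (real \<Rightarrow> real^'d) \<Rightarrow> real^'d \<Rightarrow> real^'m^'d)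
      \<Rightarrow> (real \<Rightarrow> (real \<Rightarrow> real^'d) \<Rightarrow> real^'d \<Rightarrow> real \<Rightarrow> real^'n^'d)
      \<Rightarrow> (real \<Rightarrow> real^'d) \<Rightarrow> real^'d \<Rightarrow> (real \<Rightarrow> 'a \<Rightarrow> real^'d) \<Rightarrow> bool" where
  "strong_solution p r T M \<F> W \<N> \<nu> f g h \<eta> x X \<longleftrightarrow> Lp_adapted p r T M \<F> X \<and>
     (AE \<omega> in M. cadlag_on T (\<lambda>t. X t \<omega>)) \<and>
     (AE \<omega> in M. (AE \<theta> in lebesgue_on {-r..0}. X \<theta> \<omega> = \<eta> \<theta>) \<and> X 0 \<omega> = x) \<and>
     (\<exists>f' g' h' I J.
        progressive T \<F> f' \<and> is_version T M f X f' \<and>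
        progressive T \<F> g' \<and> is_version T M g X g' \<and>
        predictable T M \<F> h' \<and> is_jump_version T M \<nu> h X h' \<and>
        is_brownian_integral T M \<F> W g' I \<and> is_jump_integral T M \<F> \<N> \<nu> h' J \<and>
        (AE \<omega> in M. set_integrable lebesgue {0..T} (\<lambda>s. f' s \<omega>) \<and>
           (\<forall>t\<in>{0..T}. X t \<omega> = x + (LINT s:{0..t}|lebesgue. f' s \<omega>) + I t \<omega> + J t \<omega>)))"


section \<open>The forward integral\<close>

definition ucp_limit ::
    "real \<Rightarrow> 'a measure \<Rightarrow> (real \<Rightarrow> real \<Rightarrow> 'a \<Rightarrow> real) \<Rightarrow> (real \<Rightarrow> 'a \<Rightarrow> real) \<Rightarrow> bool" where
  "ucp_limit T M Y Z \<longleftrightarrow> (\<forall>t\<in>{0..T}. \<forall>c>0.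
     (\<forall>\<^sub>F \<epsilon> in at_right 0.
        {\<omega> \<in> space M. (SUP s\<in>{0..t}. ennreal \<bar>Y \<epsilon> s \<omega> - Z s \<omega>\<bar>) > ennreal c} \<in> sets M) \<and>
     ((\<lambda>\<epsilon>. measure M {\<omega> \<in> space M. (SUP s\<in>{0..t}. ennreal \<bar>Y \<epsilon> s \<omega> - Z s \<omega>\<bar>) > ennreal c})
        \<longlongrightarrow> 0) (at_right 0))"

text \<open>\<open>Z t\<close> is the forward integral over \<open>[0,t]\<close> of the \<open>L\<^sup>q\<close>-valued process \<open>\<Phi>\<close> with respect to
  the segment process of \<open>X\<close>.\<close>

definition is_forward_integral ::
    "real \<Rightarrow> real \<Rightarrow> 'a measure \<Rightarrow> (real \<Rightarrow> 'a \<Rightarrow> real \<Rightarrow> 'b::euclidean_space)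
      \<Rightarrow> (real \<Rightarrow> 'a \<Rightarrow> 'b) \<Rightarrow> (real \<Rightarrow> 'a \<Rightarrow> real) \<Rightarrow> bool" where
  "is_forward_integral r T M \<Phi> X Z \<longleftrightarrow>
     ucp_limit T M (\<lambda>\<epsilon> t \<omega>. 1 / \<epsilon> * (LINT s:{0..t}|lebesgue.
        pairing r (\<Phi> s \<omega>) (\<lambda>\<theta>. segment X (s + \<epsilon>) \<omega> \<theta> - segment X s \<omega> \<theta>))) Z"

end

theory Submission
  imports Defs
begin

text \<open>
  The statement is pathwise.  Almost surely the segments at the finitely many distinct times
  \<open>min T (k r / 2)\<close> lie in \<open>W\<^sup>1\<^sup>,\<^sup>p\<close>; they overlap and cover \<open>[-r,T]\<close>, so the path agrees a.e. on
      \<open>[-r,T]\<close> with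
  \<open>Y(t) = c + \<integral>\<^bsub>-r\<^esub>\<^bsup>t\<^esup> u\<close> for a single \<open>u \<in> L\<^sup>p\<close>, and by right continuity it equals \<open>Y\<close> on \<open>[0,T)\<close>.
  Translations are continuous in \<open>L\<^sup>p\<close>, hence \<open>(Y(\<cdot> + \<epsilon>) - Y) / \<epsilon>\<close> tends to \<open>u\<close> in \<open>L\<^sup>p\<close> (Jensen and
  Tonelli) and \<open>(X\<^bsub>s+\<epsilon>\<^esub> - X\<^sub>s) / \<epsilon>\<close> tends to the weak derivative of \<open>X\<^sub>s\<close>, uniformly in \<open>s\<close>.  Since
  \<open>s \<mapsto> DF(s, X\<^sub>s, X(s))\<close> is continuous and bounded in \<open>L\<^sup>q\<close>, the forward sums converge path by path; the
  chain rule for the Frechet derivative gives the same limit for the difference quotients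
  defining the shift generator.  A jump of the path at \<open>T\<close> is not excluded by the
  definitions, but it adds only \<open>O(\<epsilon>\<^bsup>1/p\<^esup>)\<close> to the forward sums.  Finally a ucp limit is an almost
  sure limit along a subsequence, which identifies \<open>Z\<close>.
\<close>

section \<open>Integrals of powers and Hoelder's inequality\<close>

text \<open>The regularity of a segment is known off a null set that depends on its time, so for a
  fixed path only countably many times can be used at once. Windows advanced by r/2 overlap in
  intervals of positive length, which forces the additive constants of the local representations to
  agree. All functions are placed on the whole line with bounded support. The norm over a window
  [s-r,s] is then at most the norm over the line, which makes every estimate uniform in s, and Borel
  representatives make Tonelli applicable. The time T needs care: the path is known to equal its
  continuous version only on [0,T). The third argument of the derivative is therefore taken from the
  continuous version, which gives continuity on the compact interval [0,T], and T itself is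
  discarded as a null point of the ds-integrals. The shift generator fits the same scheme: freezing
  the shifted segment at its end point amounts to cutting u off at time s, and the cut does not
  change u(s + \<theta>) for \<theta> \<le> 0.\<close>

lemma norm_add_powr_le:
  fixes a b :: "'b::real_normed_vector"
  assumes "0 \<le> p"
  shows "norm (a + b) powr p \<le> 2 powr p * (norm a powr p + norm b powr p)"
proof -
  have "norm (a + b) \<le> 2 * max (norm a) (norm b)"
    using norm_triangle_ineq[of a b] by linarith
  then have "norm (a + b) powr p \<le> (2 * max (norm a) (norm b)) powr p"
    using assms by (intro powr_mono2) auto
  also have "\<dots> = 2 powr p * max (norm a) (norm b) powr p"
    by (simp add: powr_mult)
  also have "\<dots> \<le> 2 powr p * (norm a powr p + norm b powr p)"
    by (intro mult_left_mono) (auto simp: max_def)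
  finally show ?thesis .
qed

lemma norm_diff_powr_le:
  fixes a b :: "'b::real_normed_vector"
  assumes "0 \<le> p"
  shows "norm (a - b) powr p \<le> 2 powr p * (norm a powr p + norm b powr p)"
  using norm_add_powr_le[OF assms, of a "- b"] by simp

lemma le_one_plus_powr:
  fixes x :: real
  assumes "0 \<le> x" "1 \<le> p"
  shows "x \<le> 1 + x powr p"
proof (cases "x \<le> 1")
  case False
  then have "x powr 1 \<le> x powr p" using assms by (intro powr_mono) auto
  then show ?thesis using False by simp
qed (simp add: add_increasing2)

text \<open>Young's inequality is integrated after dividing \<open>a\<close> and \<open>b\<close> by
  their norms; this normalisation is impossible when a norm vanishes, whence the case split.\<close>

lemma inner_Hoelder:
  fixes a b :: "'a \<Rightarrow> 'b::euclidean_space"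
  assumes pq: "1 < p" "1 < q" "1 / p + 1 / q = 1"
    and [measurable]: "a \<in> borel_measurable N" "b \<in> borel_measurable N"
    and a: "integrable N (\<lambda>x. norm (a x) powr q)" and b: "integrable N (\<lambda>x. norm (b x) powr p)"
  shows integrable_inner_Hoelder: "integrable N (\<lambda>x. a x \<bullet> b x)"
    and integral_inner_Hoelder: "\<bar>LINT x|N. a x \<bullet> b x\<bar> \<le>
      (LINT x|N. norm (a x) powr q) powr (1 / q) * (LINT x|N. norm (b x) powr p) powr (1 / p)"
proof -
  have young: "norm (a x) * norm (b x) \<le> norm (a x) powr q / q + norm (b x) powr p / p" for x
    using Youngs_inequality[of q p "norm (a x)" "norm (b x)"] pq by (simp add: add.commute)
  have bound: "integrable N (\<lambda>x. norm (a x) powr q / q + norm (b x) powr p / p)"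
    using a b by simp
  have ab: "\<bar>a x \<bullet> b x\<bar> \<le> norm (a x) * norm (b x)" for x
    by (rule Cauchy_Schwarz_ineq2)
  show int: "integrable N (\<lambda>x. a x \<bullet> b x)"
    by (rule Bochner_Integration.integrable_bound[OF bound])
       (use young ab in \<open>auto intro!: AE_I2 order_trans[OF ab] order_trans[OF young]\<close>)
  have intn: "integrable N (\<lambda>x. norm (a x) * norm (b x))"
    by (rule Bochner_Integration.integrable_bound[OF bound])
       (use young in \<open>auto intro!: AE_I2 order_trans[OF young]\<close>)
  define A where "A = (LINT x|N. norm (a x) powr q)"
  define B where "B = (LINT x|N. norm (b x) powr p)"
  have AB0: "0 \<le> A" "0 \<le> B"
    unfolding A_def B_def by auto
  consider "A = 0" | "B = 0" | "0 < A" "0 < B" using AB0 by linarith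
  then show "\<bar>LINT x|N. a x \<bullet> b x\<bar> \<le> A powr (1 / q) * B powr (1 / p)"
  proof cases
    case 1
    then have "AE x in N. norm (a x) powr q = 0"
      using integral_nonneg_eq_0_iff_AE[OF a] unfolding A_def by auto
    then have "AE x in N. a x \<bullet> b x = 0" by eventually_elim auto
    then have "(LINT x|N. a x \<bullet> b x) = 0" by (intro integral_eq_zero_AE) auto
    then show ?thesis by simp
  next
    case 2
    then have "AE x in N. norm (b x) powr p = 0"
      using integral_nonneg_eq_0_iff_AE[OF b] unfolding B_def by auto
    then have "AE x in N. a x \<bullet> b x = 0" by eventually_elim auto
    then have "(LINT x|N. a x \<bullet> b x) = 0" by (intro integral_eq_zero_AE) auto
    then show ?thesis by simp
  next
    case 3
    let ?\<alpha> = "A powr (1 / q)" and ?\<beta> = "B powr (1 / p)"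
    have pos: "0 < ?\<alpha>" "0 < ?\<beta>" using 3 by auto
    have "norm (a x) * norm (b x) \<le> ?\<alpha> * ?\<beta> * (norm (a x) powr q / (A * q) + norm (b x) powr p /
        (B * p))" for x
    proof -
      have "(norm (a x) / ?\<alpha>) * (norm (b x) / ?\<beta>)
          \<le> (norm (a x) / ?\<alpha>) powr q / q + (norm (b x) / ?\<beta>) powr p / p"
        using Youngs_inequality[of q p "norm (a x) / ?\<alpha>" "norm (b x) / ?\<beta>"] pq pos
        by (simp add: add.commute)
      also have "\<dots> = norm (a x) powr q / (A * q) + norm (b x) powr p / (B * p)"
        using pq 3 by (simp add: powr_divide powr_powr)
      finally show ?thesis using pos by (simp add: field_simps)
    qed
    then have "(LINT x|N. norm (a x) * norm (b x)) \<le>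
        (LINT x|N. ?\<alpha> * ?\<beta> * (norm (a x) powr q / (A * q) + norm (b x) powr p / (B * p)))"
      using a b by (intro integral_mono intn) auto
    also have "\<dots> = ?\<alpha> * ?\<beta> * (A / (A * q) + B / (B * p))"
      using a b by (simp add: A_def B_def)
    also have "\<dots> = ?\<alpha> * ?\<beta>"
      using 3 pq by (simp add: add.commute)
    finally have "(LINT x|N. norm (a x) * norm (b x)) \<le> ?\<alpha> * ?\<beta>" .
    moreover have "\<bar>LINT x|N. a x \<bullet> b x\<bar> \<le> (LINT x|N. norm (a x) * norm (b x))"
    proof -
      have "\<bar>LINT x|N. a x \<bullet> b x\<bar> \<le> (LINT x|N. \<bar>a x \<bullet> b x\<bar>)" by (rule integral_abs_bound)
      also have "\<dots> \<le> (LINT x|N. norm (a x) * norm (b x))"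
        using int intn ab by (intro integral_mono) auto
      finally show ?thesis .
    qed
    ultimately show ?thesis by linarith
  qed
qed

section \<open>Representatives of L^p classes, their norms and the duality pairing\<close>

lemma borel_measurable_lebesgue_on_AE:
  fixes f g :: "real \<Rightarrow> 'b::euclidean_space"
  assumes f: "f \<in> borel_measurable (lebesgue_on S)" and S: "S \<in> sets lebesgue"
    and ae: "AE x in lebesgue_on S. f x = g x"
  shows "g \<in> borel_measurable (lebesgue_on S)"
proof -
  have "AE x in lebesgue. x \<in> S \<longrightarrow> f x = g x"
    using ae S by (subst (asm) AE_restrict_space_iff) auto
  then have "AE x in lebesgue. (if x \<in> S then f x else 0) = (if x \<in> S then g x else 0)"
    by eventually_elim auto
  from borel_measurable_AE[OF borel_measurable_if_I[OF f S] this] show ?thesis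
    using borel_measurable_if_D by blast
qed

lemma Lp_cong_AE:
  assumes "\<psi> \<in> Lp p r" "AE \<theta> in lebesgue_on {-r..0}. \<psi> \<theta> = \<phi> \<theta>"
  shows "\<phi> \<in> Lp p r"
proof -
  have m: "\<phi> \<in> borel_measurable (lebesgue_on {-r..0})"
    using assms borel_measurable_lebesgue_on_AE[of \<psi> "{-r..0}" \<phi>] by (auto simp: Lp_def)
  moreover have "integrable (lebesgue_on {-r..0}) (\<lambda>\<theta>. norm (\<phi> \<theta>) powr p)"
  proof (rule integrable_cong_AE_imp)
    show "AE \<theta> in lebesgue_on {-r..0}. norm (\<psi> \<theta>) powr p = norm (\<phi> \<theta>) powr p"
      using assms(2) by eventually_elim simp
  qed (use assms m in \<open>auto simp: Lp_def\<close>)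
  ultimately show ?thesis using assms by (auto simp: Lp_def)
qed

lemma Lp_norm_cong_AE:
  assumes "AE \<theta> in lebesgue_on {-r..0}. \<psi> \<theta> = \<phi> \<theta>" "\<psi> \<in> Lp p r"
  shows "Lp_norm p r \<psi> = Lp_norm p r \<phi>"
proof -
  have "\<phi> \<in> Lp p r" using Lp_cong_AE assms by blast
  moreover have "AE \<theta> in lebesgue_on {-r..0}. norm (\<psi> \<theta>) powr p = norm (\<phi> \<theta>) powr p"
    using assms(1) by eventually_elim simp
  ultimately have "(LINT \<theta>|lebesgue_on {-r..0}. norm (\<psi> \<theta>) powr p) = (LINT \<theta>|lebesgue_on {-r..0}.
      norm (\<phi> \<theta>) powr p)"
    using assms(2) by (intro integral_cong_AE) (auto simp: Lp_def)
  then show ?thesis by (simp add: Lp_norm_def)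
qed

lemma pairing_cong_AE:
  assumes "AE \<theta> in lebesgue_on {-r..0}. a \<theta> = a' \<theta>" "AE \<theta> in lebesgue_on {-r..0}. b \<theta> = b' \<theta>"
    and "a \<in> Lp q r" "b \<in> Lp p r"
  shows "pairing r a b = pairing r a' b'"
proof -
  have [measurable]: "a \<in> borel_measurable (lebesgue_on {-r..0})" "b \<in> borel_measurable
      (lebesgue_on {-r..0})"
    "a' \<in> borel_measurable (lebesgue_on {-r..0})" "b' \<in> borel_measurable (lebesgue_on {-r..0})"
    using assms Lp_cong_AE by (auto simp: Lp_def)
  show ?thesis
    unfolding pairing_def
    by (intro integral_cong_AE) (measurable, use assms(1,2) in eventually_elim, simp)
qed

lemma Lp_add:
  assumes "a \<in> Lp p r" "b \<in> Lp p r" "0 \<le> p"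
  shows "(\<lambda>\<theta>. a \<theta> + b \<theta>) \<in> Lp p r"
proof -
  have [measurable]: "a \<in> borel_measurable (lebesgue_on {-r..0})" "b \<in> borel_measurable
      (lebesgue_on {-r..0})"
    using assms by (auto simp: Lp_def)
  have "integrable (lebesgue_on {-r..0}) (\<lambda>\<theta>. 2 powr p * (norm (a \<theta>) powr p + norm (b \<theta>) powr p))"
    using assms by (auto simp: Lp_def)
  then have "integrable (lebesgue_on {-r..0}) (\<lambda>\<theta>. norm (a \<theta> + b \<theta>) powr p)"
    by (rule Bochner_Integration.integrable_bound)
       (auto intro!: AE_I2 norm_add_powr_le assms(3) simp: abs_mult)
  then show ?thesis by (simp add: Lp_def)
qed

lemma Lp_scaleR:
  assumes "a \<in> Lp p r"
  shows "(\<lambda>\<theta>. k *\<^sub>R a \<theta>) \<in> Lp p r"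
  using assms by (auto simp: Lp_def powr_mult)

lemma Lp_diff:
  assumes "a \<in> Lp p r" "b \<in> Lp p r" "0 \<le> p"
  shows "(\<lambda>\<theta>. a \<theta> - b \<theta>) \<in> Lp p r"
  using Lp_add[OF assms(1) Lp_scaleR[OF assms(2), of "-1"] assms(3)] by simp

lemma Lp_norm_nonneg: "0 \<le> Lp_norm p r \<psi>"
  by (simp add: Lp_norm_def)

lemma Lp_norm_scaleR:
  assumes "0 < p"
  shows "Lp_norm p r (\<lambda>\<theta>. k *\<^sub>R \<psi> \<theta>) = \<bar>k\<bar> * Lp_norm p r \<psi>"
  using assms by (simp add: Lp_norm_def powr_mult powr_powr)

lemma Lp_norm_powr:
  assumes "0 < p"
  shows "Lp_norm p r \<psi> powr p = (LINT \<theta>|lebesgue_on {-r..0}. norm (\<psi> \<theta>) powr p)"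
  using assms by (simp add: Lp_norm_def powr_powr)

text \<open>A weak form of Minkowski's inequality, integrated from \<open>norm_add_powr_le\<close>.
  The factor \<open>2 powr p\<close> is harmless because the inequality serves only to show
  boundedness.\<close>

lemma Lp_norm_add_le:
  assumes "0 < p" "a \<in> Lp p r" "b \<in> Lp p r"
  shows "Lp_norm p r (\<lambda>\<theta>. a \<theta> + b \<theta>) powr p \<le> 2 powr p * (Lp_norm p r a powr p + Lp_norm p r b powr p)"
proof -
  have "(LINT \<theta>|lebesgue_on {-r..0}. norm (a \<theta> + b \<theta>) powr p) \<le>
      (LINT \<theta>|lebesgue_on {-r..0}. 2 powr p * (norm (a \<theta>) powr p + norm (b \<theta>) powr p))"
    using assms Lp_add[of a p r b] by (intro integral_mono norm_add_powr_le) (auto simp: Lp_def)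
  also have "\<dots> = 2 powr p * (Lp_norm p r a powr p + Lp_norm p r b powr p)"
    using assms by (simp add: Lp_norm_powr Lp_def)
  finally show ?thesis using assms by (simp add: Lp_norm_powr)
qed

lemma Lp_norm_less_iff:
  assumes "0 < p" "0 < c"
  shows "Lp_norm p r \<psi> < c \<longleftrightarrow> (LINT \<theta>|lebesgue_on {-r..0}. norm (\<psi> \<theta>) powr p) < c powr p"
proof -
  have "Lp_norm p r \<psi> < c \<longleftrightarrow> Lp_norm p r \<psi> powr p < c powr p"
    using assms Lp_norm_nonneg[of p r \<psi>] by (metis linorder_not_less less_imp_le powr_less_mono2
        powr_mono2)
  then show ?thesis using assms by (simp add: Lp_norm_powr)
qed

context
  fixes p q r :: real
  assumes pq: "1 < p" "1 < q" "1 / p + 1 / q = 1"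
begin

lemma integrable_pairing:
  assumes "a \<in> Lp q r" "b \<in> Lp p r"
  shows "integrable (lebesgue_on {-r..0}) (\<lambda>\<theta>. a \<theta> \<bullet> b \<theta>)"
  using integrable_inner_Hoelder[OF pq] assms by (auto simp: Lp_def)

lemma abs_pairing_le:
  assumes "a \<in> Lp q r" "b \<in> Lp p r"
  shows "\<bar>pairing r a b\<bar> \<le> Lp_norm q r a * Lp_norm p r b"
  using integral_inner_Hoelder[OF pq] assms by (auto simp: Lp_def pairing_def Lp_norm_def)

lemma pairing_diff_right:
  assumes "a \<in> Lp q r" "b \<in> Lp p r" "b' \<in> Lp p r"
  shows "pairing r a (\<lambda>\<theta>. b \<theta> - b' \<theta>) = pairing r a b - pairing r a b'"
  unfolding pairing_def inner_diff_right using assms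
  by (intro Bochner_Integration.integral_diff integrable_pairing)

lemma pairing_add_right:
  assumes "a \<in> Lp q r" "b \<in> Lp p r" "b' \<in> Lp p r"
  shows "pairing r a (\<lambda>\<theta>. b \<theta> + b' \<theta>) = pairing r a b + pairing r a b'"
  unfolding pairing_def inner_add_right using assms
  by (intro Bochner_Integration.integral_add integrable_pairing)

lemma pairing_diff_left:
  assumes "a \<in> Lp q r" "a' \<in> Lp q r" "b \<in> Lp p r"
  shows "pairing r (\<lambda>\<theta>. a \<theta> - a' \<theta>) b = pairing r a b - pairing r a' b"
  unfolding pairing_def inner_diff_left using assms
  by (intro Bochner_Integration.integral_diff integrable_pairing)

end

lemma pairing_scaleR_right: "pairing r a (\<lambda>\<theta>. k *\<^sub>R b \<theta>) = k * pairing r a b"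
  by (simp add: pairing_def)

section \<open>Continuity of translations\<close>

text \<open>Norms over the whole line are translation invariant, and Borel measurability is what the
  product \<open>lborel \<Otimes>\<^sub>M lborel\<close> asks for. Bounded support embeds L^p into
  L^1, so that primitives starting at minus infinity make sense.\<close>

definition Lp_compact :: "real \<Rightarrow> (real \<Rightarrow> 'b::euclidean_space) \<Rightarrow> bool" where
  "Lp_compact p u \<longleftrightarrow> u \<in> borel_measurable borel \<and> integrable lborel (\<lambda>t. norm (u t) powr p) \<and>
     (\<exists>R>0. \<forall>t. R < \<bar>t\<bar> \<longrightarrow> u t = 0)"

lemma Lp_compactD:
  assumes "Lp_compact p u"
  shows Lp_compact_borel: "u \<in> borel_measurable borel"
    and Lp_compact_integrable_powr: "integrable lborel (\<lambda>t. norm (u t) powr p)"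
    and Lp_compact_bounded_support: "\<exists>R>0. \<forall>t. R < \<bar>t\<bar> \<longrightarrow> u t = 0"
  using assms by (auto simp: Lp_compact_def)

lemma integrable_indicator_Icc [simp]: "integrable lborel (indicator {a..b} :: real \<Rightarrow> real)"
  by (rule integrable_real_indicator) (auto simp: emeasure_lborel_Icc_eq)

lemma Lp_compact_integrable:
  assumes "Lp_compact p u" "1 \<le> p"
  shows "integrable lborel u"
proof -
  note [measurable] = Lp_compact_borel[OF assms(1)]
  obtain R where R: "\<And>t. R < \<bar>t\<bar> \<Longrightarrow> u t = 0"
    using Lp_compact_bounded_support[OF assms(1)] by blast
  have "integrable lborel (\<lambda>t. indicator {-R..R} t + norm (u t) powr p)"
    using Lp_compact_integrable_powr[OF assms(1)] by simp
  then show ?thesis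
  proof (rule Bochner_Integration.integrable_bound)
    have "norm (u t) \<le> indicator {-R..R} t + norm (u t) powr p" for t
      using le_one_plus_powr[of "norm (u t)" p] R[of t] assms(2)
      by (cases "\<bar>t\<bar> \<le> R") (auto simp: indicator_def)
    then show "AE t in lborel. norm (u t) \<le> norm (indicator {-R..R} t + norm (u t) powr p)"
      by (auto intro!: AE_I2 order_trans)
  qed simp
qed

lemma Lp_compact_mono_exponent:
  assumes "Lp_compact p u" "1 \<le> p"
  shows "Lp_compact 1 u"
  using assms Lp_compact_integrable[OF assms] by (auto simp: Lp_compact_def)

lemma Lp_compact_bounded:
  assumes [measurable]: "u \<in> borel_measurable borel" and "\<And>t. norm (u t) \<le> C"
    and "0 < R" "\<And>t. R < \<bar>t\<bar> \<Longrightarrow> u t = 0" and "0 \<le> p"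
  shows "Lp_compact p u"
proof -
  have "integrable lborel (\<lambda>t. norm (u t) powr p)"
  proof (rule Bochner_Integration.integrable_bound[of _ "\<lambda>t. C powr p * indicator {-R..R} t"])
    have "norm (u t) powr p \<le> C powr p * indicator {-R..R} t" for t
      using assms powr_mono2[of p "norm (u t)" C] by (cases "\<bar>t\<bar> \<le> R") (auto simp: indicator_def)
    then show "AE t in lborel. norm (norm (u t) powr p) \<le> norm (C powr p * indicator {-R..R} t :: real)"
      by (auto intro!: AE_I2 simp: abs_mult)
  qed auto
  with assms show ?thesis by (auto simp: Lp_compact_def)
qed

lemma Lp_compact_restrict:
  assumes "Lp_compact p u" "A \<in> sets borel"
  shows "Lp_compact p (\<lambda>t. indicator A t *\<^sub>R u t)"
proof -
  note [measurable] = Lp_compact_borel[OF assms(1)] assms(2)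
  have "integrable lborel (\<lambda>t. norm (indicator A t *\<^sub>R u t) powr p)"
    by (rule Bochner_Integration.integrable_bound[OF Lp_compact_integrable_powr[OF assms(1)]])
       (auto intro!: AE_I2 simp: indicator_def)
  with assms show ?thesis
    using Lp_compact_bounded_support[OF assms(1)] by (auto simp: Lp_compact_def)
qed

lemma Lp_compact_diff:
  assumes "Lp_compact p u" "Lp_compact p v" "0 \<le> p"
  shows "Lp_compact p (\<lambda>t. u t - v t)"
proof -
  note [measurable] = Lp_compact_borel[OF assms(1)] Lp_compact_borel[OF assms(2)]
  have "integrable lborel (\<lambda>t. 2 powr p * (norm (u t) powr p + norm (v t) powr p))"
    using Lp_compact_integrable_powr[OF assms(1)] Lp_compact_integrable_powr[OF assms(2)] by simp
  then have "integrable lborel (\<lambda>t. norm (u t - v t) powr p)"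
    by (rule Bochner_Integration.integrable_bound)
       (auto intro!: AE_I2 norm_diff_powr_le assms(3) simp: abs_mult)
  moreover obtain R R' where "0 < R" "0 < R'" "\<And>t. R < \<bar>t\<bar> \<Longrightarrow> u t = 0" "\<And>t. R' < \<bar>t\<bar> \<Longrightarrow> v t = 0"
    using Lp_compact_bounded_support assms by metis
  then have "0 < max R R' \<and> (\<forall>t. max R R' < \<bar>t\<bar> \<longrightarrow> u t - v t = 0)"
    by auto
  ultimately show ?thesis unfolding Lp_compact_def by (intro conjI exI[of _ "max R R'"]) auto
qed

lemma Lp_compact_translate:
  assumes "Lp_compact p u"
  shows "Lp_compact p (\<lambda>t. u (t + h))"
proof -
  note [measurable] = Lp_compact_borel[OF assms(1)]
  obtain R where R: "0 < R" "\<And>t. R < \<bar>t\<bar> \<Longrightarrow> u t = 0"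
    using Lp_compact_bounded_support[OF assms(1)] by blast
  have "integrable lborel (\<lambda>t. norm (u (t + h)) powr p)"
    using lborel_integrable_real_affine[OF Lp_compact_integrable_powr[OF assms], of 1 h]
    by (simp add: add.commute)
  moreover have "\<forall>t. R + \<bar>h\<bar> < \<bar>t\<bar> \<longrightarrow> u (t + h) = 0" using R by auto
  moreover have "0 < R + \<bar>h\<bar>" using R by auto
  ultimately show ?thesis unfolding Lp_compact_def
    by (intro conjI exI[of _ "R + \<bar>h\<bar>"]) auto
qed

lemma lborel_integral_translate:
  fixes f :: "real \<Rightarrow> 'b::{banach, second_countable_topology}"
  shows "(LINT t|lborel. f (t + h)) = (LINT t|lborel. f t)"
  using lborel_integral_real_affine[of 1 f h] by (simp add: add.commute)

lemma lborel_integrable_translate: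
  fixes f :: "real \<Rightarrow> 'b::{banach, second_countable_topology}"
  shows "integrable lborel (\<lambda>t. f (t + h)) \<longleftrightarrow> integrable lborel f"
  using lborel_integrable_real_affine_iff[of 1 f h] by (simp add: add.commute)

section \<open>Density of continuous functions in L^p\<close>

definition clip :: "real \<Rightarrow> 'b::real_normed_vector \<Rightarrow> 'b" where
  "clip C x = (C / max C (norm x)) *\<^sub>R x"

lemma clip_eq: "0 < C \<Longrightarrow> norm x \<le> C \<Longrightarrow> clip C x = x"
  by (simp add: clip_def max_def)

lemma norm_clip_le: "0 < C \<Longrightarrow> norm (clip C x) \<le> C"
  by (simp add: clip_def max_def)

lemma continuous_on_clip: "0 < C \<Longrightarrow> continuous_on UNIV (clip C)"
  unfolding clip_def by (intro continuous_intros) (auto simp: max_def)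

lemma borel_measurable_AE_lim_continuous:
  fixes u :: "real \<Rightarrow> 'b::euclidean_space"
  assumes "u \<in> borel_measurable lebesgue"
  obtains g :: "nat \<Rightarrow> real \<Rightarrow> 'b" where "\<And>n. continuous_on UNIV (g n)"
    "AE t in lebesgue. (\<lambda>n. g n t) \<longlonglongrightarrow> u t"
proof -
  have "u measurable_on UNIV"
    using assms by (simp add: lebesgue_measurable_imp_measurable_on)
  then obtain N g where "negligible N" "\<And>n. continuous_on UNIV (g n)"
      "\<And>t. t \<notin> N \<Longrightarrow> (\<lambda>n. g n t) \<longlonglongrightarrow> u t"
    unfolding measurable_on_def by auto
  moreover from this have "AE t in lebesgue. (\<lambda>n. g n t) \<longlonglongrightarrow> u t"
    by (intro AE_I'[of N]) (auto simp: negligible_iff_null_sets)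
  ultimately show ?thesis using that by blast
qed

lemma AE_lborel_iff_lebesgue: "(AE t in lebesgue. P t) \<longleftrightarrow> (AE t in lborel. P t)"
  by (rule AE_completion_iff)

text \<open>\<open>clip C\<close> is the radial projection onto the ball of radius \<open>C\<close>.
  Applied to continuous functions converging a.e. to \<open>v\<close>, it keeps them continuous,
  does not move the limit because \<open>v\<close> lies in the ball, and supplies the dominating
  constant \<open>(2 * C) powr p\<close> on \<open>{a..b}\<close>.\<close>

lemma bounded_approx_continuous:
  fixes v :: "real \<Rightarrow> 'b::euclidean_space"
  assumes [measurable]: "v \<in> borel_measurable borel" and C: "0 < C" "\<And>t. norm (v t) \<le> C"
    and p: "0 < p" and e: "0 < e"
  obtains g where "continuous_on UNIV g" "\<And>t. norm (g t) \<le> C"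
    "(LINT t|lborel. indicator {a..b} t * norm (v t - g t) powr p) < e"
proof -
  obtain g :: "nat \<Rightarrow> real \<Rightarrow> 'b" where g: "\<And>n. continuous_on UNIV (g n)"
      "AE t in lebesgue. (\<lambda>n. g n t) \<longlonglongrightarrow> v t"
    by (rule borel_measurable_AE_lim_continuous[of v]) (auto intro: measurable_completion)
  define k where "k n t = clip C (g n t)" for n t
  have ck: "continuous_on UNIV (k n)" for n
    unfolding k_def using continuous_on_compose2[OF continuous_on_clip[OF C(1)] g(1)] by auto
  then have [measurable]: "k n \<in> borel_measurable borel" for n
    by (rule borel_measurable_continuous_onI)
  have nk: "norm (k n t) \<le> C" for n t
    unfolding k_def by (rule norm_clip_le[OF C(1)])
  have "(\<lambda>n. LINT t|lborel. indicator {a..b} t * norm (v t - k n t) powr p) \<longlonglongrightarrow>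
      (LINT t|(lborel::real measure). (0::real))"
  proof (rule integral_dominated_convergence[where w="\<lambda>t. (2 * C) powr p * indicator {a..b} t"])
    have "AE t in lborel. (\<lambda>n. g n t) \<longlonglongrightarrow> v t" using g(2) by (simp add: AE_lborel_iff_lebesgue)
    then show "AE t in lborel. (\<lambda>n. indicator {a..b} t * norm (v t - k n t) powr p) \<longlonglongrightarrow> 0"
    proof eventually_elim
      case (elim t)
      have "isCont (clip C) (v t)"
        using continuous_on_clip[OF C(1)] continuous_on_eq_continuous_at by blast
      then have "(\<lambda>n. clip C (g n t)) \<longlonglongrightarrow> clip C (v t)"
        using elim isCont_tendsto_compose by blast
      then have "(\<lambda>n. k n t) \<longlonglongrightarrow> v t" by (simp add: k_def clip_eq C)
      then have "(\<lambda>n. norm (v t - k n t)) \<longlonglongrightarrow> 0"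
        using tendsto_norm_zero[OF LIM_zero] by (subst norm_minus_commute) blast
      then have "(\<lambda>n. norm (v t - k n t) powr p) \<longlonglongrightarrow> 0 powr p"
        using p by (intro tendsto_powr') auto
      then show ?case using p by (intro tendsto_mult_right_zero) auto
    qed
    fix n
    have "norm (v t - k n t) powr p \<le> (2 * C) powr p" for t
      using norm_triangle_ineq4[of "v t" "k n t"] C(2)[of t] nk[of n t] p
      by (intro powr_mono2) auto
    then show "AE t in lborel. norm (indicator {a..b} t * norm (v t - k n t) powr p)
        \<le> (2 * C) powr p * indicator {a..b} t"
      by (auto simp: indicator_def intro!: AE_I2)
  qed auto
  then have "\<forall>\<^sub>F n in sequentially. (LINT t|lborel. indicator {a..b} t * norm (v t - k n t) powr p) < e"
    using e by (auto dest: order_tendstoD(2))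
  then obtain n where "(LINT t|lborel. indicator {a..b} t * norm (v t - k n t) powr p) < e"
    by (auto simp: eventually_sequentially)
  with ck nk show ?thesis using that by blast
qed

text \<open>Truncation to zero above a high level, with \<open>norm (u t) powr p\<close> as the
  majorant for dominated convergence.\<close>

lemma Lp_compact_approx_bounded:
  fixes u :: "real \<Rightarrow> 'b::euclidean_space"
  assumes u: "Lp_compact p u" and p: "0 < p" and e: "0 < e"
  obtains C v where "0 < C" "v \<in> borel_measurable borel" "\<And>t. norm (v t) \<le> C"
    "\<And>t. norm (v t) \<le> norm (u t)" "(LINT t|lborel. norm (u t - v t) powr p) < e"
proof -
  note [measurable] = Lp_compact_borel[OF u]
  define k where "k n t = (if norm (u t) \<le> real (Suc n) then u t else 0)" for n t
  have [measurable]: "k n \<in> borel_measurable borel" for n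
    unfolding k_def by measurable
  have "(\<lambda>n. LINT t|lborel. norm (u t - k n t) powr p) \<longlonglongrightarrow> (LINT t|(lborel::real measure). (0::real))"
  proof (rule integral_dominated_convergence[where w="\<lambda>t. norm (u t) powr p"])
    show "AE t in lborel. (\<lambda>n. norm (u t - k n t) powr p) \<longlonglongrightarrow> 0"
    proof (rule AE_I2)
      fix t
      obtain m where m: "norm (u t) \<le> real m" using real_arch_simple by blast
      have "\<forall>\<^sub>F n in sequentially. norm (u t - k n t) powr p = 0"
        using eventually_ge_at_top[of m]
      proof eventually_elim
        case (elim n)
        then show ?case using m p by (simp add: k_def)
      qed
      then show "(\<lambda>n. norm (u t - k n t) powr p) \<longlonglongrightarrow> 0" by (rule tendsto_eventually)
    qed
  qed (use p Lp_compact_integrable_powr[OF u] in \<open>auto simp: k_def\<close>)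
  then have "\<forall>\<^sub>F n in sequentially. (LINT t|lborel. norm (u t - k n t) powr p) < e"
    using e by (auto dest: order_tendstoD(2))
  then obtain n where "(LINT t|lborel. norm (u t - k n t) powr p) < e"
    by (auto simp: eventually_sequentially)
  then show ?thesis
    by (intro that[of "real (Suc n)" "k n"]) (auto simp: k_def)
qed

lemma Lp_compact_approx_continuous:
  fixes u :: "real \<Rightarrow> 'b::euclidean_space"
  assumes u: "Lp_compact p u" and p: "0 < p" and e: "0 < e"
  obtains g where "continuous_on UNIV g"
    "integrable lborel (\<lambda>t. indicator {a..b} t * norm (u t - g t) powr p)"
    "(LINT t|lborel. indicator {a..b} t * norm (u t - g t) powr p) < e"
proof -
  note [measurable] = Lp_compact_borel[OF u]
  \<comment> \<open>The truncation error and the error of the continuous approximation each pick up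
    the factor \<open>2 powr p\<close> from \<open>norm_add_powr_le\<close>; half of
    \<open>e\<close> is reserved for each.\<close>
  define e' where "e' = e / (2 * 2 powr p)"
  have e': "0 < e'" using e by (simp add: e'_def)
  obtain C v where v: "0 < C" "v \<in> borel_measurable borel" "\<And>t. norm (v t) \<le> C"
    "\<And>t. norm (v t) \<le> norm (u t)" "(LINT t|lborel. norm (u t - v t) powr p) < e'"
    by (rule Lp_compact_approx_bounded[OF u p e']) (rule that)
  obtain g where g: "continuous_on UNIV g" "\<And>t. norm (g t) \<le> C"
    "(LINT t|lborel. indicator {a..b} t * norm (v t - g t) powr p) < e'"
    by (rule bounded_approx_continuous[OF v(2,1,3) p e']) (rule that)
  have [measurable]: "g \<in> borel_measurable borel" "v \<in> borel_measurable borel"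
    using g(1) v(2) by (auto intro: borel_measurable_continuous_onI)
  have iuv: "integrable lborel (\<lambda>t. norm (u t - v t) powr p)"
  proof (rule Bochner_Integration.integrable_bound)
    show "integrable lborel (\<lambda>t. 2 powr p * (norm (u t) powr p + norm (u t) powr p))"
      using Lp_compact_integrable_powr[OF u] by simp
    have "norm (u t - v t) powr p \<le> 2 powr p * (norm (u t) powr p + norm (u t) powr p)" for t
      using norm_diff_powr_le[of p "u t" "v t"] powr_mono2[of p "norm (v t)" "norm (u t)"] v(4)[of t] p
      by (smt (verit) mult_left_mono norm_ge_zero powr_ge_zero)
    then show "AE t in lborel. norm (norm (u t - v t) powr p)
        \<le> norm (2 powr p * (norm (u t) powr p + norm (u t) powr p))"
      by (auto simp: abs_mult)
  qed simp
  have ivg: "integrable lborel (\<lambda>t. indicator {a..b} t * norm (v t - g t) powr p)"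
  proof (rule Bochner_Integration.integrable_bound)
    show "integrable lborel (\<lambda>t::real. (2 * C) powr p * indicator {a..b} t)" by simp
    have "norm (v t - g t) powr p \<le> (2 * C) powr p" for t
      using norm_triangle_ineq4[of "v t" "g t"] v(3)[of t] g(2)[of t] p
      by (intro powr_mono2) auto
    then show "AE t in lborel. norm (indicator {a..b} t * norm (v t - g t) powr p)
        \<le> norm ((2 * C) powr p * indicator {a..b} t)"
      by (auto simp: indicator_def intro!: AE_I2)
  qed simp
  define w where "w t = 2 powr p * (norm (u t - v t) powr p + indicator {a..b} t * norm (v t - g
      t) powr p)" for t
  have iw: "integrable lborel w"
    unfolding w_def using iuv ivg by simp
  have le: "indicator {a..b} t * norm (u t - g t) powr p \<le> w t" for t
    using norm_add_powr_le[of p "u t - v t" "v t - g t"] p by (auto simp: w_def indicator_def)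
  have i: "integrable lborel (\<lambda>t. indicator {a..b} t * norm (u t - g t) powr p)"
    by (rule Bochner_Integration.integrable_bound[OF iw])
       (use le in \<open>auto intro!: AE_I2 order_trans[OF le] simp: abs_mult\<close>)
  have "(LINT t|lborel. indicator {a..b} t * norm (u t - g t) powr p) \<le> (LINT t|lborel. w t)"
    by (intro integral_mono i iw le)
  also have "\<dots> = 2 powr p * ((LINT t|lborel. norm (u t - v t) powr p)
      + (LINT t|lborel. indicator {a..b} t * norm (v t - g t) powr p))"
    unfolding w_def using iuv ivg by simp
  also have "\<dots> < 2 powr p * (e' + e')"
    using v(5) g(3) by (intro mult_strict_left_mono add_strict_mono) auto
  also have "\<dots> = e" by (simp add: e'_def field_simps)
  finally show ?thesis using that g(1) i by blast
qed

text \<open>Three-term comparison with a continuous \<open>g\<close>: u(t+h) - u(t) splits into u -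
  g at t+h, the increment of g, and g - u at t. The outer terms are small by density, the middle one
  by uniform continuity on a compact interval.\<close>

lemma translation_continuous_Lp:
  fixes u :: "real \<Rightarrow> 'b::euclidean_space"
  assumes u: "Lp_compact p u" and p: "0 < p"
  shows "((\<lambda>h. LINT t|lborel. norm (u (t + h) - u t) powr p) \<longlongrightarrow> 0) (at 0)"
proof (rule tendstoI)
  fix e :: real assume "0 < e"
  note [measurable] = Lp_compact_borel[OF u]
  obtain R where R: "0 < R" "\<And>t. R < \<bar>t\<bar> \<Longrightarrow> u t = 0"
    using Lp_compact_bounded_support[OF u] by blast
  \<comment> \<open>For |h| < 1/2 the integrand vanishes outside \<open>I'\<close>, and
    \<open>t \<in> I'\<close> puts both \<open>t\<close> and \<open>t + h\<close> into
    \<open>I\<close>, where \<open>g\<close> approximates \<open>u\<close>.\<close>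
  define I where "I = {- (R + 1)..R + 1}"
  define I' where "I' = {- (R + 1/2)..R + 1/2}"
  \<comment> \<open>\<open>K\<close> comes from two applications of \<open>norm_add_powr_le\<close>;
    with \<open>e1 = e / (4 * K)\<close> the three terms add up to less than 3/4 of
    \<open>e\<close>.\<close>
  define K where "K = 2 powr p * 2 powr p"
  have p2: "1 \<le> 2 powr p" using p by (intro ge_one_powr_ge_zero) auto
  have K: "0 < K" by (simp add: K_def)
  define e1 where "e1 = e / (4 * K)"
  have e1: "0 < e1" using \<open>0 < e\<close> K by (simp add: e1_def)
  obtain g where g: "continuous_on UNIV g"
    "integrable lborel (\<lambda>t. indicator I t * norm (u t - g t) powr p)"
    "(LINT t|lborel. indicator I t * norm (u t - g t) powr p) < e1"
    unfolding I_def by (rule Lp_compact_approx_continuous[OF u p e1])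
  have [measurable]: "g \<in> borel_measurable borel"
    using g(1) by (rule borel_measurable_continuous_onI)
  \<comment> \<open>\<open>2 * R + 1\<close> is the length of \<open>I'\<close>, so increments of
    \<open>g\<close> below \<open>c\<close> contribute at most \<open>e1\<close> to the
    integral.\<close>
  define c where "c = (e1 / (2 * R + 1)) powr (1 / p)"
  have c: "0 < c" "c powr p = e1 / (2 * R + 1)" using e1 R p by (auto simp: c_def powr_powr)
  have "uniformly_continuous_on I g"
    unfolding I_def using g(1) by (intro compact_uniformly_continuous) (auto intro: continuous_on_subset)
  then obtain d where d: "0 < d" "\<And>s t. s \<in> I \<Longrightarrow> t \<in> I \<Longrightarrow> dist s t < d \<Longrightarrow> dist (g s) (g t) < c"
    using c(1) unfolding uniformly_continuous_on_def by metis
  have "\<forall>\<^sub>F h in at 0. \<bar>h\<bar> < min d (1/2)"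
    using d(1) unfolding eventually_at by (intro exI[of _ "min d (1/2)"]) auto
  then show "\<forall>\<^sub>F h in at 0. dist (LINT t|lborel. norm (u (t + h) - u t) powr p) 0 < e"
  proof eventually_elim
    case (elim h)
    define f where "f t = indicator I t * norm (u t - g t) powr p" for t
    define w where "w t = K * (f (t + h) + e1 / (2 * R + 1) * indicator I' t + f t)" for t
    have fi: "integrable lborel f" "(LINT t|lborel. f t) < e1"
      using g(2,3) by (auto simp: f_def[abs_def])
    have f0: "0 \<le> f t" for t by (simp add: f_def)
    have iw: "integrable lborel w"
      unfolding w_def using fi(1) by (simp add: lborel_integrable_translate I'_def)
    have le: "norm (u (t + h) - u t) powr p \<le> w t" for t
    proof (cases "t \<in> I'")
      case False
      then have "u t = 0" "u (t + h) = 0"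
        using elim R by (auto simp: I'_def)
      then show ?thesis using p f0 K e1 R by (simp add: w_def)
    next
      case True
      then have I: "t \<in> I" "t + h \<in> I" using elim by (auto simp: I'_def I_def)
      have "dist (g (t + h)) (g t) < c"
        using I elim by (intro d(2)) (auto simp: dist_norm)
      then have gg: "norm (g (t + h) - g t) powr p \<le> e1 / (2 * R + 1)"
        using p unfolding c(2)[symmetric] dist_norm by (intro powr_mono2) auto
      have "norm (u (t + h) - u t) powr p
          = norm ((u (t + h) - g (t + h)) + ((g (t + h) - g t) + (g t - u t))) powr p"
        by simp
      also have "\<dots> \<le> 2 powr p * (norm (u (t + h) - g (t + h)) powr p + norm ((g (t + h) - g t) +
          (g t - u t)) powr p)"
        using p by (intro norm_add_powr_le) auto
      also have "\<dots> \<le> 2 powr p * (norm (u (t + h) - g (t + h)) powr p +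
          2 powr p * (norm (g (t + h) - g t) powr p + norm (g t - u t) powr p))"
        using p by (intro mult_left_mono add_left_mono norm_add_powr_le) auto
      also have "\<dots> \<le> 2 powr p * (2 powr p * norm (u (t + h) - g (t + h)) powr p +
          2 powr p * (norm (g (t + h) - g t) powr p + norm (g t - u t) powr p))"
        using p2 mult_right_mono[of 1 "2 powr p" "norm (u (t + h) - g (t + h)) powr p"]
        by (intro mult_left_mono add_right_mono) auto
      also have "\<dots> = K * (f (t + h) + norm (g (t + h) - g t) powr p + f t)"
        using I by (simp add: K_def f_def norm_minus_commute algebra_simps)
      also have "\<dots> \<le> w t"
        unfolding w_def using gg True K by (intro mult_left_mono add_mono) auto
      finally show ?thesis .
    qed
    have "(LINT t|lborel. norm (u (t + h) - u t) powr p) \<le> (LINT t|lborel. w t)"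
      by (rule integral_mono'[OF iw le]) (rule order_trans[OF powr_ge_zero le])
    also have "\<dots> = K * ((LINT t|lborel. f t) + e1 / (2 * R + 1) * (2 * R + 1) + (LINT t|lborel. f t))"
      unfolding w_def using fi(1) R
      by (simp add: lborel_integrable_translate lborel_integral_translate I'_def)
    also have "\<dots> < K * (e1 + e1 + e1)"
      using fi(2) K R by (intro mult_strict_left_mono) auto
    also have "\<dots> \<le> e" using K \<open>0 < e\<close> by (simp add: e1_def)
    finally show ?case by simp
  qed
qed

section \<open>Difference quotients of primitives\<close>

text \<open>The tangent at \<open>m\<close> lies below the convex function x^p. Young's inequality
  with the conjugate exponent p/(p-1) proves this in a way that includes
  \<open>m = 0\<close>.\<close>

lemma powr_tangent_le:
  fixes x m p :: real
  assumes p: "1 < p" and "0 \<le> x" "0 \<le> m"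
  shows "m powr p + p * m powr (p - 1) * (x - m) \<le> x powr p"
proof -
  define q where "q = p / (p - 1)"
  have q: "1 < q" "1 / p + 1 / q = 1" "(p - 1) * q = p"
    using p by (auto simp: q_def field_simps)
  have "x * m powr (p - 1) \<le> x powr p / p + (m powr (p - 1)) powr q / q"
    using assms q by (intro Youngs_inequality) auto
  then have "x * m powr (p - 1) \<le> x powr p / p + m powr p * ((p - 1) / p)"
    using p by (simp add: powr_powr q(3)) (simp add: q_def)
  then have "p * (x * m powr (p - 1)) \<le> p * (x powr p / p + m powr p * ((p - 1) / p))"
    using p by (intro mult_left_mono) auto
  also have "\<dots> = x powr p + (p - 1) * m powr p"
    using p by (simp add: field_simps)
  finally have "p * (x * m powr (p - 1)) \<le> x powr p + (p - 1) * m powr p" .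
  moreover have "m * m powr (p - 1) = m powr p"
    using assms powr_mult_base[of m "p - 1"] by simp
  moreover have "p * m powr (p - 1) * (x - m) = p * (x * m powr (p - 1)) - p * (m * m powr (p - 1))"
    by (simp add: algebra_simps)
  ultimately show ?thesis by (simp add: algebra_simps)
qed

text \<open>Jensen's inequality for the uniform distribution on (0,\<epsilon>]. The tangent
  inequality is integrated at the norm \<open>m\<close> of the average; its linear term contributes
  nonnegatively because \<open>m\<close> is at most the average of the norms. With values in
  \<open>ennreal\<close> no integrability of \<open>G\<close> has to be assumed.\<close>

lemma norm_average_powr_le:
  fixes G :: "real \<Rightarrow> 'b::euclidean_space"
  assumes [measurable]: "G \<in> borel_measurable borel" and e: "0 < \<epsilon>" and p: "1 < p"
  shows "ennreal (norm ((1 / \<epsilon>) *\<^sub>R (LINT a:{0<..\<epsilon>}|lborel. G a)) powr p) \<le>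
    ennreal (1 / \<epsilon>) * (\<integral>\<^sup>+a. indicator {0<..\<epsilon>} a * ennreal (norm (G a) powr p) \<partial>lborel)"
proof -
  let ?I = "indicat_real {0<..\<epsilon>}"
  define m where "m = norm ((1 / \<epsilon>) *\<^sub>R (LINT a:{0<..\<epsilon>}|lborel. G a))"
  let ?N = "\<integral>\<^sup>+a. indicator {0<..\<epsilon>} a * ennreal (norm (G a) powr p) \<partial>lborel"
  have N: "?N = (\<integral>\<^sup>+a. ennreal (?I a * norm (G a) powr p) \<partial>lborel)"
    by (intro nn_integral_cong) (auto simp: indicator_def)
  consider "m = 0" | "?N = \<infinity>" | "m \<noteq> 0" "?N < \<infinity>"
    using top.not_eq_extremum[of ?N] by auto
  then have "ennreal (m powr p) \<le> ennreal (1 / \<epsilon>) * ?N"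
  proof cases
    case 2
    then show ?thesis using e by (simp add: ennreal_mult_top)
  next
    case 3
    have I: "integrable lborel ?I" by (rule integrable_real_indicator) (auto simp:
        emeasure_lborel_Ioc e less_imp_le)
    have m0: "0 \<le> m" unfolding m_def by simp
    have mI: "(LINT a|lborel. ?I a) = \<epsilon>" using e by simp
    have i1: "integrable lborel (\<lambda>a. ?I a * norm (G a) powr p)"
      using 3(2) unfolding N by (intro integrableI_bounded) (auto simp: abs_mult)
    \<comment> \<open>A non-integrable \<open>G\<close> has integral 0 by convention, which would
      give \<open>m = 0\<close>.\<close>
    have "set_integrable lborel {0<..\<epsilon>} G"
    proof (rule ccontr)
      assume "\<not> ?thesis"
      then have "(LINT a:{0<..\<epsilon>}|lborel. G a) = 0"
        unfolding set_integrable_def set_lebesgue_integral_def by (rule not_integrable_integral_eq)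
      then show False using 3(1) by (simp add: m_def)
    qed
    then have i2: "integrable lborel (\<lambda>a. ?I a * norm (G a))"
      unfolding set_integrable_def by (drule_tac integrable_norm) simp
    have "norm (LINT a:{0<..\<epsilon>}|lborel. G a) \<le> (LINT a|lborel. ?I a * norm (G a))"
      unfolding set_lebesgue_integral_def by (rule order_trans[OF integral_norm_bound]) simp
    then have m: "\<epsilon> * m \<le> (LINT a|lborel. ?I a * norm (G a))"
      using e by (simp add: m_def)
    have "\<epsilon> * m powr p \<le> \<epsilon> * m powr p + p * m powr (p - 1) * ((LINT a|lborel. ?I a * norm (G a)) -
        \<epsilon> * m)"
      using m p by simp
    also have "\<dots> = (LINT a|lborel. ?I a * m powr p + p * m powr (p - 1) * (?I a * norm (G a) - ?I
        a * m))"
      using I i2 mI by simp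
    also have "\<dots> \<le> (LINT a|lborel. ?I a * norm (G a) powr p)"
    proof (rule integral_mono[OF _ i1])
      show "integrable lborel (\<lambda>a. ?I a * m powr p + p * m powr (p - 1) * (?I a * norm (G a) - ?I
          a * m))"
        using I i2 by simp
      show "?I a * m powr p + p * m powr (p - 1) * (?I a * norm (G a) - ?I a * m) \<le> ?I a * norm (G
          a) powr p" for a
        using powr_tangent_le[OF p norm_ge_zero m0, of "G a"] by (simp add: indicator_def)
    qed
    finally have "m powr p \<le> (1 / \<epsilon>) * (LINT a|lborel. ?I a * norm (G a) powr p)"
      using e by (simp add: field_simps)
    moreover have "ennreal (1 / \<epsilon>) * ?N = ennreal ((1 / \<epsilon>) * (LINT a|lborel. ?I a * norm (G a) powr p))"
      unfolding N using e i1 by (subst nn_integral_eq_integral) (auto simp flip: ennreal_mult')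
    ultimately show ?thesis by (simp add: ennreal_leI)
  qed (use p in simp)
  then show ?thesis by (simp add: m_def)
qed

text \<open>Minkowski's integral inequality for averages: Jensen pointwise in \<open>t\<close>,
  Tonelli, and the bound \<open>C\<close> averaged over an interval of length
  \<open>\<epsilon>\<close>.\<close>

lemma nn_integral_average_powr_le:
  fixes G :: "real \<Rightarrow> real \<Rightarrow> 'b::euclidean_space"
  assumes [measurable]: "(\<lambda>(t, a). G t a) \<in> borel_measurable (borel \<Otimes>\<^sub>M borel)"
    and e: "0 < \<epsilon>" and p: "1 < p"
    and C: "\<And>a. a \<in> {0<..\<epsilon>} \<Longrightarrow> (\<integral>\<^sup>+t. ennreal (norm (G t a) powr p) \<partial>lborel) \<le> C"
  shows "(\<integral>\<^sup>+t. ennreal (norm ((1 / \<epsilon>) *\<^sub>R (LINT a:{0<..\<epsilon>}|lborel. G t a)) powr p) \<partial>lborel) \<le> C"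
proof -
  have "(\<integral>\<^sup>+t. ennreal (norm ((1 / \<epsilon>) *\<^sub>R (LINT a:{0<..\<epsilon>}|lborel. G t a)) powr p) \<partial>lborel) \<le>
      (\<integral>\<^sup>+t. ennreal (1 / \<epsilon>) * (\<integral>\<^sup>+a. indicator {0<..\<epsilon>} a * ennreal (norm (G t a) powr p) \<partial>lborel)
          \<partial>lborel)"
    by (intro nn_integral_mono norm_average_powr_le e p) measurable
  also have "\<dots> = ennreal (1 / \<epsilon>) * (\<integral>\<^sup>+t. (\<integral>\<^sup>+a. indicator {0<..\<epsilon>} a * ennreal (norm (G t a) powr
      p) \<partial>lborel) \<partial>lborel)"
    by (rule nn_integral_cmult) measurable
  also have "(\<integral>\<^sup>+t. (\<integral>\<^sup>+a. indicator {0<..\<epsilon>} a * ennreal (norm (G t a) powr p) \<partial>lborel) \<partial>lborel) =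
      (\<integral>\<^sup>+a. (\<integral>\<^sup>+t. indicator {0<..\<epsilon>} a * ennreal (norm (G t a) powr p) \<partial>lborel) \<partial>lborel)"
    by (rule lborel_pair.Fubini'[symmetric]) measurable
  also have "\<dots> \<le> (\<integral>\<^sup>+a. C * indicator {0<..\<epsilon>} a \<partial>lborel)"
    by (rule nn_integral_mono) (use C in \<open>auto simp: indicator_def\<close>)
  also have "\<dots> = C * ennreal \<epsilon>" using e by (subst nn_integral_cmult_indicator) auto
  also have "ennreal (1 / \<epsilon>) * (C * ennreal \<epsilon>) = C"
    using e by (simp add: mult.left_commute flip: ennreal_mult)
  finally show ?thesis using e by (simp add: mult_left_mono)
qed

text \<open>Integrating from minus infinity instead of from -r makes primitives commute with
  translations, so no base point has to be moved along with the windows.\<close>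

definition primitive :: "(real \<Rightarrow> 'b::euclidean_space) \<Rightarrow> real \<Rightarrow> 'b" where
  "primitive u t = (LINT s:{..t}|lborel. u s)"

lemma integrable_translate_left:
  fixes u :: "real \<Rightarrow> 'b::euclidean_space"
  shows "integrable lborel (\<lambda>a. u (t + a)) \<longleftrightarrow> integrable lborel u"
  using lborel_integrable_translate[of u t] by (simp add: add.commute)

lemma primitive_diff:
  fixes u :: "real \<Rightarrow> 'b::euclidean_space"
  assumes u: "integrable lborel u" and "0 \<le> \<epsilon>"
  shows "primitive u (t + \<epsilon>) - primitive u t = (LINT a:{0<..\<epsilon>}|lborel. u (t + a))"
proof -
  have i: "integrable lborel (\<lambda>s. indicat_real {..b} s *\<^sub>R u s)" for b
    by (rule integrable_mult_indicator[OF _ u]) auto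
  have "primitive u (t + \<epsilon>) - primitive u t =
      (LINT s|lborel. indicat_real {..t + \<epsilon>} s *\<^sub>R u s - indicat_real {..t} s *\<^sub>R u s)"
    unfolding primitive_def set_lebesgue_integral_def
    by (rule Bochner_Integration.integral_diff[symmetric]) (rule i)+
  also have "\<dots> = (LINT s|lborel. indicat_real {t<..t + \<epsilon>} s *\<^sub>R u s)"
    using assms(2) by (intro Bochner_Integration.integral_cong) (auto simp: indicator_def)
  also have "\<dots> = (LINT a|lborel. indicat_real {t<..t + \<epsilon>} (a + t) *\<^sub>R u (a + t))"
    by (rule lborel_integral_translate[symmetric])
  also have "\<dots> = (LINT a:{0<..\<epsilon>}|lborel. u (t + a))"
    unfolding set_lebesgue_integral_def
    by (intro Bochner_Integration.integral_cong) (auto simp: indicator_def add.commute)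
  finally show ?thesis .
qed

lemma norm_set_integral_le:
  fixes u :: "real \<Rightarrow> 'b::euclidean_space"
  assumes "integrable lborel u" "A \<in> sets borel"
  shows "norm (LINT s:A|lborel. u s) \<le> (LINT s|lborel. norm (u s))"
proof -
  have "norm (LINT s:A|lborel. u s) \<le> (LINT s|lborel. norm (indicat_real A s *\<^sub>R u s))"
    unfolding set_lebesgue_integral_def by (rule integral_norm_bound)
  also have "\<dots> \<le> (LINT s|lborel. norm (u s))"
    using assms by (intro integral_mono integrable_norm integrable_mult_indicator)
      (auto simp: indicator_def)
  finally show ?thesis .
qed

text \<open>The increment over \<open>h\<close> is the integral of u(s+h) - u(s) over
  \<open>{..t}\<close>, so this is the continuity of translations for exponent 1.\<close>

lemma continuous_primitive:
  assumes u: "Lp_compact 1 u"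
  shows "continuous_on UNIV (primitive u)"
proof -
  have iu: "integrable lborel u" by (rule Lp_compact_integrable[OF u]) simp
  have "isCont (primitive u) t" for t
  proof -
    have d: "norm (primitive u (t + h) - primitive u t) \<le> (LINT s|lborel. norm (u (s + h) - u s)
        powr 1)" for h
    proof -
      have "primitive u (t + h) = (LINT s:{..t}|lborel. u (s + h))"
        unfolding primitive_def set_lebesgue_integral_def
        by (subst lborel_integral_translate[symmetric, of _ h])
           (intro Bochner_Integration.integral_cong, auto simp: indicator_def)
      moreover have "integrable lborel (\<lambda>s. u (s + h))"
        using iu by (simp add: lborel_integrable_translate)
      ultimately have "primitive u (t + h) - primitive u t = (LINT s:{..t}|lborel. u (s + h) - u s)"
        unfolding primitive_def set_lebesgue_integral_def using iu
        by (simp add: scaleR_diff_right integrable_mult_indicator flip: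
            Bochner_Integration.integral_diff)
      then show ?thesis
        using norm_set_integral_le[of "\<lambda>s. u (s + h) - u s" "{..t}"] iu
        by (simp add: lborel_integrable_translate)
    qed
    have "((\<lambda>h. primitive u (t + h) - primitive u t) \<longlongrightarrow> 0) (at 0)"
      by (rule Lim_null_comparison[OF always_eventually translation_continuous_Lp[OF u]]) (use d in auto)
    then show ?thesis unfolding isCont_iff by (simp add: LIM_zero_iff)
  qed
  then show ?thesis by (simp add: continuous_at_imp_continuous_on)
qed

lemma primitive_eq_zero:
  fixes u :: "real \<Rightarrow> 'b::euclidean_space"
  assumes "\<And>t. t < a \<Longrightarrow> u t = 0" "t \<le> a"
  shows "primitive u t = 0"
proof -
  \<comment> \<open>For \<open>t = a\<close> the value \<open>u a\<close> is unconstrained, but a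
    single point carries no mass.\<close>
  have "primitive u t = (LINT s|lborel. indicat_real {a} s *\<^sub>R (indicat_real {..t} s *\<^sub>R u s))"
    unfolding primitive_def set_lebesgue_integral_def
    using assms by (intro Bochner_Integration.integral_cong) (force simp: indicator_def)+
  also have "\<dots> = 0"
    by (rule integral_eq_zero_AE, use AE_lborel_singleton[of a] in eventually_elim) simp
  finally show ?thesis .
qed

lemma primitive_eq_const:
  fixes u :: "real \<Rightarrow> 'b::euclidean_space"
  assumes "\<And>t. b < t \<Longrightarrow> u t = 0" "b \<le> t"
  shows "primitive u t = primitive u b"
  unfolding primitive_def set_lebesgue_integral_def
  using assms by (intro Bochner_Integration.integral_cong) (auto simp: indicator_def not_less)

lemma Lp_compact_scaleR:
  assumes "Lp_compact p u"
  shows "Lp_compact p (\<lambda>t. k *\<^sub>R u t)"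
  using assms by (auto simp: Lp_compact_def powr_mult)

text \<open>To the right of the support of \<open>u\<close> a primitive is constant but in general
  not zero; its increments do have bounded support.\<close>

lemma Lp_compact_increment:
  assumes u: "Lp_compact p u" and p: "1 \<le> p" and e: "0 \<le> \<epsilon>"
  shows "Lp_compact p (\<lambda>t. primitive u (t + \<epsilon>) - primitive u t)"
proof -
  have iu: "integrable lborel u" by (rule Lp_compact_integrable[OF u p])
  obtain R where R: "0 < R" "\<And>t. R < \<bar>t\<bar> \<Longrightarrow> u t = 0"
    using Lp_compact_bounded_support[OF u] by blast
  have c: "continuous_on UNIV (primitive u)"
    by (rule continuous_primitive[OF Lp_compact_mono_exponent[OF u p]])
  have [measurable]: "primitive u \<in> borel_measurable borel"
    by (rule borel_measurable_continuous_onI[OF c])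
  show ?thesis
  proof (rule Lp_compact_bounded)
    show "norm (primitive u (t + \<epsilon>) - primitive u t) \<le> (LINT s|lborel. norm (u s))" for t
      unfolding primitive_diff[OF iu e]
      using norm_set_integral_le[of "\<lambda>s. u (t + s)" "{0<..\<epsilon>}"] iu
        lborel_integral_translate[of "\<lambda>s. norm (u s)" t]
      by (simp add: integrable_translate_left add.commute[of _ t])
    show "0 < R + \<epsilon>" using R e by simp
    show "primitive u (t + \<epsilon>) - primitive u t = 0" if "R + \<epsilon> < \<bar>t\<bar>" for t
    proof (cases "t < 0")
      case True
      then show ?thesis using primitive_eq_zero[of "- R" u] R that e by auto
    next
      case False
      then have "R \<le> t" using that e by auto
      then show ?thesis
        using primitive_eq_const[of R u t] primitive_eq_const[of R u "t + \<epsilon>"] R e by auto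
    qed
  qed (use p in auto)
qed

text \<open>The quotient minus \<open>u t\<close> is the average of \<open>u (t + a) - u t\<close>
  over \<open>a\<close> in (0,\<epsilon>], so its L^p norm is controlled by translations by at most
  \<epsilon>.\<close>

lemma difference_quotient_Lp:
  fixes u :: "real \<Rightarrow> 'b::euclidean_space"
  assumes u: "Lp_compact p u" and p: "1 < p"
  shows "((\<lambda>\<epsilon>. LINT t|lborel. norm ((1 / \<epsilon>) *\<^sub>R (primitive u (t + \<epsilon>) - primitive u t) - u t) powr p)
    \<longlongrightarrow> 0) (at_right 0)"
proof (rule tendstoI)
  fix e :: real assume e: "0 < e"
  note [measurable] = Lp_compact_borel[OF u]
  have iu: "integrable lborel u" by (rule Lp_compact_integrable[OF u]) (use p in simp)
  have "\<forall>\<^sub>F h in at 0. (LINT t|lborel. norm (u (t + h) - u t) powr p) < e / 2"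
    using translation_continuous_Lp[OF u] p e by (intro order_tendstoD(2)) auto
  then obtain d where d: "0 < d" "\<And>h. h \<noteq> 0 \<Longrightarrow> \<bar>h\<bar> < d \<Longrightarrow> (LINT t|lborel. norm (u (t + h) - u t)
      powr p) < e / 2"
    unfolding eventually_at by (auto simp: dist_real_def)
  have "\<forall>\<^sub>F \<epsilon> in at_right 0. \<epsilon> \<in> {0<..<d}"
    using d(1) by (rule eventually_at_right_real)
  then show "\<forall>\<^sub>F \<epsilon> in at_right 0.
    dist (LINT t|lborel. norm ((1 / \<epsilon>) *\<^sub>R (primitive u (t + \<epsilon>) - primitive u t) - u t) powr p) 0 < e"
  proof eventually_elim
    case (elim \<epsilon>)
    then have \<epsilon>: "0 < \<epsilon>" "\<epsilon> < d" by auto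
    let ?q = "\<lambda>t. (1 / \<epsilon>) *\<^sub>R (primitive u (t + \<epsilon>) - primitive u t) - u t"
    have q: "?q t = (1 / \<epsilon>) *\<^sub>R (LINT a:{0<..\<epsilon>}|lborel. u (t + a) - u t)" for t
    proof -
      have "set_integrable lborel {0<..\<epsilon>} (\<lambda>a. u (t + a))"
        unfolding set_integrable_def using iu
        by (intro integrable_mult_indicator) (auto simp: integrable_translate_left)
      moreover have "set_integrable lborel {0<..\<epsilon>} (\<lambda>a. u t)"
        using \<epsilon> unfolding set_integrable_def
        by (intro integrable_scaleR_left) (auto intro!: integrable_real_indicator)
      moreover have "(LINT a:{0<..\<epsilon>}|lborel. u t) = \<epsilon> *\<^sub>R u t"
        using \<epsilon> by (simp add: set_lebesgue_integral_def)
      ultimately show ?thesis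
        using \<epsilon> by (simp add: set_integral_diff primitive_diff[OF iu] scaleR_diff_right)
    qed
    have L: "Lp_compact p ?q"
      using u p \<epsilon> by (intro Lp_compact_diff Lp_compact_scaleR Lp_compact_increment) auto
    have "(\<integral>\<^sup>+t. ennreal (norm (?q t) powr p) \<partial>lborel) \<le> ennreal (e / 2)"
      unfolding q
    proof (rule nn_integral_average_powr_le)
      fix a assume a: "a \<in> {0<..\<epsilon>}"
      have "Lp_compact p (\<lambda>t. u (t + a) - u t)"
        using u p by (intro Lp_compact_diff Lp_compact_translate) auto
      then have "(\<integral>\<^sup>+t. ennreal (norm (u (t + a) - u t) powr p) \<partial>lborel) =
          ennreal (LINT t|lborel. norm (u (t + a) - u t) powr p)"
        by (intro nn_integral_eq_integral Lp_compact_integrable_powr) auto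
      then show "(\<integral>\<^sup>+t. ennreal (norm (u (t + a) - u t) powr p) \<partial>lborel) \<le> ennreal (e / 2)"
        using d(2)[of a] a \<epsilon> by (simp add: ennreal_leI)
    qed (use \<epsilon> p in auto)
    also have "(\<integral>\<^sup>+t. ennreal (norm (?q t) powr p) \<partial>lborel) = ennreal (LINT t|lborel. norm (?q t)
        powr p)"
      using Lp_compact_integrable_powr[OF L] by (intro nn_integral_eq_integral) auto
    finally have "(LINT t|lborel. norm (?q t) powr p) \<le> e / 2"
      using e by (simp add: ennreal_le_iff)
    then show ?case using e by simp
  qed
qed

section \<open>Passage from the whole line to the window [-r,0]\<close>

lemma integrable_lebesgue_on_borel:
  fixes f :: "real \<Rightarrow> 'b::euclidean_space"
  assumes "integrable lborel f" "S \<in> sets borel"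
  shows "integrable (lebesgue_on S) f"
proof -
  have "integrable lebesgue f"
    using assms(1) by (subst integrable_completion) auto
  then show ?thesis
    using assms(2) by (subst integrable_restrict_space) (auto intro: integrable_mult_indicator)
qed

lemma integral_lebesgue_on_borel:
  fixes f :: "real \<Rightarrow> 'b::euclidean_space"
  assumes [measurable]: "f \<in> borel_measurable borel" "S \<in> sets borel"
  shows "(LINT t|lebesgue_on S. f t) = (LINT t|lborel. indicat_real S t *\<^sub>R f t)"
  using assms by (subst integral_restrict_space) (auto intro!: integral_completion)

lemma Lp_compact_imp_Lp:
  assumes "Lp_compact p u"
  shows "u \<in> Lp p r"
proof -
  have "u \<in> borel_measurable lebesgue"
    using Lp_compact_borel[OF assms] by (auto intro: measurable_completion)
  then show ?thesis
    using integrable_lebesgue_on_borel[OF Lp_compact_integrable_powr[OF assms]]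
    by (simp add: Lp_def measurable_restrict_space1)
qed

lemma Lp_norm_powr_le_lborel:
  assumes "Lp_compact p u" "0 < p"
  shows "Lp_norm p r u powr p \<le> (LINT t|lborel. norm (u t) powr p)"
proof -
  note [measurable] = Lp_compact_borel[OF assms(1)]
  have "Lp_norm p r u powr p = (LINT t|lborel. indicat_real {-r..0} t *\<^sub>R norm (u t) powr p)"
    using assms(2) by (simp add: Lp_norm_powr integral_lebesgue_on_borel)
  also have "\<dots> \<le> (LINT t|lborel. norm (u t) powr p)"
    using Lp_compact_integrable_powr[OF assms(1)]
    by (intro integral_mono integrable_mult_indicator) (auto simp: indicator_def)
  finally show ?thesis .
qed

section \<open>The lemma of du Bois-Reymond\<close>

text \<open>The space C_c(-r,0). Derivatives of test functions are exactly its members with integral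
  zero.\<close>

definition compactly_supported :: "real \<Rightarrow> (real \<Rightarrow> real) \<Rightarrow> bool" where
  "compactly_supported r G \<longleftrightarrow> continuous_on UNIV G \<and> (\<exists>a b. -r < a \<and> b < 0 \<and> (\<forall>t. t \<notin> {a..b} \<longrightarrow> G t = 0))"

lemma compactly_supported_bounded:
  assumes "compactly_supported r G"
  obtains B where "\<And>t. \<bar>G t\<bar> \<le> B" "0 \<le> B"
proof -
  obtain a b where ab: "\<And>t. t \<notin> {a..b} \<Longrightarrow> G t = 0" and c: "continuous_on UNIV G"
    using assms unfolding compactly_supported_def by blast
  have "compact (G ` {a..b})"
    by (intro compact_continuous_image continuous_on_subset[OF c]) auto
  then have "bounded (G ` {a..b})" by (rule compact_imp_bounded)
  then obtain B where "\<forall>x\<in>G ` {a..b}. norm x \<le> B" unfolding bounded_iff by blast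
  then have "\<bar>G t\<bar> \<le> B" if "t \<in> {a..b}" for t using that by auto
  then have "\<bar>G t\<bar> \<le> max B 0" for t
    using ab[of t] by (cases "t \<in> {a..b}") (auto intro: order_trans[of _ B])
  then show ?thesis using that[of "max B 0"] by simp
qed

lemma compactly_supported_borel: "compactly_supported r G \<Longrightarrow> G \<in> borel_measurable borel"
  by (auto simp: compactly_supported_def intro: borel_measurable_continuous_onI)

lemma integrable_bounded_scaleR:
  fixes w :: "real \<Rightarrow> 'b::euclidean_space"
  assumes w: "integrable N w" and [measurable]: "G \<in> borel_measurable N" and B: "\<And>t. \<bar>G t\<bar> \<le> B"
  shows "integrable N (\<lambda>t. G t *\<^sub>R w t)"
proof (rule Bochner_Integration.integrable_bound)
  show "integrable N (\<lambda>t. B *\<^sub>R w t)" using w by simp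
  show "(\<lambda>t. G t *\<^sub>R w t) \<in> borel_measurable N" using w by measurable
  have "\<bar>G t\<bar> \<le> \<bar>B\<bar>" for t using B[of t] by linarith
  then show "AE t in N. norm (G t *\<^sub>R w t) \<le> norm (B *\<^sub>R w t)"
    by (auto intro!: AE_I2 mult_right_mono)
qed

lemma borel_imp_lebesgue_on: "f \<in> borel_measurable borel \<Longrightarrow> f \<in> borel_measurable (lebesgue_on S)"
  by (intro measurable_restrict_space1 measurable_completion) simp

lemma AE_lebesgue_on_singleton: "AE t in lebesgue_on {a..b::real}. t \<noteq> c"
proof -
  have "AE t in lebesgue. t \<noteq> c"
    unfolding AE_lborel_iff_lebesgue by (rule AE_lborel_singleton)
  then show ?thesis by (subst AE_restrict_space_iff) (auto elim: eventually_mono)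
qed

text \<open>Fundamental lemma of the calculus of variations. The sign of \<open>w\<close> is a
  bounded a.e. limit of admissible \<open>G\<close>, so by dominated convergence the vanishing
  integrals tend to the integral of |w|.\<close>

lemma AE_zero_real_if_integral_test_zero:
  fixes w :: "real \<Rightarrow> real"
  assumes r: "0 < r" and w: "integrable (lebesgue_on {-r..0}) w"
    and test: "\<And>G. compactly_supported r G \<Longrightarrow> (LINT t|lebesgue_on {-r..0}. G t * w t) = 0"
  shows "AE t in lebesgue_on {-r..0}. w t = 0"
proof -
  let ?N = "lebesgue_on {-r..0}"
  define \<sigma> where "\<sigma> t = (if t \<in> {-r..0} then sgn (w t) else 0)" for t
  have "\<sigma> \<in> borel_measurable lebesgue"
    unfolding \<sigma>_def using w by (intro borel_measurable_if_I) auto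
  then obtain g :: "nat \<Rightarrow> real \<Rightarrow> real" where g: "\<And>n. continuous_on UNIV (g n)"
      "AE t in lebesgue. (\<lambda>n. g n t) \<longlonglongrightarrow> \<sigma> t"
    by (rule borel_measurable_AE_lim_continuous) (rule that)
  \<comment> \<open>A trapezoidal cutoff: for positive \<open>n\<close> it vanishes within distance
    1/n of the end points and equals 1 beyond distance 2/n. The index \<open>Suc n\<close> is used
    below to keep 1/n meaningful.\<close>
  define k where "k n t = max 0 (min 1 (real n * min (t + r) (- t) - 1))" for n and t :: real
  define G where "G n t = k n t * clip 1 (g n t)" for n t
  have G: "compactly_supported r (G (Suc n))" for n
  proof -
    have "continuous_on UNIV (\<lambda>t. clip 1 (g (Suc n) t))"
      using continuous_on_compose2[OF continuous_on_clip[of 1] g(1)] by auto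
    then have "continuous_on UNIV (G (Suc n))"
      unfolding G_def k_def by (intro continuous_intros)
    moreover have "G (Suc n) t = 0" if "t \<notin> {- r + 1 / real (Suc n)..- (1 / real (Suc n))}" for t
    proof -
      have "min (t + r) (- t) < 1 / real (Suc n)" using that by auto
      then have "real (Suc n) * min (t + r) (- t) < 1"
        by (subst mult.commute) (simp add: pos_less_divide_eq del: of_nat_Suc)
      then show ?thesis by (simp add: G_def k_def del: of_nat_Suc)
    qed
    ultimately show ?thesis unfolding compactly_supported_def
      by (intro conjI exI[of _ "- r + 1 / real (Suc n)"] exI[of _ "- (1 / real (Suc n))"]) auto
  qed
  have "(\<lambda>n. LINT t|?N. G (Suc n) t * w t) \<longlonglongrightarrow> (LINT t|?N. \<bar>w t\<bar>)"
  proof (rule integral_dominated_convergence[where w="\<lambda>t. \<bar>w t\<bar>"])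
    have "AE t in ?N. (\<lambda>n. g n t) \<longlonglongrightarrow> \<sigma> t"
      using g(2) by (subst AE_restrict_space_iff) (auto elim: eventually_mono)
    moreover have "AE t in ?N. t \<noteq> -r" "AE t in ?N. t \<noteq> 0" by (rule AE_lebesgue_on_singleton)+
    moreover have "AE t in ?N. t \<in> {-r..0}" by (rule AE_I2) simp
    ultimately show "AE t in ?N. (\<lambda>n. G (Suc n) t * w t) \<longlonglongrightarrow> \<bar>w t\<bar>"
    proof eventually_elim
      case (elim t)
      then have t: "-r < t" "t < 0" by auto
      define \<delta> where "\<delta> = min (t + r) (- t)"
      have \<delta>: "0 < \<delta>" using t by (simp add: \<delta>_def)
      obtain m where m: "2 / \<delta> < real m" using reals_Archimedean2 by blast
      have "\<forall>\<^sub>F n in sequentially. k n t = 1"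
        using eventually_ge_at_top[of m]
      proof eventually_elim
        case (elim n)
        then have "2 / \<delta> < real n" using m by linarith
        then have "2 < real n * \<delta>" using \<delta> by (simp add: field_simps)
        then show ?case by (simp add: k_def flip: \<delta>_def)
      qed
      then have "(\<lambda>n. k n t) \<longlonglongrightarrow> 1" by (rule tendsto_eventually)
      moreover have "continuous_on UNIV (clip 1 :: real \<Rightarrow> real)" by (rule continuous_on_clip) simp
      then have "isCont (clip 1) (\<sigma> t)" by (simp add: continuous_on_eq_continuous_at)
      then have "(\<lambda>n. clip 1 (g n t)) \<longlonglongrightarrow> clip 1 (\<sigma> t)"
        using elim(1) isCont_tendsto_compose by blast
      ultimately have "(\<lambda>n. G n t) \<longlonglongrightarrow> 1 * clip 1 (\<sigma> t)"
        unfolding G_def by (intro tendsto_mult)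
      also have "1 * clip 1 (\<sigma> t) = sgn (w t)"
        using elim(4) by (subst clip_eq) (auto simp: \<sigma>_def abs_sgn_eq)
      finally have "(\<lambda>n. G (Suc n) t) \<longlonglongrightarrow> sgn (w t)" by (rule LIMSEQ_Suc)
      then have "(\<lambda>n. G (Suc n) t * w t) \<longlonglongrightarrow> sgn (w t) * w t" by (intro tendsto_intros)
      then show ?case by (simp add: abs_sgn mult.commute)
    qed
    fix n
    show "(\<lambda>t. G (Suc n) t * w t) \<in> borel_measurable ?N"
      using w borel_imp_lebesgue_on[OF compactly_supported_borel[OF G]] by auto
    have "\<bar>G (Suc n) t\<bar> \<le> 1" for t
      using norm_clip_le[of 1 "g (Suc n) t"] by (auto simp: G_def k_def abs_mult intro!: mult_le_one)
    then show "AE t in ?N. norm (G (Suc n) t * w t) \<le> \<bar>w t\<bar>"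
      by (auto simp: abs_mult intro!: AE_I2 mult_left_le_one_le)
  qed (use w in auto)
  then have "(LINT t|?N. \<bar>w t\<bar>) = 0"
    using test[OF G] by (simp add: LIMSEQ_const_iff)
  then show ?thesis
    using integral_nonneg_eq_0_iff_AE[of ?N "\<lambda>t. \<bar>w t\<bar>"] w by auto
qed

lemma AE_zero_if_integral_test_zero:
  fixes w :: "real \<Rightarrow> 'b::euclidean_space"
  assumes r: "0 < r" and w: "integrable (lebesgue_on {-r..0}) w"
    and test: "\<And>G. compactly_supported r G \<Longrightarrow> (LINT t|lebesgue_on {-r..0}. G t *\<^sub>R w t) = 0"
  shows "AE t in lebesgue_on {-r..0}. w t = 0"
proof -
  let ?N = "lebesgue_on {-r..0}"
  have "AE t in ?N. w t \<bullet> i = 0" if "i \<in> Basis" for i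
  proof (rule AE_zero_real_if_integral_test_zero[OF r])
    show "integrable ?N (\<lambda>t. w t \<bullet> i)" using w by simp
    fix G assume G: "compactly_supported r G"
    obtain B where B: "\<And>t. \<bar>G t\<bar> \<le> B" by (rule compactly_supported_bounded[OF G]) blast
    have "integrable ?N (\<lambda>t. G t *\<^sub>R w t)"
      by (rule integrable_bounded_scaleR[OF w borel_imp_lebesgue_on[OF
          compactly_supported_borel[OF G]] B])
    then have "(LINT t|?N. (G t *\<^sub>R w t) \<bullet> i) = 0"
      using test[OF G] by (subst integral_inner_left) auto
    then show "(LINT t|?N. G t * (w t \<bullet> i)) = 0" by simp
  qed
  then have "AE t in ?N. \<forall>i\<in>Basis. w t \<bullet> i = 0"
    by (intro AE_finite_allI) auto
  then show ?thesis by eventually_elim (simp add: euclidean_all_zero_iff)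
qed

lemma compactly_supported_Lp_compact:
  assumes "compactly_supported r G"
  shows "Lp_compact 1 G"
proof -
  obtain B where B: "\<And>t. \<bar>G t\<bar> \<le> B" by (rule compactly_supported_bounded[OF assms]) blast
  obtain a b where ab: "-r < a" "b < 0" "\<And>t. t \<notin> {a..b} \<Longrightarrow> G t = 0"
    using assms unfolding compactly_supported_def by blast
  show ?thesis
  proof (rule Lp_compact_bounded)
    show "G t = 0" if "\<bar>a\<bar> + \<bar>b\<bar> + 1 < \<bar>t\<bar>" for t
      using that by (intro ab(3)) auto
  qed (use B compactly_supported_borel[OF assms] in auto)
qed

lemma primitive_has_real_derivative:
  fixes G :: "real \<Rightarrow> real"
  assumes G: "continuous_on UNIV G" and a: "\<And>t. t < a \<Longrightarrow> G t = 0"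
  shows "(primitive G has_real_derivative G x) (at x)"
proof -
  \<comment> \<open>A point to the left of both the support and \<open>x\<close>, so that near
    \<open>x\<close> the primitive is an ordinary integral from \<open>c\<close>.\<close>
  define c where "c = min a x - 1"
  have eq: "primitive G t = integral {c..t} G" if "c \<le> t" for t
  proof -
    have i: "set_integrable lborel {c..t} G"
      by (rule borel_integrable_atLeastAtMost') (rule continuous_on_subset[OF G], simp)
    have "primitive G t = (LINT s:{c..t}|lborel. G s)"
      unfolding primitive_def set_lebesgue_integral_def
      using a by (intro Bochner_Integration.integral_cong) (auto simp: indicator_def c_def)
    also have "\<dots> = integral {c..t} G" by (rule set_borel_integral_eq_integral(2)[OF i])
    finally show ?thesis .
  qed
  have x: "x \<in> {c..x + 1}" "x \<in> {c<..<x + 1}" by (auto simp: c_def)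
  have "((\<lambda>t. integral {c..t} G) has_real_derivative G x) (at x within {c..x + 1})"
    by (rule integral_has_real_derivative[OF continuous_on_subset[OF G] x(1)]) simp
  then have "((\<lambda>t. integral {c..t} G) has_real_derivative G x) (at x)"
    using x(2) by (simp add: at_within_Icc_at)
  then show ?thesis
    by (rule has_field_derivative_transform_within_open[of _ _ _ "{c<..}"]) (use x eq in auto)
qed

text \<open>Zero mean is what brings the primitive back to zero to the right of the support of
  \<open>G\<close>, so that its own support stays in the same compact interval.\<close>

lemma test_function_primitive:
  assumes G: "compactly_supported r G" and z: "(LINT t|lborel. G t) = 0"
  shows "test_function r (primitive G)" "deriv (primitive G) = G"
proof -
  obtain a b where ab: "-r < a" "b < 0" "\<And>t. t \<notin> {a..b} \<Longrightarrow> G t = 0" and c: "continuous_on UNIV G"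
    using G unfolding compactly_supported_def by blast
  have d: "(primitive G has_real_derivative G x) (at x)" for x
    by (rule primitive_has_real_derivative[OF c, of a]) (use ab in auto)
  then show dG: "deriv (primitive G) = G" by (intro ext DERIV_imp_deriv)
  have "primitive G t = 0" if "t < a" for t
    using that ab by (intro primitive_eq_zero[of a]) auto
  moreover have "primitive G t = 0" if "b < t" for t
  proof -
    have "primitive G t = (LINT s|lborel. G s)"
      unfolding primitive_def set_lebesgue_integral_def
      by (intro Bochner_Integration.integral_cong) (use that ab in \<open>auto simp: indicator_def not_le\<close>)
    then show ?thesis using z by simp
  qed
  ultimately have "{t. primitive G t \<noteq> 0} \<subseteq> {a..b}" by force
  then have cl: "closure {t. primitive G t \<noteq> 0} \<subseteq> {a..b}" by (rule closure_minimal) simp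
  then have "compact (closure {t. primitive G t \<noteq> 0})"
    using compact_closure bounded_subset[OF bounded_closed_interval] closure_subset by (metis
        dual_order.trans)
  moreover have "closure {t. primitive G t \<noteq> 0} \<subseteq> {-r<..<0}" using cl ab by force
  ultimately show "test_function r (primitive G)"
    unfolding test_function_def dG using d c by (auto simp: real_differentiable_def)
qed

lemma integral_lebesgue_on_compactly_supported:
  fixes w :: "real \<Rightarrow> 'b::euclidean_space"
  assumes "\<And>t. t \<notin> {-r..0} \<Longrightarrow> G t = (0::real)" "G \<in> borel_measurable borel" "w \<in> borel_measurable borel"
  shows "(LINT t|lebesgue_on {-r..0}. G t *\<^sub>R w t) = (LINT t|lborel. G t *\<^sub>R w t)"
proof -
  have eq: "indicat_real {-r..0} t *\<^sub>R (G t *\<^sub>R w t) = G t *\<^sub>R w t" for t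
    using assms(1)[of t] by (auto simp: indicator_def)
  then show ?thesis using assms(2,3) by (subst integral_lebesgue_on_borel) (use assms(2,3) in
      \<open>simp_all only: eq, measurable\<close>)
qed

lemma compactly_supported_zero_outside:
  assumes "compactly_supported r G" "t \<notin> {-r<..<0}"
  shows "G t = 0"
  using assms unfolding compactly_supported_def by fastforce

lemma compactly_supported_unit_mass:
  assumes r: "0 < r"
  obtains k where "compactly_supported r k" "(LINT t|lborel. k t) = 1"
proof -
  \<comment> \<open>A tent of height r/4 centred at -r/2. On the middle quarter of [-r,0] it is at
    least r/8, which makes its integral positive.\<close>
  define k0 where "k0 t = max 0 (r / 4 - \<bar>t + r / 2\<bar>)" for t
  have c0: "continuous_on UNIV k0" unfolding k0_def by (intro continuous_intros)
  have z0: "k0 t = 0" if "t \<notin> {- 3 * r / 4..- r / 4}" for t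
    using that r by (auto simp: k0_def max_def abs_if split: if_splits)
  have k0: "compactly_supported r k0"
    unfolding compactly_supported_def using c0 z0 r
    by (intro conjI exI[of _ "- 3 * r / 4"] exI[of _ "- r / 4"]) auto
  have pos: "0 < (LINT t|lborel. k0 t)"
  proof -
    have "(LINT t|lborel. r / 8 * indicat_real {- 5 * r / 8..- 3 * r / 8} t) \<le> (LINT t|lborel. k0 t)"
    proof (rule integral_mono')
      show "integrable lborel k0"
        by (rule Lp_compact_integrable[OF compactly_supported_Lp_compact[OF k0]]) simp
      show "r / 8 * indicat_real {- 5 * r / 8..- 3 * r / 8} t \<le> k0 t" for t
        using r by (auto simp: k0_def indicator_def abs_if)
      show "0 \<le> k0 t" for t by (simp add: k0_def)
    qed
    moreover have "0 < (LINT t|lborel. r / 8 * indicat_real {- 5 * r / 8..- 3 * r / 8} t)"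
      using r by simp
    ultimately show ?thesis by linarith
  qed
  then have "(LINT t|lborel. k0 t / (LINT t|lborel. k0 t)) = 1" by simp
  moreover have "compactly_supported r (\<lambda>t. k0 t / (LINT t|lborel. k0 t))"
    using k0 pos unfolding compactly_supported_def by (auto intro!: continuous_intros)
  ultimately show ?thesis using that by blast
qed

text \<open>Subtracting a multiple of a unit-mass \<open>k\<close> gives any \<open>G\<close> zero
  mean and turns it into the derivative of a test function. Hence the integral of
  \<open>\<psi>\<close> against \<open>G\<close> depends on the mass of \<open>G\<close> alone, as
  for a constant.\<close>

lemma du_Bois_Reymond:
  fixes \<psi> :: "real \<Rightarrow> 'b::euclidean_space"
  assumes r: "0 < r" and \<psi>: "integrable (lebesgue_on {-r..0}) \<psi>"
    and w: "\<And>\<phi>. test_function r \<phi> \<Longrightarrow> (LINT \<theta>|lebesgue_on {-r..0}. deriv \<phi> \<theta> *\<^sub>R \<psi> \<theta>) = 0"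
  obtains c where "AE \<theta> in lebesgue_on {-r..0}. \<psi> \<theta> = c"
proof -
  let ?N = "lebesgue_on {-r..0}"
  obtain k where k: "compactly_supported r k" "(LINT t|lborel. k t) = 1"
    by (rule compactly_supported_unit_mass[OF r])
  \<comment> \<open>A constant \<open>\<psi>\<close> would be returned by integration against the
    unit mass \<open>k\<close>, which leaves this value as the only candidate.\<close>
  define c where "c = (LINT \<theta>|?N. k \<theta> *\<^sub>R \<psi> \<theta>)"
  have int: "integrable ?N (\<lambda>\<theta>. G \<theta> *\<^sub>R \<psi> \<theta>)" if G: "compactly_supported r G" for G
  proof -
    obtain B where B: "\<And>t. \<bar>G t\<bar> \<le> B" by (rule compactly_supported_bounded[OF G]) blast
    show ?thesis
      by (rule integrable_bounded_scaleR[OF \<psi> borel_imp_lebesgue_on[OF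
          compactly_supported_borel[OF G]] B])
  qed
  have iN: "integrable ?N G" "(LINT \<theta>|?N. G \<theta>) = (LINT \<theta>|lborel. G \<theta>)" if G: "compactly_supported
      r G" for G
  proof -
    have i: "integrable lborel G"
      by (rule Lp_compact_integrable[OF compactly_supported_Lp_compact[OF G]]) simp
    show "integrable ?N G" by (rule integrable_lebesgue_on_borel[OF i]) simp
    have z: "G t = 0" if "t \<notin> {-r..0}" for t
      using that by (intro compactly_supported_zero_outside[OF G]) auto
    show "(LINT \<theta>|?N. G \<theta>) = (LINT \<theta>|lborel. G \<theta>)"
      using integral_lebesgue_on_compactly_supported[of r G "\<lambda>_. 1::real",
        OF z compactly_supported_borel[OF G]] by simp
  qed
  have "AE \<theta> in ?N. \<psi> \<theta> - c = 0"
  proof (rule AE_zero_if_integral_test_zero[OF r])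
    have fin: "integrable ?N (\<lambda>_. c)"
      by (rule finite_measure.integrable_const) (simp add: finite_measure_lebesgue_on)
    show "integrable ?N (\<lambda>\<theta>. \<psi> \<theta> - c)" using \<psi> fin by simp
    fix G assume G: "compactly_supported r G"
    define m where "m = (LINT t|lborel. G t)"
    define G' where "G' t = G t - m * k t" for t
    obtain a b a' b' where ab: "-r < a" "b < 0" "-r < a'" "b' < 0"
      and 0: "\<And>t. t \<notin> {a..b} \<Longrightarrow> G t = 0" "\<And>t. t \<notin> {a'..b'} \<Longrightarrow> k t = 0"
      and cont: "continuous_on UNIV G" "continuous_on UNIV k"
      using G k(1) unfolding compactly_supported_def by metis
    have G': "compactly_supported r G'"
      unfolding compactly_supported_def
    proof (intro conjI exI allI impI)
      show "continuous_on UNIV G'" unfolding G'_def using cont by (intro continuous_intros)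
      show "-r < min a a'" "max b b' < 0" using ab by auto
      show "G' t = 0" if "t \<notin> {min a a'..max b b'}" for t
      proof -
        have "t \<notin> {a..b}" "t \<notin> {a'..b'}" using that by auto
        then show ?thesis using 0[of t] by (simp add: G'_def)
      qed
    qed
    have iG: "integrable lborel G" "integrable lborel k"
      using Lp_compact_integrable[OF compactly_supported_Lp_compact] G k(1) by auto
    then have "(LINT t|lborel. G' t) = 0"
      using k(2) by (simp add: G'_def m_def)
    then have "(LINT \<theta>|?N. G' \<theta> *\<^sub>R \<psi> \<theta>) = 0"
      using w[OF test_function_primitive(1)] test_function_primitive(2) G' by metis
    moreover have "(LINT \<theta>|?N. G' \<theta> *\<^sub>R \<psi> \<theta>) = (LINT \<theta>|?N. G \<theta> *\<^sub>R \<psi> \<theta>) - m *\<^sub>R c"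
      unfolding G'_def c_def scaleR_diff_left scaleR_scaleR[symmetric]
      using int[OF G] int[OF k(1)] by (simp del: scaleR_scaleR)
    moreover have "(LINT \<theta>|?N. G \<theta> *\<^sub>R (\<psi> \<theta> - c)) = (LINT \<theta>|?N. G \<theta> *\<^sub>R \<psi> \<theta>) - m *\<^sub>R c"
      unfolding scaleR_diff_right m_def using int[OF G] iN[OF G] by simp
    ultimately show "(LINT \<theta>|?N. G \<theta> *\<^sub>R (\<psi> \<theta> - c)) = 0" by simp
  qed
  then have "AE \<theta> in ?N. \<psi> \<theta> = c" by eventually_elim simp
  then show ?thesis using that by blast
qed

section \<open>Weak derivatives and primitives\<close>

lemma test_function_compactly_supported:
  assumes r: "0 < r" and \<phi>: "test_function r \<phi>"
  shows "compactly_supported r \<phi>" "compactly_supported r (deriv \<phi>)"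
    "(\<phi> has_real_derivative deriv \<phi> x) (at x)"
proof -
  define K where "K = closure {x. \<phi> x \<noteq> 0}"
  have K: "compact K" "K \<subseteq> {-r<..<0}" using \<phi> by (auto simp: test_function_def K_def)
  have d: "(\<phi> has_real_derivative deriv \<phi> x) (at x)" for x
    using \<phi> by (auto simp: test_function_def DERIV_deriv_iff_real_differentiable)
  then show "(\<phi> has_real_derivative deriv \<phi> x) (at x)" .
  have c: "continuous_on UNIV \<phi>"
    using d by (meson DERIV_isCont continuous_at_imp_continuous_on)
  obtain a b where ab: "-r < a" "b < 0" "K \<subseteq> {a..b}"
  proof (cases "K = {}")
    case True
    then show ?thesis using that[of "-r / 2" "-r / 2"] r by auto
  next
    case False
    obtain a where "a \<in> K" "\<forall>t\<in>K. a \<le> t" using compact_attains_inf[OF K(1) False] by blast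
    moreover obtain b where "b \<in> K" "\<forall>t\<in>K. t \<le> b" using compact_attains_sup[OF K(1) False] by blast
    ultimately show ?thesis using K(2) by (intro that[of a b]) auto
  qed
  have z: "\<phi> t = 0" if "t \<notin> {a..b}" for t
    using that ab(3) closure_subset[of "{x. \<phi> x \<noteq> 0}"] unfolding K_def by blast
  have dz: "deriv \<phi> t = 0" if t: "t \<notin> {a..b}" for t
  proof -
    have "((\<lambda>_. 0) has_real_derivative 0) (at t)" by simp
    then have "(\<phi> has_real_derivative 0) (at t)"
      by (rule has_field_derivative_transform_within_open[of _ _ _ "- {a..b}"]) (use t z in \<open>auto
          simp: open_Compl\<close>)
    then show ?thesis by (rule DERIV_imp_deriv)
  qed
  show "compactly_supported r \<phi>"
    unfolding compactly_supported_def using c z ab by blast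
  show "compactly_supported r (deriv \<phi>)"
    unfolding compactly_supported_def using \<phi> dz ab by (auto simp: test_function_def)
qed

text \<open>Fubini on the half plane s \<le> t, dominated by the integrable product of
  \<open>D t\<close> and \<open>u s\<close>.\<close>

lemma integral_Fubini_primitive:
  fixes u :: "real \<Rightarrow> 'b::euclidean_space" and D :: "real \<Rightarrow> real"
  assumes D: "integrable lborel D" and u: "integrable lborel u"
  shows "(LINT t|lborel. D t *\<^sub>R primitive u t) = (LINT s|lborel. (LINT t|lborel. indicator {s..}
      t * D t) *\<^sub>R u s)"
proof -
  have [measurable]: "D \<in> borel_measurable borel" "u \<in> borel_measurable borel"
    using D u by auto
  define f where "f t s = (if s \<le> t then D t *\<^sub>R u s else 0)" for t s
  have f: "f t s = D t *\<^sub>R (indicat_real {..t} s *\<^sub>R u s)" "f t s = (indicator {s..} t * D t) *\<^sub>R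
      u s" for t s
    by (auto simp: f_def indicator_def)
  have "integrable (lborel \<Otimes>\<^sub>M lborel) (\<lambda>(t, s). D t *\<^sub>R u s)"
    by (rule lborel_pair.Fubini_integrable) (use D u in \<open>auto simp: case_prod_unfold\<close>)
  then have "integrable (lborel \<Otimes>\<^sub>M lborel) (case_prod f)"
    by (rule Bochner_Integration.integrable_bound) (auto simp: f_def case_prod_unfold)
  then have "(LINT s|lborel. LINT t|lborel. f t s) = (LINT t|lborel. LINT s|lborel. f t s)"
    by (rule lborel_pair.Fubini_integral)
  moreover have "(LINT s|lborel. f t s) = D t *\<^sub>R primitive u t" for t
    unfolding f(1) primitive_def set_lebesgue_integral_def by (simp del: scaleR_scaleR)
  moreover have "(LINT t|lborel. f t s) = (LINT t|lborel. indicator {s..} t * D t) *\<^sub>R u s" for s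
  proof -
    have "integrable lborel (\<lambda>t. indicat_real {s..} t * D t)"
      using integrable_mult_indicator[of "{s..}" lborel D] D by simp
    then show ?thesis unfolding f(2) by simp
  qed
  ultimately show ?thesis by simp
qed

lemma integral_deriv_tail:
  assumes r: "0 < r" and \<phi>: "test_function r \<phi>"
  shows "(LINT t|lborel. indicator {s..} t * deriv \<phi> t) = - \<phi> s"
proof -
  note cs = test_function_compactly_supported[OF r \<phi>]
  have z: "\<phi> t = 0" "deriv \<phi> t = 0" if "0 \<le> t" for t
    using that cs(1,2) compactly_supported_zero_outside by auto
  \<comment> \<open>The upper limit \<open>max s 0\<close> keeps the interval nonempty for s > 0,
    where both sides are zero.\<close>
  have "(LINT t|lborel. indicator {s..} t * deriv \<phi> t) = (LINT t|lborel. indicator {s..max s 0} t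
      *\<^sub>R deriv \<phi> t)"
    using z(2) by (intro Bochner_Integration.integral_cong) (auto simp: indicator_def)
  also have "\<dots> = \<phi> (max s 0) - \<phi> s"
  proof (rule integral_FTC_atLeastAtMost)
    show "(\<phi> has_vector_derivative deriv \<phi> x) (at x within {s..max s 0})" for x
      using cs(3)[of x] by (metis has_real_derivative_iff_has_vector_derivative
          has_vector_derivative_at_within)
    show "continuous_on {s..max s 0} (deriv \<phi>)"
      using cs(2) by (auto simp: compactly_supported_def intro: continuous_on_subset)
  qed simp
  finally show ?thesis using z(1)[of "max s 0"] by simp
qed

lemma integrable_lebesgue_on_continuous:
  fixes f :: "real \<Rightarrow> 'b::euclidean_space"
  assumes "continuous_on UNIV f"
  shows "integrable (lebesgue_on {a..b}) f"
proof -
  have "set_integrable lebesgue {a..b} f"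
    by (rule absolutely_integrable_continuous_real) (rule continuous_on_subset[OF assms], simp)
  then show ?thesis unfolding set_integrable_def by (subst integrable_restrict_space) auto
qed

lemma Lp_integrable:
  assumes "\<psi> \<in> Lp p r" "1 \<le> p"
  shows "integrable (lebesgue_on {-r..0}) \<psi>"
proof (rule Bochner_Integration.integrable_bound)
  have "integrable (lebesgue_on {-r..0}) (\<lambda>_. 1::real)"
    by (rule integrable_lebesgue_on_continuous) simp
  then show "integrable (lebesgue_on {-r..0}) (\<lambda>\<theta>. 1 + norm (\<psi> \<theta>) powr p)"
    using assms by (auto simp: Lp_def)
  show "\<psi> \<in> borel_measurable (lebesgue_on {-r..0})" using assms by (auto simp: Lp_def)
  have "norm (\<psi> \<theta>) \<le> norm (1 + norm (\<psi> \<theta>) powr p)" for \<theta>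
    using le_one_plus_powr[OF norm_ge_zero assms(2), of "\<psi> \<theta>"] by simp
  then show "AE \<theta> in lebesgue_on {-r..0}. norm (\<psi> \<theta>) \<le> norm (1 + norm (\<psi> \<theta>) powr p)"
    by (rule AE_I2)
qed

text \<open>Integration by parts through Fubini: the integral of \<open>deriv \<phi>\<close> over
  \<open>{s..}\<close> is \<open>- \<phi> s\<close>, and the constant \<open>c\<close> drops out
  because \<open>deriv \<phi>\<close> has integral zero.\<close>

lemma has_weak_deriv_primitive:
  fixes u :: "real \<Rightarrow> 'b::euclidean_space"
  assumes r: "0 < r" and u: "Lp_compact p u" and p: "1 \<le> p"
    and ae: "AE \<theta> in lebesgue_on {-r..0}. \<psi> \<theta> = c + primitive u \<theta>"
  shows "has_weak_deriv r \<psi> u"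
  unfolding has_weak_deriv_def
proof (intro allI impI)
  fix \<phi> assume \<phi>: "test_function r \<phi>"
  let ?N = "lebesgue_on {-r..0}"
  note cs = test_function_compactly_supported[OF r \<phi>]
  have iu: "integrable lborel u" by (rule Lp_compact_integrable[OF u p])
  have iD: "integrable lborel (deriv \<phi>)"
    by (rule Lp_compact_integrable[OF compactly_supported_Lp_compact[OF cs(2)]]) simp
  have cp: "continuous_on UNIV (primitive u)"
    by (rule continuous_primitive[OF Lp_compact_mono_exponent[OF u p]])
  have [measurable]: "u \<in> borel_measurable borel" "deriv \<phi> \<in> borel_measurable borel"
    "\<phi> \<in> borel_measurable borel" "primitive u \<in> borel_measurable borel"
    using Lp_compact_borel[OF u] compactly_supported_borel cs borel_measurable_continuous_onI[OF
        cp] by auto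
  have zero: "\<phi> t = 0" "deriv \<phi> t = 0" if "t \<notin> {-r..0}" for t
    using that by (intro compactly_supported_zero_outside[OF cs(1)]
        compactly_supported_zero_outside[OF cs(2)]; auto)+
  have mp: "(\<lambda>\<theta>. c + primitive u \<theta>) \<in> borel_measurable ?N"
    by (rule borel_imp_lebesgue_on) measurable
  have "\<psi> \<in> borel_measurable ?N"
    by (rule borel_measurable_lebesgue_on_AE[OF mp]) (use ae in \<open>auto elim: eventually_mono\<close>)
  then have "(LINT \<theta>|?N. deriv \<phi> \<theta> *\<^sub>R \<psi> \<theta>) = (LINT \<theta>|?N. deriv \<phi> \<theta> *\<^sub>R (c + primitive u \<theta>))"
    using mp borel_imp_lebesgue_on[of "deriv \<phi>"]
    by (intro integral_cong_AE) (auto intro!: borel_measurable_scaleR simp: ae intro: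
        eventually_mono[OF ae])
  also have "\<dots> = (LINT t|lborel. deriv \<phi> t *\<^sub>R (c + primitive u t))"
    by (rule integral_lebesgue_on_compactly_supported) (use zero in auto)
  also have "\<dots> = (LINT t|lborel. deriv \<phi> t *\<^sub>R c + deriv \<phi> t *\<^sub>R primitive u t)"
    by (simp add: scaleR_add_right)
  also have "\<dots> = (LINT t|lborel. deriv \<phi> t *\<^sub>R c) + (LINT t|lborel. deriv \<phi> t *\<^sub>R primitive u t)"
  proof (rule Bochner_Integration.integral_add)
    show "integrable lborel (\<lambda>t. deriv \<phi> t *\<^sub>R primitive u t)"
    proof (rule Bochner_Integration.integrable_bound)
      show "integrable lborel (\<lambda>t. (LINT s|lborel. norm (u s)) *\<^sub>R deriv \<phi> t)" using iD by simp
      have "norm (primitive u t) \<le> (LINT s|lborel. norm (u s))" for t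
        unfolding primitive_def by (rule norm_set_integral_le[OF iu]) simp
      then show "AE t in lborel. norm (deriv \<phi> t *\<^sub>R primitive u t)
          \<le> norm ((LINT s|lborel. norm (u s)) *\<^sub>R deriv \<phi> t)"
        by (auto intro!: AE_I2 simp: abs_mult mult.commute mult_left_mono)
    qed measurable
  qed (use iD in simp)
  also have "(LINT t|lborel. deriv \<phi> t *\<^sub>R c) = 0"
  proof -
    have "(LINT t|lborel. deriv \<phi> t) = (LINT t|lborel. indicator {-r..} t * deriv \<phi> t)"
      using zero(2) by (intro Bochner_Integration.integral_cong) (auto simp: indicator_def)
    also have "\<dots> = - \<phi> (-r)" by (rule integral_deriv_tail[OF r \<phi>])
    also have "\<phi> (-r) = 0" by (rule compactly_supported_zero_outside[OF cs(1)]) simp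
    finally show ?thesis using iD by simp
  qed
  also have "(LINT t|lborel. deriv \<phi> t *\<^sub>R primitive u t) = - (LINT s|lborel. \<phi> s *\<^sub>R u s)"
    by (simp add: integral_Fubini_primitive[OF iD iu] integral_deriv_tail[OF r \<phi>])
  also have "(LINT s|lborel. \<phi> s *\<^sub>R u s) = (LINT \<theta>|?N. \<phi> \<theta> *\<^sub>R u \<theta>)"
    by (rule integral_lebesgue_on_compactly_supported[symmetric]) (use zero in auto)
  finally show "(LINT \<theta>|?N. deriv \<phi> \<theta> *\<^sub>R \<psi> \<theta>) = - (LINT \<theta>|?N. \<phi> \<theta> *\<^sub>R u \<theta>)" by simp
qed

lemma Lp_borel_representative:
  fixes \<psi> :: "real \<Rightarrow> 'b::euclidean_space"
  assumes \<psi>: "\<psi> \<in> Lp p r" and r: "0 < r"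
  obtains u where "Lp_compact p u" "\<And>t. t \<notin> {-r..0} \<Longrightarrow> u t = 0"
    "AE \<theta> in lebesgue_on {-r..0}. \<psi> \<theta> = u \<theta>"
proof -
  define f where "f t = (if t \<in> {-r..0} then \<psi> t else 0)" for t
  have "f \<in> borel_measurable lebesgue"
    unfolding f_def using \<psi> by (intro borel_measurable_if_I) (auto simp: Lp_def)
  then obtain g :: "nat \<Rightarrow> real \<Rightarrow> 'b" where g: "\<And>n. continuous_on UNIV (g n)"
      "AE t in lebesgue. (\<lambda>n. g n t) \<longlonglongrightarrow> f t"
    by (rule borel_measurable_AE_lim_continuous) (rule that)
  \<comment> \<open>\<open>lim\<close> gives a Borel function of \<open>t\<close> even where the
    sequence diverges, and on the window it agrees almost everywhere with the merely Lebesgue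
    measurable \<open>\<psi>\<close>.\<close>
  define u where "u t = indicat_real {-r..0} t *\<^sub>R lim (\<lambda>n. g n t)" for t
  have [measurable]: "g n \<in> borel_measurable borel" for n
    using g(1) by (rule borel_measurable_continuous_onI)
  have [measurable]: "u \<in> borel_measurable borel" unfolding u_def by measurable
  have ae: "AE t in lebesgue. t \<in> {-r..0} \<longrightarrow> \<psi> t = u t"
    using g(2) by eventually_elim (auto simp: u_def f_def limI)
  then have ae': "AE \<theta> in lebesgue_on {-r..0}. \<psi> \<theta> = u \<theta>"
    by (subst AE_restrict_space_iff) auto
  have "u \<in> Lp p r" by (rule Lp_cong_AE[OF \<psi> ae'])
  then have "integrable lebesgue (\<lambda>t. indicat_real {-r..0} t *\<^sub>R norm (u t) powr p)"
    unfolding Lp_def by (auto simp: integrable_restrict_space)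
  moreover have "indicat_real {-r..0} t *\<^sub>R norm (u t) powr p = norm (u t) powr p" for t
    by (auto simp: u_def indicator_def)
  ultimately have "integrable lebesgue (\<lambda>t. norm (u t) powr p)" by (simp only:)
  then have "integrable lborel (\<lambda>t. norm (u t) powr p)" by (simp add: integrable_completion)
  moreover have "\<forall>t. r < \<bar>t\<bar> \<longrightarrow> u t = 0" by (auto simp: u_def indicator_def)
  ultimately have "Lp_compact p u" using r by (auto simp: Lp_compact_def)
  then show ?thesis using that ae' by (auto simp: u_def)
qed

text \<open>Subtracting from \<open>\<psi>\<close> the primitive of its weak derivative leaves a
  function with weak derivative zero, which is constant by du Bois-Reymond.\<close>

lemma W1p_representation:
  fixes \<psi> :: "real \<Rightarrow> 'b::euclidean_space"
  assumes \<psi>: "\<psi> \<in> W1p p r" and r: "0 < r" and p: "1 \<le> p"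
  obtains u c where "Lp_compact p u" "\<And>t. t \<notin> {-r..0} \<Longrightarrow> u t = 0"
    "AE \<theta> in lebesgue_on {-r..0}. \<psi> \<theta> = c + primitive u \<theta>"
proof -
  let ?N = "lebesgue_on {-r..0}"
  obtain v where v: "v \<in> Lp p r" "has_weak_deriv r \<psi> v" and \<psi>L: "\<psi> \<in> Lp p r"
    using \<psi> by (auto simp: W1p_def)
  obtain u where u: "Lp_compact p u" "\<And>t. t \<notin> {-r..0} \<Longrightarrow> u t = 0" "AE \<theta> in ?N. v \<theta> = u \<theta>"
    by (rule Lp_borel_representative[OF v(1) r]) (rule that)
  have wu: "has_weak_deriv r (primitive u) u"
    by (rule has_weak_deriv_primitive[OF r u(1) p, of _ 0]) simp
  have i: "integrable ?N \<psi>" "integrable ?N (primitive u)"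
    using Lp_integrable[OF \<psi>L p]
      integrable_lebesgue_on_continuous[OF continuous_primitive[OF Lp_compact_mono_exponent[OF u(1) p]]]
    by auto
  have "(LINT \<theta>|?N. deriv \<phi> \<theta> *\<^sub>R (\<psi> \<theta> - primitive u \<theta>)) = 0" if \<phi>: "test_function r \<phi>" for \<phi>
  proof -
    note cs = test_function_compactly_supported[OF r \<phi>]
    obtain B where B: "\<And>t. \<bar>deriv \<phi> t\<bar> \<le> B" by (rule compactly_supported_bounded[OF cs(2)]) blast
    note ib = integrable_bounded_scaleR[OF _ borel_imp_lebesgue_on[OF compactly_supported_borel[OF
        cs(2)]] B]
    have m: "u \<in> borel_measurable ?N" "v \<in> borel_measurable ?N" "\<phi> \<in> borel_measurable ?N"
      using Lp_compact_imp_Lp[OF u(1)] v(1) borel_imp_lebesgue_on[OF compactly_supported_borel[OF cs(1)]]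
      by (auto simp: Lp_def)
    have "(LINT \<theta>|?N. \<phi> \<theta> *\<^sub>R v \<theta>) = (LINT \<theta>|?N. \<phi> \<theta> *\<^sub>R u \<theta>)"
      using m by (intro integral_cong_AE) (auto intro: eventually_mono[OF u(3)])
    then have "(LINT \<theta>|?N. deriv \<phi> \<theta> *\<^sub>R \<psi> \<theta>) = (LINT \<theta>|?N. deriv \<phi> \<theta> *\<^sub>R primitive u \<theta>)"
      using v(2) wu \<phi> by (simp add: has_weak_deriv_def)
    then show ?thesis
      using ib[OF i(1)] ib[OF i(2)] by (simp add: scaleR_diff_right)
  qed
  then obtain c where "AE \<theta> in ?N. \<psi> \<theta> - primitive u \<theta> = c"
    using du_Bois_Reymond[OF r, of "\<lambda>\<theta>. \<psi> \<theta> - primitive u \<theta>"] i by auto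
  then have "AE \<theta> in ?N. \<psi> \<theta> = c + primitive u \<theta>" by eventually_elim (auto simp: algebra_simps)
  then show ?thesis using that u by blast
qed

text \<open>Two continuous functions differ on an open set, and a nonempty open set is not null.
  Taking the closure brings in the end points, where additive constants are compared later.\<close>

lemma continuous_AE_eq:
  fixes f g :: "real \<Rightarrow> 'b::euclidean_space"
  assumes c: "continuous_on UNIV f" "continuous_on UNIV g" and ab: "a < b"
    and ae: "AE t in lebesgue. t \<in> {a<..<b} \<longrightarrow> f t = g t" and t: "t \<in> {a..b}"
  shows "f t = g t"
proof -
  define S where "S = {t. f t \<noteq> g t} \<inter> {a<..<b}"
  have "open {t. f t \<noteq> g t}" using c by (rule open_Collect_neq)
  then have "open S" unfolding S_def by auto
  moreover have "negligible S"
    using ae unfolding completion.AE_iff_null_sets negligible_iff_null_sets S_def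
    by (auto simp: Int_def conj_commute)
  ultimately have "S = {}" using open_not_negligible by blast
  then have "{a<..<b} \<subseteq> {t. f t = g t}" unfolding S_def by auto
  then have "closure {a<..<b} \<subseteq> {t. f t = g t}"
    by (rule closure_minimal) (rule closed_Collect_eq[OF c])
  then show ?thesis using t ab by auto
qed

text \<open>Test functions are differentiable, whereas \<open>AE_zero_if_integral_test_zero\<close>
  tests with all continuous functions. The argument therefore moves one level up: the primitive of
  the difference is constant by du Bois-Reymond and vanishes at -r, and its difference quotients,
  all zero, converge in L^p to the difference itself.\<close>

lemma has_weak_deriv_unique:
  fixes \<psi> :: "real \<Rightarrow> 'b::euclidean_space"
  assumes r: "0 < r" and p: "1 < p"
    and u: "u1 \<in> Lp p r" "u2 \<in> Lp p r" "has_weak_deriv r \<psi> u1" "has_weak_deriv r \<psi> u2"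
  shows "AE \<theta> in lebesgue_on {-r..0}. u1 \<theta> = u2 \<theta>"
proof -
  let ?N = "lebesgue_on {-r..0}"
  have p1: "1 \<le> p" using p by simp
  have "(\<lambda>\<theta>. u1 \<theta> - u2 \<theta>) \<in> Lp p r" using p by (intro Lp_diff u) simp
  then obtain w where w: "Lp_compact p w" "\<And>t. t \<notin> {-r..0} \<Longrightarrow> w t = 0" "AE \<theta> in ?N. u1 \<theta> - u2 \<theta> = w \<theta>"
    by (rule Lp_borel_representative[OF _ r]) (rule that)
  have iw: "integrable lborel w" by (rule Lp_compact_integrable[OF w(1) p1])
  have cw: "continuous_on UNIV (primitive w)"
    by (rule continuous_primitive[OF Lp_compact_mono_exponent[OF w(1) p1]])
  have ww: "has_weak_deriv r (primitive w) w"
    by (rule has_weak_deriv_primitive[OF r w(1) p1, of _ 0]) simp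
  have "(LINT \<theta>|?N. deriv \<phi> \<theta> *\<^sub>R primitive w \<theta>) = 0" if \<phi>: "test_function r \<phi>" for \<phi>
  proof -
    note cs = test_function_compactly_supported[OF r \<phi>]
    obtain B where B: "\<And>t. \<bar>\<phi> t\<bar> \<le> B" by (rule compactly_supported_bounded[OF cs(1)]) blast
    note ib = integrable_bounded_scaleR[OF _ borel_imp_lebesgue_on[OF compactly_supported_borel[OF
        cs(1)]] B]
    have m: "w \<in> borel_measurable ?N" "u1 \<in> borel_measurable ?N" "u2 \<in> borel_measurable ?N" "\<phi> \<in>
        borel_measurable ?N"
      using Lp_compact_imp_Lp[OF w(1)] u borel_imp_lebesgue_on[OF compactly_supported_borel[OF cs(1)]]
      by (auto simp: Lp_def)
    have "(LINT \<theta>|?N. \<phi> \<theta> *\<^sub>R w \<theta>) = (LINT \<theta>|?N. \<phi> \<theta> *\<^sub>R (u1 \<theta> - u2 \<theta>))"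
      using m by (intro integral_cong_AE) (auto intro: eventually_mono[OF w(3)])
    also have "\<dots> = (LINT \<theta>|?N. \<phi> \<theta> *\<^sub>R u1 \<theta>) - (LINT \<theta>|?N. \<phi> \<theta> *\<^sub>R u2 \<theta>)"
      using ib[OF Lp_integrable[OF u(1) p1]] ib[OF Lp_integrable[OF u(2) p1]]
      by (simp add: scaleR_diff_right)
    also have "\<dots> = 0"
    proof -
      have "(LINT \<theta>|?N. deriv \<phi> \<theta> *\<^sub>R \<psi> \<theta>) = - (LINT \<theta>|?N. \<phi> \<theta> *\<^sub>R u1 \<theta>)"
        using u(3) \<phi> by (simp add: has_weak_deriv_def)
      moreover have "(LINT \<theta>|?N. deriv \<phi> \<theta> *\<^sub>R \<psi> \<theta>) = - (LINT \<theta>|?N. \<phi> \<theta> *\<^sub>R u2 \<theta>)"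
        using u(4) \<phi> by (simp add: has_weak_deriv_def)
      ultimately show ?thesis by simp
    qed
    finally show ?thesis using ww \<phi> unfolding has_weak_deriv_def by simp
  qed
  then obtain c where c: "AE \<theta> in ?N. primitive w \<theta> = c"
    using du_Bois_Reymond[OF r integrable_lebesgue_on_continuous[OF cw]] by blast
  have "AE t in lebesgue. t \<in> {-r<..<0} \<longrightarrow> primitive w t = c"
    using c by (subst (asm) AE_restrict_space_iff) (auto elim: eventually_mono)
  then have eq: "primitive w t = c" if "t \<in> {-r..0}" for t
    using that r by (intro continuous_AE_eq[OF cw, of "\<lambda>_. c" "-r" 0]) auto
  moreover have left: "primitive w t = 0" if "t \<le> -r" for t
    using that by (intro primitive_eq_zero[of "-r"]) (auto intro: w(2))
  ultimately have "c = 0" using r eq[of "-r"] left[of "-r"] by simp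
  have zero: "primitive w t = 0" for t
  proof -
    consider "t \<le> -r" | "t \<in> {-r..0}" | "0 \<le> t" by fastforce
    then show ?thesis
    proof cases
      case 3
      then have "primitive w t = primitive w 0" by (intro primitive_eq_const) (auto intro: w(2))
      then show ?thesis using eq[of 0] r \<open>c = 0\<close> by simp
    qed (use left eq \<open>c = 0\<close> in auto)
  qed
  have "((\<lambda>\<epsilon>::real. LINT t|lborel. norm (w t) powr p) \<longlongrightarrow> 0) (at_right 0)"
    using difference_quotient_Lp[OF w(1) p] by (simp add: zero)
  then have "(LINT t|lborel. norm (w t) powr p) = 0"
    by (simp add: tendsto_const_iff)
  then have "AE t in lborel. norm (w t) powr p = 0"
    using Lp_compact_integrable_powr[OF w(1)] by (subst (asm) integral_nonneg_eq_0_iff_AE) auto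
  then have "AE t in lebesgue. w t = 0"
    unfolding AE_lborel_iff_lebesgue by eventually_elim auto
  then have "AE \<theta> in ?N. w \<theta> = 0"
    by (subst AE_restrict_space_iff) (auto elim: eventually_mono)
  with w(3) show ?thesis by eventually_elim simp
qed

section \<open>Segments and directional derivatives\<close>

lemma AE_lebesgue_translate:
  assumes "AE t in lebesgue. P t"
  shows "AE t in lebesgue. P (s + t :: real)"
proof -
  have "AE t in lborel. P t" using assms by (simp add: AE_lborel_iff_lebesgue)
  then have "AE t in distr lborel borel ((+) s). P t" unfolding lborel_distr_plus .
  then have "AE t in lborel. P (s + t)" by (rule AE_distrD[rotated]) simp
  then show ?thesis by (simp add: AE_lborel_iff_lebesgue)
qed

lemma AE_lebesgue_on_translate:
  assumes "AE t in lebesgue. t \<in> S \<longrightarrow> P t" "\<And>\<theta>. \<theta> \<in> {a..b} \<Longrightarrow> s + \<theta> \<in> S"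
  shows "AE \<theta> in lebesgue_on {a..b}. P (s + \<theta> :: real)"
  using AE_lebesgue_translate[OF assms(1), of s] assms(2)
  by (subst AE_restrict_space_iff) (auto elim: eventually_mono)

lemma Lp_compact_translate': "Lp_compact p w \<Longrightarrow> Lp_compact p (\<lambda>t. w (s + t))"
  using Lp_compact_translate[of p w s] by (simp add: add.commute)

lemma Lp_norm_le_root:
  assumes "0 < p" "Lp_norm p r \<psi> powr p \<le> K"
  shows "Lp_norm p r \<psi> \<le> K powr (1 / p)"
proof -
  have "(Lp_norm p r \<psi> powr p) powr (1 / p) \<le> K powr (1 / p)"
    using assms by (intro powr_mono2) auto
  then show ?thesis using assms(1) Lp_norm_nonneg[of p r \<psi>] by (simp add: powr_powr)
qed

lemma Lp_norm_translate_le: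
  assumes w: "Lp_compact p w" and p: "0 < p"
  shows "Lp_norm p r (\<lambda>\<theta>. w (s + \<theta>)) \<le> (LINT t|lborel. norm (w t) powr p) powr (1 / p)"
proof (rule Lp_norm_le_root[OF p])
  have "Lp_norm p r (\<lambda>\<theta>. w (s + \<theta>)) powr p \<le> (LINT t|lborel. norm (w (s + t)) powr p)"
    by (rule Lp_norm_powr_le_lborel[OF Lp_compact_translate'[OF w] p])
  then show "Lp_norm p r (\<lambda>\<theta>. w (s + \<theta>)) powr p \<le> (LINT t|lborel. norm (w t) powr p)"
    using lborel_integral_translate[of "\<lambda>t. norm (w t) powr p" s] by (simp add: add.commute)
qed

text \<open>The window norm is at most the norm over the line, where only the difference of
  \<open>s'\<close> and \<open>s\<close> matters; hence one \<open>d\<close> serves all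
  positions.\<close>

lemma segment_continuous_Lp:
  assumes w: "Lp_compact p w" and p: "0 < p" and e: "0 < e"
  obtains d where "0 < d"
    "\<And>s s'. \<bar>s' - s\<bar> < d \<Longrightarrow> Lp_norm p r (\<lambda>\<theta>. w (s' + \<theta>) - w (s + \<theta>)) < e"
proof -
  have "\<forall>\<^sub>F h in at 0. (LINT t|lborel. norm (w (t + h) - w t) powr p) < e powr p"
    using translation_continuous_Lp[OF w p] e by (intro order_tendstoD(2)) auto
  then obtain d where d: "0 < d"
    "\<And>h. h \<noteq> 0 \<Longrightarrow> \<bar>h\<bar> < d \<Longrightarrow> (LINT t|lborel. norm (w (t + h) - w t) powr p) < e powr p"
    unfolding eventually_at by (auto simp: dist_real_def)
  \<comment> \<open>The limit is taken along a punctured neighbourhood of 0, so \<open>h = 0\<close>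
    is added separately.\<close>
  have d': "(LINT t|lborel. norm (w (t + h) - w t) powr p) < e powr p" if "\<bar>h\<bar> < d" for h
    using d(2)[of h] that e by (cases "h = 0") auto
  have "Lp_norm p r (\<lambda>\<theta>. w (s' + \<theta>) - w (s + \<theta>)) < e" if "\<bar>s' - s\<bar> < d" for s s'
  proof -
    have L: "Lp_compact p (\<lambda>t. w (t + (s' - s)) - w t)"
      using w p by (intro Lp_compact_diff Lp_compact_translate) auto
    have "Lp_norm p r (\<lambda>\<theta>. w ((s + \<theta>) + (s' - s)) - w (s + \<theta>)) powr p
        \<le> (LINT t|lborel. norm (w ((s + t) + (s' - s)) - w (s + t)) powr p)"
      by (rule Lp_norm_powr_le_lborel[OF Lp_compact_translate'[OF L] p])
    also have "\<dots> = (LINT t|lborel. norm (w (t + (s' - s)) - w t) powr p)"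
      using lborel_integral_translate[of "\<lambda>t. norm (w (t + (s' - s)) - w t) powr p" s]
      by (simp add: add.commute)
    also have "\<dots> < e powr p" by (rule d'[OF that])
    finally have "Lp_norm p r (\<lambda>\<theta>. w (s' + \<theta>) - w (s + \<theta>)) powr p < e powr p"
      by (simp add: algebra_simps)
    then show ?thesis using p e by (simp add: Lp_norm_less_iff Lp_norm_powr)
  qed
  then show ?thesis using that d(1) by blast
qed

text \<open>Chain rule along increments whose quotients converge in L^p. Such increments are of
  order \<epsilon>, so the Frechet remainder divided by \<epsilon> vanishes, and what is left is a
  pairing with a convergent argument.\<close>

lemma has_Lp_deriv_directional:
  fixes w :: "real \<Rightarrow> 'b::euclidean_space"
  assumes pq: "1 < p" "1 < q" "1 / p + 1 / q = 1"
    and G: "has_Lp_deriv p r G a \<psi>" and a: "a \<in> Lp q r" and w: "w \<in> Lp p r"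
    and \<phi>: "\<And>\<epsilon>. 0 < \<epsilon> \<Longrightarrow> \<phi> \<epsilon> \<in> Lp p r"
    and lim: "((\<lambda>\<epsilon>. Lp_norm p r (\<lambda>\<theta>. (1 / \<epsilon>) *\<^sub>R \<phi> \<epsilon> \<theta> - w \<theta>)) \<longlongrightarrow> 0) (at_right 0)"
  shows "((\<lambda>\<epsilon>. (G (\<lambda>\<theta>. \<psi> \<theta> + \<phi> \<epsilon> \<theta>) - G \<psi>) / \<epsilon>) \<longlongrightarrow> pairing r a w) (at_right 0)"
proof (rule tendstoI)
  fix e :: real assume e: "0 < e"
  \<comment> \<open>Once the quotients are within distance 1 of \<open>w\<close>, \<open>K\<close>
    bounds the p-th powers of their norms and \<open>M\<close> the norms, so that
    \<open>\<epsilon> * M\<close> bounds the increments.\<close>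
  define K where "K = 2 powr p * (1 + Lp_norm p r w powr p)"
  define M where "M = K powr (1 / p)"
  have K: "0 < K" unfolding K_def by (simp add: add_pos_nonneg)
  then have M: "0 < M" by (simp add: M_def)
  define e1 where "e1 = e / (4 * M)"
  \<comment> \<open>The summand 1 keeps the divisor positive when \<open>a\<close> has norm
    zero.\<close>
  define e2 where "e2 = (e / 4) / (1 + Lp_norm q r a)"
  have pos: "0 < e1" "0 < e2" using e M Lp_norm_nonneg[of q r a] by (auto simp: e1_def e2_def)
  obtain c where c: "0 < c" "\<And>\<phi>. \<phi> \<in> Lp p r \<Longrightarrow> Lp_norm p r \<phi> < c \<Longrightarrow>
     \<bar>G (\<lambda>\<theta>. \<psi> \<theta> + \<phi> \<theta>) - G \<psi> - pairing r a \<phi>\<bar> \<le> e1 * Lp_norm p r \<phi>"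
    using G pos(1) unfolding has_Lp_deriv_def by blast
  have "\<forall>\<^sub>F \<epsilon> in at_right 0. Lp_norm p r (\<lambda>\<theta>. (1 / \<epsilon>) *\<^sub>R \<phi> \<epsilon> \<theta> - w \<theta>) < min 1 e2"
    using lim pos by (intro order_tendstoD(2)) auto
  moreover have "\<forall>\<^sub>F \<epsilon> in at_right 0. \<epsilon> \<in> {0<..<c / M}"
    using c(1) M by (intro eventually_at_right_real) auto
  ultimately show "\<forall>\<^sub>F \<epsilon> in at_right 0. dist ((G (\<lambda>\<theta>. \<psi> \<theta> + \<phi> \<epsilon> \<theta>) - G \<psi>) / \<epsilon>) (pairing r a w) < e"
  proof eventually_elim
    case (elim \<epsilon>)
    then have \<epsilon>: "0 < \<epsilon>" "\<epsilon> * M < c" using M by (auto simp: field_simps)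
    let ?d = "\<lambda>\<theta>. (1 / \<epsilon>) *\<^sub>R \<phi> \<epsilon> \<theta> - w \<theta>"
    have p0: "0 \<le> p" "0 < p" using pq by auto
    have dL: "?d \<in> Lp p r" using \<phi>[OF \<epsilon>(1)] w p0 by (intro Lp_diff Lp_scaleR)
    have "Lp_norm p r (\<lambda>\<theta>. ?d \<theta> + w \<theta>) powr p \<le> 2 powr p * (Lp_norm p r ?d powr p + Lp_norm p r w
        powr p)"
      by (rule Lp_norm_add_le[OF p0(2) dL w])
    also have "\<dots> \<le> K"
      unfolding K_def using elim(1) Lp_norm_nonneg[of p r ?d] p0 powr_mono2[of p "Lp_norm p r ?d" 1]
      by (intro mult_left_mono add_right_mono) auto
    finally have "Lp_norm p r (\<lambda>\<theta>. ?d \<theta> + w \<theta>) \<le> M"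
      unfolding M_def by (rule Lp_norm_le_root[OF p0(2)])
    moreover have "Lp_norm p r (\<lambda>\<theta>. ?d \<theta> + w \<theta>) = Lp_norm p r (\<phi> \<epsilon>) / \<epsilon>"
      using Lp_norm_scaleR[OF p0(2), of r "1 / \<epsilon>" "\<phi> \<epsilon>"] \<epsilon> by simp
    ultimately have "Lp_norm p r (\<phi> \<epsilon>) / \<epsilon> \<le> M" by (simp only:)
    then have \<phi>M: "Lp_norm p r (\<phi> \<epsilon>) \<le> \<epsilon> * M" using \<epsilon> by (simp add: pos_divide_le_eq mult.commute)
    have "\<bar>G (\<lambda>\<theta>. \<psi> \<theta> + \<phi> \<epsilon> \<theta>) - G \<psi> - pairing r a (\<phi> \<epsilon>)\<bar> \<le> e1 * Lp_norm p r (\<phi> \<epsilon>)"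
      using \<phi>M \<epsilon> by (intro c(2) \<phi>) auto
    also have "\<dots> \<le> e1 * (\<epsilon> * M)" using \<phi>M pos by (intro mult_left_mono) auto
    finally have "\<bar>G (\<lambda>\<theta>. \<psi> \<theta> + \<phi> \<epsilon> \<theta>) - G \<psi> - pairing r a (\<phi> \<epsilon>)\<bar> / \<epsilon> \<le> e1 * M"
      using \<epsilon> by (simp add: field_simps)
    then have 1: "\<bar>(G (\<lambda>\<theta>. \<psi> \<theta> + \<phi> \<epsilon> \<theta>) - G \<psi>) / \<epsilon> - pairing r a (\<phi> \<epsilon>) / \<epsilon>\<bar> \<le> e / 4"
    proof -
      have "(G (\<lambda>\<theta>. \<psi> \<theta> + \<phi> \<epsilon> \<theta>) - G \<psi>) / \<epsilon> - pairing r a (\<phi> \<epsilon>) / \<epsilon>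
          = (G (\<lambda>\<theta>. \<psi> \<theta> + \<phi> \<epsilon> \<theta>) - G \<psi> - pairing r a (\<phi> \<epsilon>)) / \<epsilon>"
        by (simp add: diff_divide_distrib)
      moreover have "e1 * M = e / 4" using M by (simp add: e1_def)
      moreover have "\<bar>\<epsilon>\<bar> = \<epsilon>" using \<epsilon> by simp
      ultimately show ?thesis using \<open>_ \<le> e1 * M\<close> by (simp only: abs_divide)
    qed
    have "pairing r a ?d = pairing r a (\<phi> \<epsilon>) / \<epsilon> - pairing r a w"
      using pairing_diff_right[OF pq a Lp_scaleR[OF \<phi>[OF \<epsilon>(1)]] w, of "1 / \<epsilon>"]
      by (simp add: pairing_scaleR_right)
    moreover have "\<bar>pairing r a ?d\<bar> \<le> Lp_norm q r a * e2"
      using abs_pairing_le[OF pq a dL] elim(1) Lp_norm_nonneg[of q r a]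
      by (meson less_imp_le min_less_iff_conj mult_left_mono order_trans)
    moreover have "Lp_norm q r a * e2 \<le> e / 4"
    proof -
      have "Lp_norm q r a * e2 \<le> (1 + Lp_norm q r a) * e2" using pos by (intro mult_right_mono) auto
      also have "\<dots> = e / 4" unfolding e2_def using Lp_norm_nonneg[of q r a]
        by (simp add: add_nonneg_eq_0_iff del: divide_divide_eq_left divide_divide_eq_left')
      finally show ?thesis .
    qed
    ultimately have "\<bar>pairing r a (\<phi> \<epsilon>) / \<epsilon> - pairing r a w\<bar> \<le> e / 4" by simp
    with 1 e show ?case unfolding dist_real_def by arith
  qed
qed

text \<open>The end point \<open>T\<close> is null, so agreement before it is enough; measurability
  of \<open>f\<close> follows from completeness of Lebesgue measure.\<close>

lemma set_integral_lebesgue_continuous_cong: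
  fixes f g :: "real \<Rightarrow> real"
  assumes g: "continuous_on {0..T} g" and eq: "\<And>s. s \<in> {0..<T} \<Longrightarrow> f s = g s" and t: "t \<in> {0..T}"
  shows "set_integrable lebesgue {0..t} g" "set_integrable lebesgue {0..t} f"
    "(LINT s:{0..t}|lebesgue. f s) = (LINT s:{0..t}|lebesgue. g s)"
proof -
  show gi: "set_integrable lebesgue {0..t} g"
    by (rule absolutely_integrable_continuous_real) (rule continuous_on_subset[OF g], use t in auto)
  have "AE s in lebesgue. s \<noteq> T"
    unfolding AE_lborel_iff_lebesgue by (rule AE_lborel_singleton)
  then have ae: "AE s in lebesgue. indicat_real {0..t} s *\<^sub>R g s = indicat_real {0..t} s *\<^sub>R f s"
    by eventually_elim (use eq t in \<open>auto simp: indicator_def\<close>)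
  have m: "(\<lambda>s. indicat_real {0..t} s *\<^sub>R g s) \<in> borel_measurable lebesgue"
    using gi unfolding set_integrable_def by auto
  have fm: "(\<lambda>s. indicat_real {0..t} s *\<^sub>R f s) \<in> borel_measurable lebesgue"
    by (rule borel_measurable_AE[OF m ae])
  show "set_integrable lebesgue {0..t} f"
    using gi unfolding set_integrable_def by (rule integrable_cong_AE_imp[OF _ fm ae])
  show "(LINT s:{0..t}|lebesgue. f s) = (LINT s:{0..t}|lebesgue. g s)"
    unfolding set_lebesgue_integral_def
    by (rule integral_cong_AE[OF fm m]) (use ae in \<open>auto elim: eventually_mono\<close>)
qed

section \<open>Paths with absolutely continuous segments\<close>

text \<open>\<open>y\<close> is the given path and \<open>c + primitive u\<close> its continuous
  version. A jump at \<open>T\<close> is allowed, and before time 0 the path is only an L^p class;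
  hence equality holds pointwise on \<open>{0..<T}\<close> and almost everywhere on
  \<open>{-r..T}\<close>.\<close>

locale regular_path =
  fixes p q r T :: real and y u :: "real \<Rightarrow> real^'d" and c :: "real^'d"
    and F :: "real \<Rightarrow> (real \<Rightarrow> real^'d) \<Rightarrow> real^'d \<Rightarrow> real"
  assumes T: "0 < T" and r: "0 < r"
    and pq: "1 < p" "1 < q" "1 / p + 1 / q = 1"
    and u: "Lp_compact p u" and u_after: "\<And>t. T < t \<Longrightarrow> u t = 0"
    and y_AE: "AE t in lebesgue. t \<in> {-r..T} \<longrightarrow> y t = c + primitive u t"
    and y_eq: "\<And>t. t \<in> {0..<T} \<Longrightarrow> y t = c + primitive u t"
    and y_after: "\<And>t. T < t \<Longrightarrow> y t = y T"
    and F: "C112 p q r T F"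
begin

abbreviation Y :: "real \<Rightarrow> real^'d" where "Y t \<equiv> c + primitive u t"
abbreviation J :: "real^'d" where "J \<equiv> y T - Y T"
text \<open>The third argument of \<open>F\<close> is \<open>Y s\<close> instead of
  \<open>y s\<close>. This can matter only at \<open>s = T\<close>, and it makes
  \<open>\<Psi>\<close> continuous up to \<open>T\<close>.\<close>

abbreviation \<Psi> :: "real \<Rightarrow> real \<Rightarrow> real^'d" where
  "\<Psi> s \<equiv> Lp_deriv p q r (\<lambda>\<psi>. F s \<psi> (Y s)) (\<lambda>\<theta>. y (s + \<theta>))"
text \<open>The path including its jump, cut off at \<open>T + 1\<close> to have bounded support;
  the segments at \<open>s + \<epsilon>\<close> with \<epsilon> < 1 are not affected by the
  cut.\<close>

abbreviation v :: "real \<Rightarrow> real^'d" where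
  "v \<equiv> \<lambda>t. indicat_real {-r..T + 1} t *\<^sub>R (Y t + indicat_real {T..} t *\<^sub>R J)"

lemma p_pos: "0 < p" "0 \<le> p" "1 \<le> p" using pq by auto

lemma u_integrable: "integrable lborel u" by (rule Lp_compact_integrable[OF u p_pos(3)])

lemma primitive_continuous: "continuous_on UNIV (primitive u)"
  by (rule continuous_primitive[OF Lp_compact_mono_exponent[OF u p_pos(3)]])

lemma Y_after: "T \<le> t \<Longrightarrow> Y t = Y T"
  using primitive_eq_const[of T u t] u_after by auto

lemma v_Lp: "Lp_compact p v"
proof (rule Lp_compact_bounded)
  have [measurable]: "primitive u \<in> borel_measurable borel"
    by (rule borel_measurable_continuous_onI[OF primitive_continuous])
  show "v \<in> borel_measurable borel" by measurable
  have "norm (primitive u t) \<le> (LINT s|lborel. norm (u s))" for t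
    unfolding primitive_def by (rule norm_set_integral_le[OF u_integrable]) simp
  then have Y: "norm (Y t) \<le> norm c + (LINT s|lborel. norm (u s))" for t
    using norm_triangle_mono by blast
  show "norm (v t) \<le> norm c + (LINT s|lborel. norm (u s)) + norm J" for t
  proof -
    have "norm (Y t + indicat_real {T..} t *\<^sub>R J) \<le> norm c + (LINT s|lborel. norm (u s)) + norm J"
      by (rule order_trans[OF norm_triangle_ineq add_mono[OF Y]]) (auto simp: indicator_def)
    then show ?thesis
      by (cases "t \<in> {-r..T + 1}") (auto intro: order_trans[OF norm_ge_zero])
  qed
  show "0 < r + T + 1" using r T by simp
  show "v t = 0" if "r + T + 1 < \<bar>t\<bar>" for t
    using that r T by (auto simp: indicator_def)
qed (rule p_pos)

lemma y_v: "AE t in lebesgue. t \<in> {-r..T + 1} \<longrightarrow> y t = v t"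
proof -
  have "AE t in lebesgue. t \<noteq> T"
    unfolding AE_lborel_iff_lebesgue by (rule AE_lborel_singleton)
  with y_AE show ?thesis
  proof eventually_elim
    case (elim t)
    then show ?case
      using y_after[of t] Y_after[of t] by (cases "t < T") (auto simp: indicator_def)
  qed
qed

lemma segment_v: "0 \<le> s \<Longrightarrow> s \<le> T + 1 \<Longrightarrow> AE \<theta> in lebesgue_on {-r..0}. y (s + \<theta>) = v (s + \<theta>)"
  by (rule AE_lebesgue_on_translate[OF y_v]) auto

lemma segment_Y: "s \<in> {0..T} \<Longrightarrow> AE \<theta> in lebesgue_on {-r..0}. y (s + \<theta>) = Y (s + \<theta>)"
  by (rule AE_lebesgue_on_translate[OF y_AE]) auto

lemma Lp_shift: "Lp_compact p w \<Longrightarrow> (\<lambda>\<theta>. w (s + \<theta>)) \<in> Lp p r"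
  by (intro Lp_compact_imp_Lp Lp_compact_translate')

lemma segment_Lp: "0 \<le> s \<Longrightarrow> s \<le> T + 1 \<Longrightarrow> (\<lambda>\<theta>. y (s + \<theta>)) \<in> Lp p r"
  using segment_v[of s] by (intro Lp_cong_AE[OF Lp_shift[OF v_Lp, of s]]) (auto elim: eventually_mono)

lemma \<Psi>_deriv:
  assumes "s \<in> {0..T}"
  shows \<Psi>_Lp: "\<Psi> s \<in> Lp q r"
    and has_deriv_\<Psi>: "has_Lp_deriv p r (\<lambda>\<psi>. F s \<psi> (Y s)) (\<Psi> s) (\<lambda>\<theta>. y (s + \<theta>))"
proof -
  have "\<forall>t\<in>{0..T}. \<forall>\<psi>\<in>Lp p r. \<forall>w. \<exists>a\<in>Lp q r. has_Lp_deriv p r (\<lambda>\<phi>. F t \<phi> w) a \<psi>"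
    using F unfolding C112_def by blast
  moreover have "(\<lambda>\<theta>. y (s + \<theta>)) \<in> Lp p r" using assms by (intro segment_Lp) auto
  ultimately have "\<exists>a. a \<in> Lp q r \<and> has_Lp_deriv p r (\<lambda>\<psi>. F s \<psi> (Y s)) a (\<lambda>\<theta>. y (s + \<theta>))"
    using assms by blast
  then have "\<Psi> s \<in> Lp q r \<and> has_Lp_deriv p r (\<lambda>\<psi>. F s \<psi> (Y s)) (\<Psi> s) (\<lambda>\<theta>. y (s + \<theta>))"
    unfolding Lp_deriv_def by (rule someI_ex)
  then show "\<Psi> s \<in> Lp q r" "has_Lp_deriv p r (\<lambda>\<psi>. F s \<psi> (Y s)) (\<Psi> s) (\<lambda>\<theta>. y (s + \<theta>))" by auto
qed

text \<open>Joint continuity from \<open>C112\<close> is composed with the continuity in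
  \<open>s\<close> of the segment and of \<open>Y s\<close>. Continuity of segments is obtained for
  \<open>v\<close>, whose segments agree almost everywhere with those of \<open>y\<close>.\<close>

lemma \<Psi>_continuous:
  assumes s: "s \<in> {0..T}" and e: "0 < e"
  obtains d where "0 < d" "\<And>s'. s' \<in> {0..T} \<Longrightarrow> \<bar>s' - s\<bar> < d \<Longrightarrow> Lp_norm q r (\<lambda>\<theta>. \<Psi> s' \<theta> - \<Psi> s \<theta>) < e"
proof -
  have jc: "jointly_continuous p r T (Lp_dist q r) (\<lambda>t \<psi> w. Lp_deriv p q r (\<lambda>\<phi>. F t \<phi> w) \<psi>)"
    using F unfolding C112_def by blast
  have sL: "(\<lambda>\<theta>. y (s + \<theta>)) \<in> Lp p r" using s by (intro segment_Lp) auto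
  obtain k where k: "0 < k" "\<And>t' \<psi>' v'. t' \<in> {0..T} \<Longrightarrow> \<psi>' \<in> Lp p r \<Longrightarrow>
      \<bar>t' - s\<bar> < k \<Longrightarrow> Lp_dist p r \<psi>' (\<lambda>\<theta>. y (s + \<theta>)) < k \<Longrightarrow> dist v' (Y s) < k \<Longrightarrow>
      Lp_dist q r (Lp_deriv p q r (\<lambda>\<phi>. F t' \<phi> v') \<psi>') (\<Psi> s) < e"
    using jc[unfolded jointly_continuous_def, THEN bspec, OF s, THEN bspec, OF sL, THEN spec, of
        "Y s", THEN spec, of e, THEN mp, OF e]
    by blast
  obtain d1 where d1: "0 < d1"
    "\<And>s s'. \<bar>s' - s\<bar> < d1 \<Longrightarrow> Lp_norm p r (\<lambda>\<theta>. v (s' + \<theta>) - v (s + \<theta>)) < k"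
    by (rule segment_continuous_Lp[OF v_Lp p_pos(1) k(1)]) (rule that)
  have "continuous_on UNIV (\<lambda>t. Y t)" by (intro continuous_intros primitive_continuous)
  then obtain d2 where d2: "0 < d2" "\<And>s'. \<bar>s' - s\<bar> < d2 \<Longrightarrow> dist (Y s') (Y s) < k"
    using k(1) unfolding continuous_on_iff by (metis UNIV_I dist_real_def)
  show ?thesis
  proof (rule that[of "min k (min d1 d2)"])
    fix s' assume s': "s' \<in> {0..T}" "\<bar>s' - s\<bar> < min k (min d1 d2)"
    have ae: "AE \<theta> in lebesgue_on {-r..0}. v (s' + \<theta>) - v (s + \<theta>) = y (s' + \<theta>) - y (s + \<theta>)"
      using segment_v[of s] segment_v[of s'] s s' by (auto elim: eventually_elim2)
    have "Lp_norm p r (\<lambda>\<theta>. v (s' + \<theta>) - v (s + \<theta>)) = Lp_norm p r (\<lambda>\<theta>. y (s' + \<theta>) - y (s + \<theta>))"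
      by (rule Lp_norm_cong_AE[OF ae Lp_diff[OF Lp_shift[OF v_Lp] Lp_shift[OF v_Lp] p_pos(2)]])
    then have "Lp_dist p r (\<lambda>\<theta>. y (s' + \<theta>)) (\<lambda>\<theta>. y (s + \<theta>)) < k"
      using d1(2)[of s' s] s' by (simp add: Lp_dist_def)
    then have "Lp_dist q r (\<Psi> s') (\<Psi> s) < e"
      using s' d2(2)[of s'] segment_Lp[of s'] by (intro k(2)) auto
    then show "Lp_norm q r (\<lambda>\<theta>. \<Psi> s' \<theta> - \<Psi> s \<theta>) < e" by (simp add: Lp_dist_def)
  qed (use k d1 d2 in auto)
qed

text \<open>Applied to \<open>u\<close> this concerns the limiting integrand, applied to an
  increment of \<open>v\<close> the integrand of the forward sums; continuity settles the
  integrability of both.\<close>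

lemma continuous_pairing_\<Psi>:
  assumes w: "Lp_compact p w"
  shows "continuous_on {0..T} (\<lambda>s. pairing r (\<Psi> s) (\<lambda>\<theta>. w (s + \<theta>)))"
  unfolding continuous_on_iff
proof (intro ballI allI impI)
  fix s e :: real assume s: "s \<in> {0..T}" and e: "0 < e"
  define N where "N = (LINT t|lborel. norm (w t) powr p) powr (1 / p)"
  have N: "0 \<le> N" "\<And>s. Lp_norm p r (\<lambda>\<theta>. w (s + \<theta>)) \<le> N"
    using Lp_norm_translate_le[OF w p_pos(1)] by (auto simp: N_def)
  define e1 where "e1 = (e / 2) / (1 + N)"
  define e2 where "e2 = (e / 2) / (1 + Lp_norm q r (\<Psi> s))"
  have n1: "0 < 1 + N" using N(1) by simp
  have n0: "0 < 1 + Lp_norm q r (\<Psi> s)" using Lp_norm_nonneg[of q r "\<Psi> s"] by simp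
  have e1: "0 < e1" and e2: "0 < e2" using e N n0 by (auto simp: e1_def e2_def)
  obtain d1 where d1: "0 < d1" "\<And>s'. s' \<in> {0..T} \<Longrightarrow> \<bar>s' - s\<bar> < d1 \<Longrightarrow> Lp_norm q r (\<lambda>\<theta>. \<Psi> s' \<theta> - \<Psi> s \<theta>) < e1"
    by (rule \<Psi>_continuous[OF s e1]) (rule that)
  obtain d2 where d2: "0 < d2" "\<And>s s'. \<bar>s' - s\<bar> < d2 \<Longrightarrow> Lp_norm p r (\<lambda>\<theta>. w (s' + \<theta>) - w (s + \<theta>)) < e2"
    by (rule segment_continuous_Lp[OF w p_pos(1) e2]) (rule that)
  show "\<exists>d>0. \<forall>s'\<in>{0..T}. dist s' s < d \<longrightarrow>
      dist (pairing r (\<Psi> s') (\<lambda>\<theta>. w (s' + \<theta>))) (pairing r (\<Psi> s) (\<lambda>\<theta>. w (s + \<theta>))) < e"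
  proof (intro exI[of _ "min d1 d2"] conjI ballI impI)
    fix s' assume s': "s' \<in> {0..T}" "dist s' s < min d1 d2"
    note L = \<Psi>_Lp[OF s] \<Psi>_Lp[OF s'(1)]
    note W = Lp_shift[OF w, of s] Lp_shift[OF w, of s']
    have "0 \<le> q" using pq by simp
    have "\<bar>pairing r (\<lambda>\<theta>. \<Psi> s' \<theta> - \<Psi> s \<theta>) (\<lambda>\<theta>. w (s' + \<theta>))\<bar>
        \<le> Lp_norm q r (\<lambda>\<theta>. \<Psi> s' \<theta> - \<Psi> s \<theta>) * Lp_norm p r (\<lambda>\<theta>. w (s' + \<theta>))"
      by (rule abs_pairing_le[OF pq Lp_diff[OF L(2,1) \<open>0 \<le> q\<close>] W(2)])
    also have "\<dots> \<le> e1 * N"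
      using d1(2)[OF s'(1)] s'(2) N Lp_norm_nonneg e1 by (intro mult_mono) (auto simp: dist_real_def)
    also have "\<dots> < e / 2"
    proof -
      have "e1 * N < e1 * (1 + N)" using e1 by simp
      also have "\<dots> = e / 2" using n1 by (simp add: e1_def del: divide_divide_eq_left
          divide_divide_eq_left')
      finally show ?thesis .
    qed
    finally have 1: "\<bar>pairing r (\<Psi> s') (\<lambda>\<theta>. w (s' + \<theta>)) - pairing r (\<Psi> s) (\<lambda>\<theta>. w (s' + \<theta>))\<bar> < e / 2"
      by (simp add: pairing_diff_left[OF pq L(2,1) W(2)])
    have "\<bar>pairing r (\<Psi> s) (\<lambda>\<theta>. w (s' + \<theta>) - w (s + \<theta>))\<bar>
        \<le> Lp_norm q r (\<Psi> s) * Lp_norm p r (\<lambda>\<theta>. w (s' + \<theta>) - w (s + \<theta>))"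
      by (rule abs_pairing_le[OF pq L(1) Lp_diff[OF W(2,1) p_pos(2)]])
    also have "\<dots> \<le> (1 + Lp_norm q r (\<Psi> s)) * e2"
      using d2(2)[of s' s] s'(2) Lp_norm_nonneg n0 by (intro mult_mono) (auto simp: dist_real_def)
    also have "\<dots> = e / 2" using n0 by (simp add: e2_def del: divide_divide_eq_left
        divide_divide_eq_left')
    finally have 2: "\<bar>pairing r (\<Psi> s) (\<lambda>\<theta>. w (s' + \<theta>)) - pairing r (\<Psi> s) (\<lambda>\<theta>. w (s + \<theta>))\<bar> \<le> e / 2"
      by (simp add: pairing_diff_right[OF pq L(1) W(2,1)])
    show "dist (pairing r (\<Psi> s') (\<lambda>\<theta>. w (s' + \<theta>))) (pairing r (\<Psi> s) (\<lambda>\<theta>. w (s + \<theta>))) < e"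
      using 1 2 unfolding dist_real_def by linarith
  qed (use d1 d2 in auto)
qed

text \<open>The weak triangle inequality \<open>Lp_norm_add_le\<close> makes the norm bounded near
  each point, and sequential compactness of \<open>{0..T}\<close> rules out a sequence along which
  it is unbounded.\<close>

lemma \<Psi>_bounded:
  obtains B where "0 \<le> B" "\<And>s. s \<in> {0..T} \<Longrightarrow> Lp_norm q r (\<Psi> s) \<le> B"
proof -
  have "\<exists>B. \<forall>s\<in>{0..T}. Lp_norm q r (\<Psi> s) \<le> B"
  proof (rule ccontr)
    assume "\<nexists>B. \<forall>s\<in>{0..T}. Lp_norm q r (\<Psi> s) \<le> B"
    then have "\<forall>n::nat. \<exists>s\<in>{0..T}. real n < Lp_norm q r (\<Psi> s)" by (meson not_le)
    then obtain \<sigma> :: "nat \<Rightarrow> real" where \<sigma>: "\<And>n. \<sigma> n \<in> {0..T}" "\<And>n. real n < Lp_norm q r (\<Psi> (\<sigma> n))"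
      by metis
    have "seq_compact {0..T}" using compact_Icc compact_imp_seq_compact by blast
    then obtain s k where s: "s \<in> {0..T}" and k: "strict_mono (k :: nat \<Rightarrow> nat)" "(\<sigma> \<circ> k) \<longlonglongrightarrow> s"
      using seq_compactE[of "{0..T}" \<sigma>] \<sigma>(1) by blast
    obtain d where d: "0 < d" "\<And>s'. s' \<in> {0..T} \<Longrightarrow> \<bar>s' - s\<bar> < d \<Longrightarrow> Lp_norm q r (\<lambda>\<theta>. \<Psi> s' \<theta> - \<Psi> s \<theta>) < 1"
      by (rule \<Psi>_continuous[OF s zero_less_one]) (rule that)
    have q0: "0 < q" "0 \<le> q" using pq by auto
    define K where "K = (2 powr q * (1 + Lp_norm q r (\<Psi> s) powr q)) powr (1 / q)"
    have K: "Lp_norm q r (\<Psi> s') \<le> K" if s': "s' \<in> {0..T}" "\<bar>s' - s\<bar> < d" for s'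
      unfolding K_def
    proof (rule Lp_norm_le_root[OF q0(1)])
      have "Lp_norm q r (\<lambda>\<theta>. (\<Psi> s' \<theta> - \<Psi> s \<theta>) + \<Psi> s \<theta>) powr q
          \<le> 2 powr q * (Lp_norm q r (\<lambda>\<theta>. \<Psi> s' \<theta> - \<Psi> s \<theta>) powr q + Lp_norm q r (\<Psi> s) powr q)"
        by (rule Lp_norm_add_le[OF q0(1) Lp_diff[OF \<Psi>_Lp[OF s'(1)] \<Psi>_Lp[OF s] q0(2)] \<Psi>_Lp[OF s]])
      also have "\<dots> \<le> 2 powr q * (1 + Lp_norm q r (\<Psi> s) powr q)"
        using powr_mono2[of q "Lp_norm q r (\<lambda>\<theta>. \<Psi> s' \<theta> - \<Psi> s \<theta>)" 1] d(2)[OF s'] q0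
        by (intro mult_left_mono add_right_mono) (auto simp: Lp_norm_nonneg)
      finally show "Lp_norm q r (\<Psi> s') powr q \<le> 2 powr q * (1 + Lp_norm q r (\<Psi> s) powr q)" by simp
    qed
    have "\<forall>\<^sub>F n in sequentially. dist ((\<sigma> \<circ> k) n) s < d" using k(2) d(1) by (rule tendstoD)
    moreover obtain m where "K < real m" using reals_Archimedean2 by blast
    then have "K < real n" if "m \<le> n" for n using that by linarith
    then have "\<forall>\<^sub>F n in sequentially. K < real n" by (auto simp: eventually_sequentially)
    ultimately have "\<forall>\<^sub>F n::nat in sequentially. False"
    proof eventually_elim
      case (elim n)
      then have "Lp_norm q r (\<Psi> (\<sigma> (k n))) \<le> K" using \<sigma>(1) by (intro K) (auto simp: dist_real_def)
      moreover have "real n \<le> real (k n)" using seq_suble[OF k(1), of n] by simp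
      ultimately show ?case using \<sigma>(2)[of "k n"] elim by linarith
    qed
    then show False by simp
  qed
  then obtain B where "\<forall>s\<in>{0..T}. Lp_norm q r (\<Psi> s) \<le> B" by blast
  then show ?thesis using that[of "max B 0"] by (auto simp: le_max_iff_disj)
qed

end

section \<open>Translation and truncation of primitives\<close>

lemma primitive_translate:
  fixes u :: "real \<Rightarrow> 'b::euclidean_space"
  shows "primitive (\<lambda>a. u (s + a)) t = primitive u (s + t)"
proof -
  have "primitive u (s + t) = (LINT a|lborel. indicat_real {..s + t} (a + s) *\<^sub>R u (a + s))"
    unfolding primitive_def set_lebesgue_integral_def by (rule lborel_integral_translate[symmetric])
  also have "\<dots> = primitive (\<lambda>a. u (s + a)) t"
    unfolding primitive_def set_lebesgue_integral_def
    by (intro Bochner_Integration.integral_cong) (auto simp: indicator_def add.commute)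
  finally show ?thesis by simp
qed

text \<open>Cutting \<open>u\<close> off at \<open>s\<close> freezes the primitive from time
  \<open>s\<close> on, which is how the left shift continues a segment.\<close>

lemma primitive_restrict:
  fixes u :: "real \<Rightarrow> 'b::euclidean_space"
  shows "primitive (\<lambda>a. indicat_real {..s} a *\<^sub>R u a) t = primitive u (min t s)"
  unfolding primitive_def set_lebesgue_integral_def
  by (intro Bochner_Integration.integral_cong) (auto simp: indicator_def)

text \<open>\<open>\<kappa>\<close> is the norm of the error over the whole line and hence the same
  for every window.\<close>

lemma difference_quotient_segment:
  fixes w :: "real \<Rightarrow> 'b::euclidean_space"
  assumes w: "Lp_compact p w" and p: "1 < p"
  obtains \<kappa> where "(\<kappa> \<longlongrightarrow> 0) (at_right 0)"
    "\<And>r s \<epsilon>. 0 < \<epsilon> \<Longrightarrow> Lp_norm p r (\<lambda>\<theta>. (1 / \<epsilon>) *\<^sub>R (primitive w (s + \<theta> + \<epsilon>) - primitive w (s + \<theta>))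
        - w (s + \<theta>)) \<le> \<kappa> \<epsilon>"
proof -
  define q where "q \<epsilon> t = (1 / \<epsilon>) *\<^sub>R (primitive w (t + \<epsilon>) - primitive w t) - w t" for \<epsilon> t
  define \<kappa> where "\<kappa> \<epsilon> = (LINT t|lborel. norm (q \<epsilon> t) powr p) powr (1 / p)" for \<epsilon>
  have p0: "0 < p" using p by simp
  have "((\<lambda>\<epsilon>. LINT t|lborel. norm (q \<epsilon> t) powr p) \<longlongrightarrow> 0) (at_right 0)"
    unfolding q_def by (rule difference_quotient_Lp[OF w p])
  then have "(\<kappa> \<longlongrightarrow> 0 powr (1 / p)) (at_right 0)"
    unfolding \<kappa>_def using p0 by (intro tendsto_powr') auto
  then have "(\<kappa> \<longlongrightarrow> 0) (at_right 0)" by simp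
  moreover have "Lp_norm p r (\<lambda>\<theta>. q \<epsilon> (s + \<theta>)) \<le> \<kappa> \<epsilon>" if "0 < \<epsilon>" for r s \<epsilon>
  proof -
    have "Lp_compact p (q \<epsilon>)"
      unfolding q_def using w p that
      by (intro Lp_compact_diff Lp_compact_scaleR Lp_compact_increment) auto
    then show ?thesis unfolding \<kappa>_def by (rule Lp_norm_translate_le[OF _ p0])
  qed
  ultimately show ?thesis using that unfolding q_def by blast
qed

section \<open>Weak derivative, shift generator and forward sums along one path\<close>

context regular_path
begin

abbreviation A :: "real \<Rightarrow> real" where "A s \<equiv> pairing r (\<Psi> s) (\<lambda>\<theta>. u (s + \<theta>))"

text \<open>\<open>weak_deriv\<close> is an arbitrary choice from an a.e. class. Uniqueness of weak
  derivatives identifies that class with the translate of \<open>u\<close>, and the pairing depends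
  on the class alone.\<close>

lemma pairing_weak_deriv:
  assumes s: "s \<in> {0..T}"
  shows "pairing r (\<Psi> s) (weak_deriv p r (\<lambda>\<theta>. y (s + \<theta>))) = A s"
proof -
  have us: "Lp_compact p (\<lambda>\<theta>. u (s + \<theta>))" by (rule Lp_compact_translate'[OF u])
  have "has_weak_deriv r (\<lambda>\<theta>. y (s + \<theta>)) (\<lambda>\<theta>. u (s + \<theta>))"
    by (rule has_weak_deriv_primitive[OF r us p_pos(3), of _ c])
       (use segment_Y[OF s] in \<open>simp add: primitive_translate\<close>)
  moreover have uL: "(\<lambda>\<theta>. u (s + \<theta>)) \<in> Lp p r" by (rule Lp_shift[OF u])
  ultimately have "\<exists>w. w \<in> Lp p r \<and> has_weak_deriv r (\<lambda>\<theta>. y (s + \<theta>)) w" by blast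
  then have wd: "weak_deriv p r (\<lambda>\<theta>. y (s + \<theta>)) \<in> Lp p r \<and>
      has_weak_deriv r (\<lambda>\<theta>. y (s + \<theta>)) (weak_deriv p r (\<lambda>\<theta>. y (s + \<theta>)))"
    unfolding weak_deriv_def by (rule someI_ex)
  have "AE \<theta> in lebesgue_on {-r..0}. weak_deriv p r (\<lambda>\<theta>. y (s + \<theta>)) \<theta> = u (s + \<theta>)"
    by (rule has_weak_deriv_unique[OF r pq(1)]) (use wd uL \<open>has_weak_deriv r _ (\<lambda>\<theta>. u (s + \<theta>))\<close> in auto)
  then show ?thesis
    using wd by (intro pairing_cong_AE[OF _ _ \<Psi>_Lp[OF s]]) auto
qed

text \<open>The shifted segment is frozen at \<open>y s\<close>, so its increment is that of the
  primitive of \<open>w\<close>, which is \<open>u\<close> cut off at time \<open>s\<close>. The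
  chain rule gives the pairing with \<open>w\<close>, and \<open>w\<close> agrees with
  \<open>u\<close> at s + \<theta> for \<theta> \<le> 0.\<close>

lemma shift_gen_limit:
  assumes s: "s \<in> {0..<T}"
  shows "has_shift_gen F s (\<lambda>\<theta>. y (s + \<theta>)) (y s) (A s)"
proof -
  have s': "s \<in> {0..T}" using s by auto
  have ys: "y s = Y s" by (rule y_eq[OF s])
  define w where "w a = indicat_real {..s} a *\<^sub>R u a" for a
  have w: "Lp_compact p w" unfolding w_def by (rule Lp_compact_restrict[OF u]) simp
  have pw: "primitive w t = primitive u (min t s)" for t
    unfolding w_def by (rule primitive_restrict)
  define \<phi> where "\<phi> \<epsilon> \<theta> = left_shift (\<lambda>\<theta>. y (s + \<theta>)) (y s) \<epsilon> \<theta> - y (s + \<theta>)" for \<epsilon> \<theta>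
  have \<phi>_AE: "AE \<theta> in lebesgue_on {-r..0}. primitive w (s + \<theta> + \<epsilon>) - primitive w (s + \<theta>) = \<phi> \<epsilon> \<theta>"
    if \<epsilon>: "0 < \<epsilon>" for \<epsilon>
  proof -
    \<comment> \<open>The time \<open>s + \<epsilon> + \<theta>\<close> may lie beyond
      \<open>T\<close>; the range condition stays as a premise and is discharged only where
      \<open>\<theta> + \<epsilon> < 0\<close>.\<close>
    have "AE t in lebesgue. s + \<epsilon> + t \<in> {-r..T} \<longrightarrow> y (s + \<epsilon> + t) = Y (s + \<epsilon> + t)"
      by (rule AE_lebesgue_translate[OF y_AE])
    then have "AE \<theta> in lebesgue_on {-r..0}. s + \<epsilon> + \<theta> \<in> {-r..T} \<longrightarrow> y (s + \<epsilon> + \<theta>) = Y (s + \<epsilon> + \<theta>)"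
      by (subst AE_restrict_space_iff) (auto elim: eventually_mono)
    moreover have "AE \<theta> in lebesgue_on {-r..0}. \<theta> \<in> {-r..0}" by (rule AE_I2) simp
    ultimately show ?thesis using segment_Y[OF s']
    proof eventually_elim
      case (elim \<theta>)
      then have "s + \<theta> \<le> s" "s \<le> T" "-r \<le> s + \<epsilon> + \<theta>" using s \<epsilon> by auto
      have pw1: "primitive w (s + \<theta>) = primitive u (s + \<theta>)" using \<open>s + \<theta> \<le> s\<close> by (simp add: pw)
      show ?case
      proof (cases "\<theta> + \<epsilon> < 0")
        case True
        have "s + \<theta> + \<epsilon> = s + \<epsilon> + \<theta>" by simp
        then have "primitive w (s + \<theta> + \<epsilon>) = primitive u (s + \<epsilon> + \<theta>)" using True by (simp only:
            pw) (simp add: min_def)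
        moreover have "y (s + \<epsilon> + \<theta>) = Y (s + \<epsilon> + \<theta>)" using elim(1) True s \<open>- r \<le> s + \<epsilon> + \<theta>\<close> by auto
        ultimately show ?thesis
          using elim(3) True pw1 by (simp add: \<phi>_def left_shift_def add.assoc add.commute[of \<epsilon>])
      next
        case False
        then have "min (s + \<theta> + \<epsilon>) s = s" by simp
        then have "primitive w (s + \<theta> + \<epsilon>) = primitive u s" by (simp only: pw)
        then show ?thesis
          using elim(3) False ys pw1 by (simp add: \<phi>_def left_shift_def)
      qed
    qed
  qed
  have incr: "(\<lambda>\<theta>. primitive w (s + \<theta> + \<epsilon>) - primitive w (s + \<theta>)) \<in> Lp p r" if "0 < \<epsilon>" for \<epsilon>
    using Lp_shift[OF Lp_compact_increment[OF w p_pos(3), of \<epsilon>], of s] that by simp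
  have \<phi>_Lp: "\<phi> \<epsilon> \<in> Lp p r" if "0 < \<epsilon>" for \<epsilon>
    by (rule Lp_cong_AE[OF incr[OF that] \<phi>_AE[OF that]])
  obtain \<kappa> where \<kappa>: "(\<kappa> \<longlongrightarrow> 0) (at_right 0)"
    "\<And>r s \<epsilon>. 0 < \<epsilon> \<Longrightarrow> Lp_norm p r (\<lambda>\<theta>. (1 / \<epsilon>) *\<^sub>R (primitive w (s + \<theta> + \<epsilon>) - primitive w (s + \<theta>))
        - w (s + \<theta>)) \<le> \<kappa> \<epsilon>"
    by (rule difference_quotient_segment[OF w pq(1)]) (rule that)
  have wL: "(\<lambda>\<theta>. w (s + \<theta>)) \<in> Lp p r" by (rule Lp_shift[OF w])
  have lim: "((\<lambda>\<epsilon>. Lp_norm p r (\<lambda>\<theta>. (1 / \<epsilon>) *\<^sub>R \<phi> \<epsilon> \<theta> - w (s + \<theta>))) \<longlongrightarrow> 0) (at_right 0)"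
  proof (rule Lim_null_comparison[OF _ \<kappa>(1)])
    show "\<forall>\<^sub>F \<epsilon> in at_right 0. norm (Lp_norm p r (\<lambda>\<theta>. (1 / \<epsilon>) *\<^sub>R \<phi> \<epsilon> \<theta> - w (s + \<theta>))) \<le> \<kappa> \<epsilon>"
      using eventually_at_right_less[of 0]
    proof eventually_elim
      case (elim \<epsilon>)
      have "AE \<theta> in lebesgue_on {-r..0}.
          (1 / \<epsilon>) *\<^sub>R (primitive w (s + \<theta> + \<epsilon>) - primitive w (s + \<theta>)) - w (s + \<theta>) = (1 / \<epsilon>) *\<^sub>R \<phi>
              \<epsilon> \<theta> - w (s + \<theta>)"
        using \<phi>_AE[OF elim] by eventually_elim simp
      from Lp_norm_cong_AE[OF this Lp_diff[OF Lp_scaleR[OF incr[OF elim]] wL p_pos(2)]]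
      show ?case using \<kappa>(2)[OF elim, of r s] by (simp add: Lp_norm_nonneg)
    qed
  qed
  have "((\<lambda>\<epsilon>. (F s (\<lambda>\<theta>. y (s + \<theta>) + \<phi> \<epsilon> \<theta>) (Y s) - F s (\<lambda>\<theta>. y (s + \<theta>)) (Y s)) / \<epsilon>)
      \<longlongrightarrow> pairing r (\<Psi> s) (\<lambda>\<theta>. w (s + \<theta>))) (at_right 0)"
    by (rule has_Lp_deriv_directional[OF pq has_deriv_\<Psi>[OF s'] \<Psi>_Lp[OF s'] wL \<phi>_Lp lim])
  moreover have "(\<lambda>\<theta>. y (s + \<theta>) + \<phi> \<epsilon> \<theta>) = left_shift (\<lambda>\<theta>. y (s + \<theta>)) (y s) \<epsilon>" for \<epsilon>
    by (auto simp: \<phi>_def)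
  moreover have "pairing r (\<Psi> s) (\<lambda>\<theta>. w (s + \<theta>)) = A s"
    by (intro pairing_cong_AE[OF _ _ \<Psi>_Lp[OF s'] wL]) (auto simp: w_def intro!: AE_I2)
  ultimately show ?thesis unfolding has_shift_gen_def ys by simp
qed

lemma shift_gen_eq:
  assumes s: "s \<in> {0..<T}"
  shows "shift_gen F s (\<lambda>\<theta>. y (s + \<theta>)) (y s) = A s"
  unfolding shift_gen_def
proof (rule the_equality)
  show "has_shift_gen F s (\<lambda>\<theta>. y (s + \<theta>)) (y s) (A s)" by (rule shift_gen_limit[OF s])
  fix l assume "has_shift_gen F s (\<lambda>\<theta>. y (s + \<theta>)) (y s) l"
  then show "l = A s"
    using shift_gen_limit[OF s] unfolding has_shift_gen_def
    by (intro tendsto_unique[OF trivial_limit_at_right_real])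
qed

text \<open>The increment of \<open>v\<close> is the increment of the continuous version, controlled
  by \<open>\<kappa>\<close>, plus the contribution of the jump. The jump is felt only for
  \<open>s\<close> within \<epsilon> of \<open>T\<close>, and then on a \<theta>-interval of length
  at most \<epsilon>, which accounts for the factor \<open>\<epsilon> powr (1 / p)\<close>.\<close>

lemma forward_sum_estimate:
  assumes \<epsilon>: "0 < \<epsilon>" "\<epsilon> < 1" and s: "s \<in> {0..T}"
    and B: "Lp_norm q r (\<Psi> s) \<le> B" and \<kappa>: "Lp_norm p r (\<lambda>\<theta>. (1 / \<epsilon>) *\<^sub>R (primitive u (s + \<theta> + \<epsilon>) -
        primitive u (s + \<theta>)) - u (s + \<theta>)) \<le> \<kappa>"
  shows "\<bar>1 / \<epsilon> * pairing r (\<Psi> s) (\<lambda>\<theta>. v (s + \<epsilon> + \<theta>) - v (s + \<theta>)) - A s\<bar>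
    \<le> B * \<kappa> + B * norm J * \<epsilon> powr (1 / p) / \<epsilon> * indicat_real {T - \<epsilon>..T} s"
proof -
  have B0: "0 \<le> B" using B Lp_norm_nonneg[of q r "\<Psi> s"] by simp
  define inc where "inc t = primitive u (t + \<epsilon>) - primitive u t" for t
  \<comment> \<open>For t < T the jump enters the increment exactly when
    \<open>t \<ge> T - \<epsilon>\<close>. Points of the window satisfy
    \<open>s + \<theta> \<le> T\<close>, with equality for at most one \<theta>; the right end
    \<open>T + 2\<close> serves to bound the support.\<close>
  define jmp where "jmp t = indicat_real {T - \<epsilon>..T + 2} t *\<^sub>R J" for t
  have inc: "Lp_compact p inc" unfolding inc_def using \<epsilon> by (intro Lp_compact_increment u p_pos) auto
  have [measurable]: "jmp \<in> borel_measurable borel" unfolding jmp_def by measurable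
  have jmp: "Lp_compact p jmp"
    by (rule Lp_compact_bounded[of _ "norm J" "T + 3"]) (use T \<epsilon> p_pos in \<open>auto simp: jmp_def
        indicator_def\<close>)
  note L = \<Psi>_Lp[OF s] and incL = Lp_shift[OF inc, of s] and jmpL = Lp_shift[OF jmp, of s] and uL =
      Lp_shift[OF u, of s]
  have "AE \<theta> in lebesgue_on {-r..0}. \<theta> \<noteq> T - s" by (rule AE_lebesgue_on_singleton)
  moreover have "AE \<theta> in lebesgue_on {-r..0}. \<theta> \<in> {-r..0}" by (rule AE_I2) simp
  ultimately have "AE \<theta> in lebesgue_on {-r..0}. inc (s + \<theta>) + jmp (s + \<theta>) = v (s + \<epsilon> + \<theta>) - v (s + \<theta>)"
  proof eventually_elim
    case (elim \<theta>)
    then have "s + \<theta> < T" "- r \<le> s + \<theta>" using s by auto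
    then show ?case using \<epsilon> s elim by (auto simp: inc_def jmp_def indicator_def algebra_simps)
  qed
  then have "pairing r (\<Psi> s) (\<lambda>\<theta>. v (s + \<epsilon> + \<theta>) - v (s + \<theta>)) = pairing r (\<Psi> s) (\<lambda>\<theta>. inc (s + \<theta>) +
      jmp (s + \<theta>))"
    by (intro pairing_cong_AE[symmetric, OF _ _ L Lp_add[OF incL jmpL p_pos(2)]]) auto
  also have "\<dots> = pairing r (\<Psi> s) (\<lambda>\<theta>. inc (s + \<theta>)) + pairing r (\<Psi> s) (\<lambda>\<theta>. jmp (s + \<theta>))"
    by (rule pairing_add_right[OF pq L incL jmpL])
  finally have "1 / \<epsilon> * pairing r (\<Psi> s) (\<lambda>\<theta>. v (s + \<epsilon> + \<theta>) - v (s + \<theta>)) - A s =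
      (1 / \<epsilon> * pairing r (\<Psi> s) (\<lambda>\<theta>. inc (s + \<theta>)) - A s) + 1 / \<epsilon> * pairing r (\<Psi> s) (\<lambda>\<theta>. jmp (s + \<theta>))"
    by (simp add: algebra_simps)
  also have "1 / \<epsilon> * pairing r (\<Psi> s) (\<lambda>\<theta>. inc (s + \<theta>)) - A s = pairing r (\<Psi> s) (\<lambda>\<theta>. (1 / \<epsilon>) *\<^sub>R
      inc (s + \<theta>) - u (s + \<theta>))"
    by (simp only: pairing_diff_right[OF pq L Lp_scaleR[OF incL] uL] pairing_scaleR_right)
  finally have split: "1 / \<epsilon> * pairing r (\<Psi> s) (\<lambda>\<theta>. v (s + \<epsilon> + \<theta>) - v (s + \<theta>)) - A s =
      pairing r (\<Psi> s) (\<lambda>\<theta>. (1 / \<epsilon>) *\<^sub>R inc (s + \<theta>) - u (s + \<theta>)) + 1 / \<epsilon> * pairing r (\<Psi> s) (\<lambda>\<theta>. jmp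
          (s + \<theta>))" .
  have "\<bar>pairing r (\<Psi> s) (\<lambda>\<theta>. (1 / \<epsilon>) *\<^sub>R inc (s + \<theta>) - u (s + \<theta>))\<bar>
      \<le> Lp_norm q r (\<Psi> s) * Lp_norm p r (\<lambda>\<theta>. (1 / \<epsilon>) *\<^sub>R inc (s + \<theta>) - u (s + \<theta>))"
    by (rule abs_pairing_le[OF pq L Lp_diff[OF Lp_scaleR[OF incL] uL p_pos(2)]])
  also have "\<dots> \<le> B * \<kappa>"
    using B B0 \<kappa> by (intro mult_mono Lp_norm_nonneg) (auto simp: inc_def)
  finally have 1: "\<bar>pairing r (\<Psi> s) (\<lambda>\<theta>. (1 / \<epsilon>) *\<^sub>R inc (s + \<theta>) - u (s + \<theta>))\<bar> \<le> B * \<kappa>" .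
  have 2: "\<bar>pairing r (\<Psi> s) (\<lambda>\<theta>. jmp (s + \<theta>))\<bar> \<le> B * norm J * \<epsilon> powr (1 / p) * indicat_real {T - \<epsilon>..T} s"
  proof (cases "T - \<epsilon> \<le> s")
    case False
    have "pairing r (\<Psi> s) (\<lambda>\<theta>. jmp (s + \<theta>)) = (LINT \<theta>|lebesgue_on {-r..0}. 0)"
      unfolding pairing_def
      by (intro Bochner_Integration.integral_cong) (use False in \<open>auto simp: jmp_def indicator_def\<close>)
    then show ?thesis using B0 by simp
  next
    case True
    have "Lp_norm p r (\<lambda>\<theta>. jmp (s + \<theta>)) powr p = (LINT \<theta>|lborel. indicat_real {-r..0} \<theta> *\<^sub>R norm
        (jmp (s + \<theta>)) powr p)"
      using Lp_compact_borel[OF Lp_compact_translate'[OF jmp, of s]] p_pos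
      by (simp add: Lp_norm_powr integral_lebesgue_on_borel)
    \<comment> \<open>From \<open>s + \<theta> \<ge> T - \<epsilon>\<close> and
      \<open>s \<le> T\<close> follows \<open>\<theta> \<ge> - \<epsilon>\<close>.\<close>
    also have "\<dots> \<le> (LINT \<theta>|lborel. norm J powr p * indicat_real {-\<epsilon>..0} \<theta>)"
    proof (rule integral_mono')
      show "indicat_real {-r..0} \<theta> *\<^sub>R norm (jmp (s + \<theta>)) powr p \<le> norm J powr p * indicat_real
          {-\<epsilon>..0} \<theta>" for \<theta>
        using s by (auto simp: jmp_def indicator_def)
    qed auto
    also have "\<dots> = norm J powr p * \<epsilon>" using \<epsilon> by simp
    finally have "Lp_norm p r (\<lambda>\<theta>. jmp (s + \<theta>)) \<le> (norm J powr p * \<epsilon>) powr (1 / p)"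
      by (rule Lp_norm_le_root[OF p_pos(1)])
    also have "\<dots> = norm J * \<epsilon> powr (1 / p)"
      using \<epsilon> p_pos by (simp add: powr_mult powr_powr)
    finally have n: "Lp_norm p r (\<lambda>\<theta>. jmp (s + \<theta>)) \<le> norm J * \<epsilon> powr (1 / p)" .
    have "\<bar>pairing r (\<Psi> s) (\<lambda>\<theta>. jmp (s + \<theta>))\<bar> \<le> Lp_norm q r (\<Psi> s) * Lp_norm p r (\<lambda>\<theta>. jmp (s + \<theta>))"
      by (rule abs_pairing_le[OF pq L jmpL])
    also have "\<dots> \<le> B * (norm J * \<epsilon> powr (1 / p))"
      using n B B0 by (intro mult_mono Lp_norm_nonneg) auto
    finally show ?thesis using True s by (simp add: mult.assoc)
  qed
  have "\<bar>1 / \<epsilon> * pairing r (\<Psi> s) (\<lambda>\<theta>. jmp (s + \<theta>))\<bar> = 1 / \<epsilon> * \<bar>pairing r (\<Psi> s) (\<lambda>\<theta>. jmp (s + \<theta>))\<bar>"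
    using \<epsilon> by (simp add: abs_mult)
  also have "\<dots> \<le> 1 / \<epsilon> * (B * norm J * \<epsilon> powr (1 / p) * indicat_real {T - \<epsilon>..T} s)"
    using 2 \<epsilon> by (intro mult_left_mono) auto
  finally have "\<bar>1 / \<epsilon> * pairing r (\<Psi> s) (\<lambda>\<theta>. jmp (s + \<theta>))\<bar> \<le> B * norm J * \<epsilon> powr (1 / p) / \<epsilon> *
      indicat_real {T - \<epsilon>..T} s"
    by simp
  with 1 show ?thesis unfolding split by (intro order_trans[OF abs_triangle_ineq add_mono])
qed

lemma forward_sum_limit:
  assumes t: "t \<in> {0..T}"
  shows "((\<lambda>\<epsilon>. 1 / \<epsilon> * (LINT s:{0..t}|lebesgue.
      pairing r (Lp_deriv p q r (\<lambda>\<psi>. F s \<psi> (y s)) (\<lambda>\<theta>. y (s + \<theta>))) (\<lambda>\<theta>. y (s + \<epsilon> + \<theta>) - y (s + \<theta>))))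
    \<longlongrightarrow> (LINT s:{0..t}|lebesgue. A s)) (at_right 0)"
proof -
  obtain B where B: "0 \<le> B" "\<And>s. s \<in> {0..T} \<Longrightarrow> Lp_norm q r (\<Psi> s) \<le> B"
    by (rule \<Psi>_bounded) (rule that)
  obtain \<kappa> where \<kappa>: "(\<kappa> \<longlongrightarrow> 0) (at_right 0)"
    "\<And>r s \<epsilon>. 0 < \<epsilon> \<Longrightarrow> Lp_norm p r (\<lambda>\<theta>. (1 / \<epsilon>) *\<^sub>R (primitive u (s + \<theta> + \<epsilon>) - primitive u (s + \<theta>))
        - u (s + \<theta>)) \<le> \<kappa> \<epsilon>"
    by (rule difference_quotient_segment[OF u pq(1)]) (rule that)
  let ?S = "\<lambda>\<epsilon>. 1 / \<epsilon> * (LINT s:{0..t}|lebesgue.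
      pairing r (Lp_deriv p q r (\<lambda>\<psi>. F s \<psi> (y s)) (\<lambda>\<theta>. y (s + \<theta>))) (\<lambda>\<theta>. y (s + \<epsilon> + \<theta>) - y (s + \<theta>)))"
  have cA: "continuous_on {0..T} A" by (rule continuous_pairing_\<Psi>[OF u])
  have bound: "\<bar>?S \<epsilon> - (LINT s:{0..t}|lebesgue. A s)\<bar> \<le> T * (B * \<kappa> \<epsilon>) + B * norm J * \<epsilon> powr (1 / p)"
    if \<epsilon>: "0 < \<epsilon>" "\<epsilon> < 1" for \<epsilon>
  proof -
    define P where "P s = pairing r (\<Psi> s) (\<lambda>\<theta>. v (s + \<epsilon> + \<theta>) - v (s + \<theta>))" for s
    define C where "C = B * norm J * \<epsilon> powr (1 / p) / \<epsilon>"
    have C: "0 \<le> C" using B(1) \<epsilon> by (simp add: C_def)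
    have "Lp_compact p (\<lambda>t. v (t + \<epsilon>) - v t)"
      by (intro Lp_compact_diff Lp_compact_translate[OF v_Lp] v_Lp p_pos)
    from continuous_pairing_\<Psi>[OF this] have cP: "continuous_on {0..T} P"
      by (simp add: P_def[abs_def] algebra_simps)
    have eqP: "pairing r (Lp_deriv p q r (\<lambda>\<psi>. F s \<psi> (y s)) (\<lambda>\<theta>. y (s + \<theta>))) (\<lambda>\<theta>. y (s + \<epsilon> + \<theta>) - y
        (s + \<theta>)) = P s"
      if s: "s \<in> {0..<T}" for s
    proof -
      have "AE \<theta> in lebesgue_on {-r..0}. v (s + \<epsilon> + \<theta>) - v (s + \<theta>) = y (s + \<epsilon> + \<theta>) - y (s + \<theta>)"
        using segment_v[of s] segment_v[of "s + \<epsilon>"] s \<epsilon> by (auto elim: eventually_elim2)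
      then show ?thesis
        unfolding P_def y_eq[OF s] using s
        by (intro pairing_cong_AE[symmetric, OF _ _ \<Psi>_Lp Lp_diff[OF Lp_shift[OF v_Lp] Lp_shift[OF
            v_Lp] p_pos(2)]]) auto
    qed
    have iP: "set_integrable lebesgue {0..t} P" and iA: "set_integrable lebesgue {0..t} A"
      by (rule set_integral_lebesgue_continuous_cong(1)[OF cP _ t, of P]
          set_integral_lebesgue_continuous_cong(1)[OF cA _ t, of A], simp)+
    have "?S \<epsilon> = 1 / \<epsilon> * (LINT s:{0..t}|lebesgue. P s)"
      by (subst set_integral_lebesgue_continuous_cong(3)[OF cP eqP t]) simp_all
    then have eq: "?S \<epsilon> - (LINT s:{0..t}|lebesgue. A s) = (LINT s:{0..t}|lebesgue. 1 / \<epsilon> * P s - A s)"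
      using iP iA by (simp add: set_integral_diff)
    \<comment> \<open>The jump term has height of order \<epsilon>^(1/p - 1) but lives on an
      s-interval of length \<epsilon>, so its integral is of order \<epsilon>^(1/p).\<close>
    define W where "W s = B * \<kappa> \<epsilon> * indicat_real {0..T} s + C * indicat_real {T - \<epsilon>..T} s" for s
    have ind: "integrable lebesgue (indicat_real {a..b})" "(LINT s|lebesgue. indicat_real {a..b}
        s) = measure lborel {a..b}" for a b :: real
      by (simp_all add: integrable_completion integral_completion)
    \<comment> \<open>\<open>\<kappa> \<epsilon>\<close> is nonnegative because it bounds a norm;
      the time 0 is an arbitrary instance.\<close>
    have "0 \<le> Lp_norm p r (\<lambda>\<theta>. (1 / \<epsilon>) *\<^sub>R (primitive u (0 + \<theta> + \<epsilon>) - primitive u (0 + \<theta>)) - u (0 + \<theta>))"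
      by (rule Lp_norm_nonneg)
    then have \<kappa>0: "0 \<le> \<kappa> \<epsilon>" using \<kappa>(2)[OF \<epsilon>(1), of r 0] by linarith
    have "\<bar>LINT s:{0..t}|lebesgue. 1 / \<epsilon> * P s - A s\<bar> \<le> (LINT s|lebesgue. W s)"
    proof (rule Bochner_Integration.integral_norm_bound_integral[of lebesgue "\<lambda>s. indicat_real
        {0..t} s *\<^sub>R (1 / \<epsilon> * P s - A s)" W,
          folded set_lebesgue_integral_def, unfolded real_norm_def])
      have "set_integrable lebesgue {0..t} (\<lambda>s. 1 / \<epsilon> * P s - A s)"
        using iP iA by (intro set_integral_diff(1) set_integrable_mult_right) auto
      then show "integrable lebesgue (\<lambda>s. indicat_real {0..t} s *\<^sub>R (1 / \<epsilon> * P s - A s))"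
        unfolding set_integrable_def .
      show "integrable lebesgue W" unfolding W_def using ind by simp
      fix s
      show "\<bar>indicat_real {0..t} s *\<^sub>R (1 / \<epsilon> * P s - A s)\<bar> \<le> W s"
      proof (cases "s \<in> {0..t}")
        case True
        then have s: "s \<in> {0..T}" using t by auto
        show ?thesis
          using forward_sum_estimate[OF \<epsilon> s B(2)[OF s] \<kappa>(2)[OF \<epsilon>(1)]] True s
          by (simp add: W_def P_def C_def)
      next
        case False
        then show ?thesis using B(1) C \<kappa>0 by (simp add: W_def)
      qed
    qed
    also have "(LINT s|lebesgue. W s) = B * \<kappa> \<epsilon> * T + C * \<epsilon>"
      unfolding W_def using ind T \<epsilon> by simp
    also have "\<dots> = T * (B * \<kappa> \<epsilon>) + B * norm J * \<epsilon> powr (1 / p)"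
      using \<epsilon> by (simp add: C_def)
    finally show ?thesis unfolding eq .
  qed
  have "((\<lambda>\<epsilon>. \<epsilon> powr (1 / p)) \<longlongrightarrow> 0 powr (1 / p)) (at_right 0)"
    using p_pos eventually_at_right_less[of "0::real"]
    by (intro tendsto_powr') (auto intro: tendsto_eq_intros elim: eventually_mono)
  then have "((\<lambda>\<epsilon>. T * (B * \<kappa> \<epsilon>) + B * norm J * \<epsilon> powr (1 / p)) \<longlongrightarrow> T * (B * 0) + B * norm J * 0)
      (at_right 0)"
    using \<kappa>(1) by (intro tendsto_intros) auto
  then have z: "((\<lambda>\<epsilon>. T * (B * \<kappa> \<epsilon>) + B * norm J * \<epsilon> powr (1 / p)) \<longlongrightarrow> 0) (at_right 0)" by simp
  have "((\<lambda>\<epsilon>. ?S \<epsilon> - (LINT s:{0..t}|lebesgue. A s)) \<longlongrightarrow> 0) (at_right 0)"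
  proof (rule Lim_null_comparison[OF _ z])
    have "\<forall>\<^sub>F \<epsilon> in at_right (0::real). \<epsilon> \<in> {0<..<1}" by (rule eventually_at_right_real) simp
    then show "\<forall>\<^sub>F \<epsilon> in at_right 0. norm (?S \<epsilon> - (LINT s:{0..t}|lebesgue. A s))
        \<le> T * (B * \<kappa> \<epsilon>) + B * norm J * \<epsilon> powr (1 / p)"
      by eventually_elim (use bound in auto)
  qed
  then show ?thesis by (rule LIM_zero_cancel)
qed

end

section \<open>From paths to the stochastic statement\<close>

lemma primitive_minus:
  assumes "integrable lborel u" "integrable lborel w"
  shows "primitive (\<lambda>t. u t - w t) t = primitive u t - primitive w t"
  using assms unfolding primitive_def set_lebesgue_integral_def
  by (simp add: scaleR_diff_right integrable_mult_indicator)

text \<open>The two continuous representations agree a.e. on the overlap \<open>{d<..<b}\<close> and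
  therefore at \<open>b\<close>. Beyond \<open>b\<close> the increments of the second one can then
  be attached while the constant \<open>c\<close> of the first is kept.\<close>

lemma glue_representations:
  fixes y :: "real \<Rightarrow> 'b::euclidean_space"
  assumes p: "1 \<le> p" and ab: "a \<le> d" "d < b"
    and u: "Lp_compact p u" "\<And>t. t \<notin> {a..b} \<Longrightarrow> u t = 0"
      "AE t in lebesgue. t \<in> {a..b} \<longrightarrow> y t = c + primitive u t"
    and w: "Lp_compact p w" "\<And>t. t \<notin> {d..e} \<Longrightarrow> w t = 0"
      "AE t in lebesgue. t \<in> {d..e} \<longrightarrow> y t = c' + primitive w t"
    and e: "b \<le> e"
  obtains u' where "Lp_compact p u'" "\<And>t. t \<notin> {a..e} \<Longrightarrow> u' t = 0"
      "AE t in lebesgue. t \<in> {a..e} \<longrightarrow> y t = c + primitive u' t"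
proof -
  \<comment> \<open>\<open>k\<close> is \<open>- w\<close> on \<open>{b<..}\<close> and 0 elsewhere,
    so \<open>u'\<close> is \<open>u\<close> up to \<open>b\<close> and \<open>w\<close> after it,
    where \<open>u\<close> vanishes. In this form \<open>primitive_restrict\<close> computes the
    primitive.\<close>
  define k where "k t = indicat_real {..b} t *\<^sub>R w t - w t" for t
  define u' where "u' t = u t - k t" for t
  have kL: "Lp_compact p k" unfolding k_def
    using p by (intro Lp_compact_diff Lp_compact_restrict w) auto
  have iw: "integrable lborel w" "integrable lborel (\<lambda>t. indicat_real {..b} t *\<^sub>R w t)"
    "integrable lborel u" "integrable lborel k"
    using Lp_compact_integrable[OF w(1) p] Lp_compact_integrable[OF Lp_compact_restrict[OF w(1)]
        p, of "{..b}"]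
      Lp_compact_integrable[OF u(1) p] Lp_compact_integrable[OF kL p] by auto
  have prim: "primitive u' t = primitive u t + primitive w t - primitive w (min t b)" for t
  proof -
    have "primitive k t = primitive w (min t b) - primitive w t"
      unfolding k_def by (simp add: primitive_minus[OF iw(2,1)] primitive_restrict)
    then show ?thesis unfolding u'_def by (simp add: primitive_minus[OF iw(3,4)])
  qed
  have cu: "continuous_on UNIV (\<lambda>t. c + primitive u t)" "continuous_on UNIV (\<lambda>t. c' + primitive w t)"
    using continuous_primitive[OF Lp_compact_mono_exponent[OF u(1) p]]
      continuous_primitive[OF Lp_compact_mono_exponent[OF w(1) p]]
    by (auto intro!: continuous_intros)
  have "AE t in lebesgue. t \<in> {d<..<b} \<longrightarrow> c + primitive u t = c' + primitive w t"
    using u(3) w(3) by eventually_elim (use ab e in auto)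
  then have b: "c + primitive u b = c' + primitive w b"
    using ab by (intro continuous_AE_eq[OF cu, of d b b]) auto
  show ?thesis
  proof (rule that)
    show "Lp_compact p u'" unfolding u'_def using p by (intro Lp_compact_diff u kL) auto
    show "u' t = 0" if "t \<notin> {a..e}" for t
      using that u(2)[of t] w(2)[of t] ab e by (auto simp: u'_def k_def indicator_def)
    show "AE t in lebesgue. t \<in> {a..e} \<longrightarrow> y t = c + primitive u' t"
      using u(3) w(3)
    proof eventually_elim
      case (elim t)
      show ?case
      proof (cases "t \<le> b")
        case True
        then show ?thesis using elim(1) by (simp add: prim)
      next
        case False
        then have "primitive u t = primitive u b"
          by (intro primitive_eq_const) (auto intro: u(2))
        then show ?thesis using False elim(2) ab b by (simp add: prim algebra_simps)
      qed
    qed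
  qed
qed

lemma segment_representation:
  fixes y :: "real \<Rightarrow> 'b::euclidean_space"
  assumes y: "(\<lambda>\<theta>. y (s + \<theta>)) \<in> W1p p r" and r: "0 < r" and p: "1 \<le> p"
  obtains w c where "Lp_compact p w" "\<And>t. t \<notin> {s - r..s} \<Longrightarrow> w t = 0"
    "AE t in lebesgue. t \<in> {s - r..s} \<longrightarrow> y t = c + primitive w t"
proof -
  obtain w c where w: "Lp_compact p w" "\<And>t. t \<notin> {-r..0} \<Longrightarrow> w t = 0"
      "AE \<theta> in lebesgue_on {-r..0}. y (s + \<theta>) = c + primitive w \<theta>"
    by (rule W1p_representation[OF y r p]) (rule that)
  have "AE t in lebesgue. t \<in> {-r..0} \<longrightarrow> y (s + t) = c + primitive w t"
    using w(3) by (subst (asm) AE_restrict_space_iff) auto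
  then have "AE t in lebesgue. - s + t \<in> {-r..0} \<longrightarrow> y (s + (- s + t)) = c + primitive w (- s + t)"
    by (rule AE_lebesgue_translate)
  then have "AE t in lebesgue. t \<in> {s - r..s} \<longrightarrow> y t = c + primitive (\<lambda>t. w (- s + t)) t"
  proof eventually_elim
    case (elim t)
    then show ?case using primitive_translate[of w "- s" t] by auto
  qed
  moreover have "w (- s + t) = 0" if "t \<notin> {s - r..s}" for t
    using that by (intro w(2)) auto
  ultimately show ?thesis using that Lp_compact_translate'[OF w(1), of "- s"] by blast
qed

text \<open>Advancing by half a window leaves an overlap of length at least r/2 with the part
  already represented, as the gluing requires. The truncation by \<open>T\<close> keeps the times in
  range and makes the sequence reach \<open>T\<close> after finitely many steps.\<close>

lemma path_representation:
  fixes y :: "real \<Rightarrow> 'b::euclidean_space"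
  assumes r: "0 < r" and T: "0 \<le> T" and p: "1 \<le> p"
    and y: "\<And>k::nat. (\<lambda>\<theta>. y (min T (real k * (r / 2)) + \<theta>)) \<in> W1p p r"
  obtains u c where "Lp_compact p u" "\<And>t. t \<notin> {-r..T} \<Longrightarrow> u t = 0"
    "AE t in lebesgue. t \<in> {-r..T} \<longrightarrow> y t = c + primitive u t"
proof -
  define b where "b k = min T (real k * (r / 2))" for k :: nat
  have b0: "0 \<le> b k" for k using T r by (simp add: b_def)
  have "\<exists>u c. Lp_compact p u \<and> (\<forall>t. t \<notin> {-r..b k} \<longrightarrow> u t = 0) \<and>
    (AE t in lebesgue. t \<in> {-r..b k} \<longrightarrow> y t = c + primitive u t)" for k
  proof (induction k)
    case 0
    show ?case
      by (rule segment_representation[OF y[of 0] r p]) (use T in \<open>auto simp: b_def\<close>)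
  next
    case (Suc k)
    then obtain u c where u: "Lp_compact p u" "\<And>t. t \<notin> {-r..b k} \<Longrightarrow> u t = 0"
      "AE t in lebesgue. t \<in> {-r..b k} \<longrightarrow> y t = c + primitive u t" by blast
    obtain w c' where w: "Lp_compact p w" "\<And>t. t \<notin> {b (Suc k) - r..b (Suc k)} \<Longrightarrow> w t = 0"
      "AE t in lebesgue. t \<in> {b (Suc k) - r..b (Suc k)} \<longrightarrow> y t = c' + primitive w t"
      by (rule segment_representation[OF y[of "Suc k"] r p, folded b_def]) (rule that)
    have le: "b k \<le> b (Suc k)" "b (Suc k) \<le> b k + r / 2"
      using r by (auto simp: b_def min_def algebra_simps)
    show ?case
    proof -
      have d: "-r \<le> b (Suc k) - r" "b (Suc k) - r < b k"
        using r le b0[of "Suc k"] by linarith+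
      obtain u' where "Lp_compact p u'" "\<And>t. t \<notin> {-r..b (Suc k)} \<Longrightarrow> u' t = 0"
        "AE t in lebesgue. t \<in> {-r..b (Suc k)} \<longrightarrow> y t = c + primitive u' t"
        by (rule glue_representations[OF p d u w le(1)]) (assumption, assumption, rule that)
      then show ?thesis by blast
    qed
  qed
  moreover obtain k :: nat where "T / (r / 2) \<le> real k" using real_arch_simple by blast
  then have "b k = T" using r by (simp add: b_def field_simps)
  ultimately show ?thesis using that by metis
qed

text \<open>By right continuity a discrepancy at \<open>t\<close> would persist on an interval to
  its right, and such an interval has positive measure.\<close>

lemma right_continuous_AE_eq:
  fixes y Y :: "real \<Rightarrow> 'b::euclidean_space"
  assumes ae: "AE t in lebesgue. t \<in> {a..T} \<longrightarrow> y t = Y t" and Y: "continuous_on UNIV Y"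
    and t: "a \<le> t" "t < T" and y: "(y \<longlongrightarrow> y t) (at_right t)"
  shows "y t = Y t"
proof (rule ccontr)
  assume ne: "y t \<noteq> Y t"
  have "isCont Y t" using Y by (simp add: continuous_on_eq_continuous_at)
  then have "(Y \<longlongrightarrow> Y t) (at_right t)"
    unfolding isCont_def filterlim_at_split by simp
  then have "((\<lambda>s. y s - Y s) \<longlongrightarrow> y t - Y t) (at_right t)" using y by (intro tendsto_diff)
  then have "\<forall>\<^sub>F s in at_right t. y s - Y s \<noteq> 0"
    using ne by (intro tendsto_imp_eventually_ne) auto
  then obtain b where b: "t < b" "\<And>s. t < s \<Longrightarrow> s < b \<Longrightarrow> y s \<noteq> Y s"
    unfolding eventually_at_right_field by auto
  have "AE s in lebesgue. s \<notin> {t<..<min b T}"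
    using ae by eventually_elim (use b t in auto)
  then have "negligible {t<..<min b T}"
    by (simp add: negligible_iff_null_sets completion.null_sets_iff_AE)
  moreover have "{t<..<min b T} \<noteq> {}" using b t by simp
  ultimately show False using open_not_negligible[OF open_greaterThanLessThan, of t "min b T"] by blast
qed

text \<open>Regularity is required of countably many segments only, because a single path can almost
  surely be guaranteed just that: each time brings its own exceptional null set.\<close>

lemma pathwise_forward_integral:
  fixes y :: "real \<Rightarrow> real^'d"
  assumes T: "0 < T" and r: "0 < r" and pq: "1 < p" "1 < q" "1 / p + 1 / q = 1"
    and W: "\<And>k::nat. (\<lambda>\<theta>. y (min T (real k * (r / 2)) + \<theta>)) \<in> W1p p r"
    and rc: "\<forall>t\<in>{0..<T}. (y \<longlongrightarrow> y t) (at_right t)"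
    and after: "\<forall>t>T. y t = y T"
    and F: "C112 p q r T F"
  defines "D \<equiv> \<lambda>s. Lp_deriv p q r (\<lambda>\<psi>. F s \<psi> (y s)) (\<lambda>\<theta>. y (s + \<theta>))"
  defines "P \<equiv> \<lambda>s. pairing r (D s) (weak_deriv p r (\<lambda>\<theta>. y (s + \<theta>)))"
  defines "G \<equiv> \<lambda>s. shift_gen F s (\<lambda>\<theta>. y (s + \<theta>)) (y s)"
  shows "set_integrable lebesgue {0..T} P"
    and "AE s in lebesgue_on {0..T}. \<exists>l. has_shift_gen F s (\<lambda>\<theta>. y (s + \<theta>)) (y s) l"
    and "set_integrable lebesgue {0..T} G"
    and "t \<in> {0..T} \<Longrightarrow> (LINT s:{0..t}|lebesgue. P s) = (LINT s:{0..t}|lebesgue. G s)"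
    and "t \<in> {0..T} \<Longrightarrow> ((\<lambda>\<epsilon>. 1 / \<epsilon> * (LINT s:{0..t}|lebesgue. pairing r (D s) (\<lambda>\<theta>. y (s + \<epsilon> + \<theta>) -
        y (s + \<theta>))))
      \<longlongrightarrow> (LINT s:{0..t}|lebesgue. P s)) (at_right 0)"
proof -
  have p: "1 \<le> p" using pq by simp
  obtain u c where u: "Lp_compact p u" "\<And>t. t \<notin> {-r..T} \<Longrightarrow> u t = 0"
    "AE t in lebesgue. t \<in> {-r..T} \<longrightarrow> y t = c + primitive u t"
    by (rule path_representation[OF r less_imp_le[OF T] p W]) (rule that)
  have Y: "continuous_on UNIV (\<lambda>t. c + primitive u t)"
    by (intro continuous_intros continuous_primitive[OF Lp_compact_mono_exponent[OF u(1) p]])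
  interpret regular_path p q r T y u c F
  proof
    show "y t = c + primitive u t" if "t \<in> {0..<T}" for t
      using that r by (intro right_continuous_AE_eq[OF u(3) Y _ _ rc[rule_format]]) auto
    show "u t = 0" if "T < t" for t using that by (intro u(2)) auto
  qed (use T r pq u after F in auto)
  have cA: "continuous_on {0..T} A" by (rule continuous_pairing_\<Psi>[OF u(1)])
  have D: "D s = \<Psi> s" if "s \<in> {0..<T}" for s unfolding D_def y_eq[OF that] ..
  have PA: "P s = A s" if "s \<in> {0..<T}" for s
    unfolding P_def D[OF that] using that by (intro pairing_weak_deriv) auto
  have GA: "G s = A s" if "s \<in> {0..<T}" for s
    unfolding G_def by (rule shift_gen_eq[OF that])
  have TT: "T \<in> {0..T}" using T by simp
  show "set_integrable lebesgue {0..T} P" "set_integrable lebesgue {0..T} G"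
    using set_integral_lebesgue_continuous_cong(2)[OF cA _ TT] PA GA by auto
  have Pt: "(LINT s:{0..t}|lebesgue. P s) = (LINT s:{0..t}|lebesgue. A s)" if "t \<in> {0..T}" for t
    by (rule set_integral_lebesgue_continuous_cong(3)[OF cA PA that])
  have Gt: "(LINT s:{0..t}|lebesgue. G s) = (LINT s:{0..t}|lebesgue. A s)" if "t \<in> {0..T}" for t
    by (rule set_integral_lebesgue_continuous_cong(3)[OF cA GA that])
  show "(LINT s:{0..t}|lebesgue. P s) = (LINT s:{0..t}|lebesgue. G s)" if "t \<in> {0..T}"
    using Pt[OF that] Gt[OF that] by simp
  show "((\<lambda>\<epsilon>. 1 / \<epsilon> * (LINT s:{0..t}|lebesgue. pairing r (D s) (\<lambda>\<theta>. y (s + \<epsilon> + \<theta>) - y (s + \<theta>))))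
      \<longlongrightarrow> (LINT s:{0..t}|lebesgue. P s)) (at_right 0)" if "t \<in> {0..T}"
    unfolding Pt[OF that] D_def by (rule forward_sum_limit[OF that])
  have "AE s in lebesgue_on {0..T}. s \<noteq> T" by (rule AE_lebesgue_on_singleton)
  moreover have "AE s in lebesgue_on {0..T}. s \<in> {0..T}" by (rule AE_I2) simp
  ultimately show "AE s in lebesgue_on {0..T}. \<exists>l. has_shift_gen F s (\<lambda>\<theta>. y (s + \<theta>)) (y s) l"
  proof eventually_elim
    case (elim s)
    then have "s \<in> {0..<T}" by auto
    from shift_gen_limit[OF this] show ?case by blast
  qed
qed

text \<open>Borel-Cantelli along a fast sequence. The events involve the supremum over time, so a
  single null set serves all \<open>t\<close>.\<close>

lemma (in finite_measure) ucp_limit_AE_subsequence: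
  assumes Z: "ucp_limit T M Y Z" and T: "0 \<le> T"
  obtains \<epsilon> :: "nat \<Rightarrow> real" where "filterlim \<epsilon> (at_right 0) sequentially"
    "AE \<omega> in M. \<forall>t\<in>{0..T}. (\<lambda>n. Y (\<epsilon> n) t \<omega>) \<longlonglongrightarrow> Z t \<omega>"
proof -
  define E where "E \<epsilon> c = {\<omega> \<in> space M. (SUP s\<in>{0..T}. ennreal \<bar>Y \<epsilon> s \<omega> - Z s \<omega>\<bar>) > ennreal c}" for \<epsilon> c
  \<comment> \<open>\<open>(1 / 2) ^ n\<close> is both the threshold, which tends to 0, and the
    bound on the measure, which is summable; \<open>1 / real (Suc n)\<close> forces \<epsilon> to 0.
    The events are measurable only for small \<epsilon>, so measurability is part of the
    choice.\<close>
  have "\<exists>\<epsilon>. 0 < \<epsilon> \<and> \<epsilon> < 1 / real (Suc n) \<and> E \<epsilon> ((1 / 2) ^ n) \<in> sets M \<and> measure M (E \<epsilon> ((1 / 2) ^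
      n)) < (1 / 2) ^ n" for n
  proof -
    have c: "(0::real) < (1 / 2) ^ n" by simp
    have "T \<in> {0..T}" using T by simp
    with Z c have 1: "\<forall>\<^sub>F \<epsilon> in at_right 0. E \<epsilon> ((1 / 2) ^ n) \<in> sets M"
      and 2: "((\<lambda>\<epsilon>. measure M (E \<epsilon> ((1 / 2) ^ n))) \<longlongrightarrow> 0) (at_right 0)"
      unfolding ucp_limit_def E_def by blast+
    have 3: "\<forall>\<^sub>F \<epsilon> in at_right 0. measure M (E \<epsilon> ((1 / 2) ^ n)) < (1 / 2) ^ n"
      using order_tendstoD(2)[OF 2 c] .
    have 4: "\<forall>\<^sub>F \<epsilon> in at_right 0. \<epsilon> \<in> {0<..<1 / real (Suc n)}"
      by (rule eventually_at_right_real) simp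
    have "\<forall>\<^sub>F \<epsilon> in at_right 0. 0 < \<epsilon> \<and> \<epsilon> < 1 / real (Suc n) \<and> E \<epsilon> ((1 / 2) ^ n) \<in> sets M
        \<and> measure M (E \<epsilon> ((1 / 2) ^ n)) < (1 / 2) ^ n"
      using 1 3 4 by eventually_elim auto
    then show ?thesis using eventually_happens'[OF trivial_limit_at_right_real] by blast
  qed
  then obtain \<epsilon> where \<epsilon>: "\<And>n. 0 < \<epsilon> n" "\<And>n. \<epsilon> n < 1 / real (Suc n)"
    "\<And>n. E (\<epsilon> n) ((1 / 2) ^ n) \<in> sets M" "\<And>n. measure M (E (\<epsilon> n) ((1 / 2) ^ n)) < (1 / 2) ^ n"
    by metis
  have "\<epsilon> \<longlonglongrightarrow> 0"
  proof (rule tendsto_sandwich[OF _ _ tendsto_const LIMSEQ_inverse_real_of_nat])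
    show "\<forall>\<^sub>F n in sequentially. 0 \<le> \<epsilon> n" using \<epsilon>(1) by (auto intro: always_eventually less_imp_le)
    show "\<forall>\<^sub>F n in sequentially. \<epsilon> n \<le> inverse (real (Suc n))"
      using \<epsilon>(2) by (auto intro!: always_eventually less_imp_le simp: inverse_eq_divide)
  qed
  then have lim: "filterlim \<epsilon> (at_right 0) sequentially"
    using \<epsilon>(1) by (intro tendsto_imp_filterlim_at_right) auto
  have "summable (\<lambda>n. measure M (E (\<epsilon> n) ((1 / 2) ^ n)))"
    by (rule summable_comparison_test'[OF summable_geometric[of "1 / 2 :: real"], of 0])
       (use \<epsilon>(4) in \<open>auto intro: less_imp_le\<close>)
  then have "AE \<omega> in M. \<forall>\<^sub>F n in sequentially. \<omega> \<in> space M - E (\<epsilon> n) ((1 / 2) ^ n)"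
    using \<epsilon>(3) by (intro borel_cantelli_AE1) (auto simp: emeasure_eq_measure)
  then have "AE \<omega> in M. \<forall>t\<in>{0..T}. (\<lambda>n. Y (\<epsilon> n) t \<omega>) \<longlonglongrightarrow> Z t \<omega>"
  proof eventually_elim
    case (elim \<omega>)
    show ?case
    proof
      fix t assume t: "t \<in> {0..T}"
      have "(\<lambda>n. Y (\<epsilon> n) t \<omega> - Z t \<omega>) \<longlonglongrightarrow> 0"
      proof (rule Lim_null_comparison)
        show "\<forall>\<^sub>F n in sequentially. norm (Y (\<epsilon> n) t \<omega> - Z t \<omega>) \<le> (1 / 2) ^ n"
          using elim
        proof eventually_elim
          case (elim n)
          then have "(SUP s\<in>{0..T}. ennreal \<bar>Y (\<epsilon> n) s \<omega> - Z s \<omega>\<bar>) \<le> ennreal ((1 / 2) ^ n)"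
            unfolding E_def by (auto simp: not_less)
          then have "ennreal \<bar>Y (\<epsilon> n) t \<omega> - Z t \<omega>\<bar> \<le> ennreal ((1 / 2) ^ n)"
            by (rule order_trans[OF SUP_upper[OF t]])
          then show ?case by (simp add: ennreal_le_iff)
        qed
        show "(\<lambda>n. (1 / 2 :: real) ^ n) \<longlonglongrightarrow> 0" by (rule LIMSEQ_power_zero) simp
      qed
      then show "(\<lambda>n. Y (\<epsilon> n) t \<omega>) \<longlonglongrightarrow> Z t \<omega>" by (rule LIM_zero_cancel)
    qed
  qed
  with lim show ?thesis using that by blast
qed

theorem proposition3p7:
  fixes p q r T :: real
    and M :: "'a measure" and \<F> :: "real \<Rightarrow> 'a measure"
    and W :: "real \<Rightarrow> 'a \<Rightarrow> real^'m"
    and Lv :: "'n::finite \<Rightarrow> real \<Rightarrow> 'a \<Rightarrow> real" and \<nu> :: "'n \<Rightarrow> real measure"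
    and f :: "real \<Rightarrow> (real \<Rightarrow> real^'d) \<Rightarrow> real^'d \<Rightarrow> real^'d"
    and g :: "real \<Rightarrow> (real \<Rightarrow> real^'d) \<Rightarrow> real^'d \<Rightarrow> real^'m^'d"
    and h :: "real \<Rightarrow> (real \<Rightarrow> real^'d) \<Rightarrow> real^'d \<Rightarrow> real \<Rightarrow> real^'n^'d"
    and \<eta> :: "real \<Rightarrow> real^'d" and x :: "real^'d"
    and X :: "real \<Rightarrow> 'a \<Rightarrow> real^'d"
    and F :: "real \<Rightarrow> (real \<Rightarrow> real^'d) \<Rightarrow> real^'d \<Rightarrow> real"
    and Z :: "real \<Rightarrow> 'a \<Rightarrow> real"
  defines "DF \<equiv> \<lambda>s \<omega>. Lp_deriv p q r (\<lambda>\<psi>. F s \<psi> (X s \<omega>)) (segment X s \<omega>)"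
  assumes "0 < T" and "0 < r"
    and "2 \<le> p" and "1 / p + 1 / q = 1"
    and "prob_space M" and "complete_measure M" and "usual_filtration r T M \<F>"
    and "brownian_motion T M \<F> W"
    and "\<And>j. levy_process T M \<F> (Lv j)" and "independent_processes T M Lv"
    and "\<And>j. levy_measure_of T M (Lv j) (\<nu> j)"
    and "standing_assumptions p r T M \<F> \<nu> f g h"
    and "\<eta> \<in> Lp p r"
    and "strong_solution p r T M \<F> W (\<lambda>j \<omega>. jump_measure T (\<lambda>t. Lv j t \<omega>)) \<nu> f g h \<eta> x X"
    and "\<And>t \<omega>. t > T \<Longrightarrow> \<omega> \<in> space M \<Longrightarrow> X t \<omega> = X T \<omega>"
    and "C112 p q r T F"
    and "is_forward_integral r T M DF X Z"
    and "\<And>s. s \<in> {0..T} \<Longrightarrow> AE \<omega> in M. segment X s \<omega> \<in> W1p p r"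
  shows "AE \<omega> in M.
     set_integrable lebesgue {0..T} (\<lambda>s. pairing r (DF s \<omega>) (weak_deriv p r (segment X s \<omega>))) \<and>
     (AE s in lebesgue_on {0..T}. \<exists>l. has_shift_gen F s (segment X s \<omega>) (X s \<omega>) l) \<and>
     set_integrable lebesgue {0..T} (\<lambda>s. shift_gen F s (segment X s \<omega>) (X s \<omega>)) \<and>
     (\<forall>t\<in>{0..T}.
        Z t \<omega> = (LINT s:{0..t}|lebesgue. pairing r (DF s \<omega>) (weak_deriv p r (segment X s \<omega>))) \<and>
        (LINT s:{0..t}|lebesgue. pairing r (DF s \<omega>) (weak_deriv p r (segment X s \<omega>)))
          = (LINT s:{0..t}|lebesgue. shift_gen F s (segment X s \<omega>) (X s \<omega>)))"
proof -
  interpret prob_space M by fact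
  have p: "1 < p" using \<open>2 \<le> p\<close> by simp
  have q: "1 < q"
  proof -
    have eq: "1 / q = 1 - 1 / p" using \<open>1 / p + 1 / q = 1\<close> by simp
    have "0 < 1 / q" "1 / q < 1" unfolding eq using p by simp_all
    then show ?thesis by simp
  qed
  have seg: "segment X s \<omega> = (\<lambda>\<theta>. X (s + \<theta>) \<omega>)" for s \<omega>
    by (simp add: segment_def)
  obtain \<epsilon> :: "nat \<Rightarrow> real" where \<epsilon>: "filterlim \<epsilon> (at_right 0) sequentially"
    "AE \<omega> in M. \<forall>t\<in>{0..T}. (\<lambda>n. 1 / \<epsilon> n * (LINT s:{0..t}|lebesgue.
        pairing r (DF s \<omega>) (\<lambda>\<theta>. segment X (s + \<epsilon> n) \<omega> \<theta> - segment X s \<omega> \<theta>))) \<longlonglongrightarrow> Z t \<omega>"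
    by (rule ucp_limit_AE_subsequence[OF \<open>is_forward_integral r T M DF X Z\<close>[unfolded is_forward_integral_def]
          less_imp_le[OF \<open>0 < T\<close>]]) (rule that)
  \<comment> \<open>The null set in the regularity hypothesis depends on the time; countably many of
    them may be united.\<close>
  have W: "AE \<omega> in M. \<forall>k::nat. segment X (min T (real k * (r / 2))) \<omega> \<in> W1p p r"
    unfolding AE_all_countable
    using \<open>0 < T\<close> \<open>0 < r\<close> by (intro allI \<open>\<And>s. s \<in> {0..T} \<Longrightarrow> AE \<omega> in M. segment X s \<omega> \<in> W1p p r\<close>) auto
  have cadlag: "AE \<omega> in M. cadlag_on T (\<lambda>t. X t \<omega>)"
    using \<open>strong_solution p r T M \<F> W _ \<nu> f g h \<eta> x X\<close> unfolding strong_solution_def by blast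
  from \<epsilon>(2) W cadlag AE_space[of M] show ?thesis
  proof eventually_elim
    case (elim \<omega>)
    have W\<omega>: "(\<lambda>\<theta>. X (min T (real k * (r / 2)) + \<theta>) \<omega>) \<in> W1p p r" for k :: nat
      using elim(2) by (simp add: seg)
    have rc: "\<forall>t\<in>{0..<T}. ((\<lambda>t. X t \<omega>) \<longlongrightarrow> X t \<omega>) (at_right t)"
      using elim(3) by (simp add: cadlag_on_def)
    have after: "\<forall>t>T. X t \<omega> = X T \<omega>"
      using elim(4) \<open>\<And>t \<omega>. t > T \<Longrightarrow> \<omega> \<in> space M \<Longrightarrow> X t \<omega> = X T \<omega>\<close> by blast
    note path = pathwise_forward_integral[OF \<open>0 < T\<close> \<open>0 < r\<close> p q \<open>1 / p + 1 / q = 1\<close> W\<omega> rc after \<open>C112 p q r T F\<close>]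
    \<comment> \<open>Along the chosen sequence the forward sums converge to
      \<open>Z t \<omega>\<close> and, by the pathwise limit, to the integral as well.\<close>
    have "Z t \<omega> = (LINT s:{0..t}|lebesgue. pairing r (DF s \<omega>) (weak_deriv p r (segment X s \<omega>)))"
      if t: "t \<in> {0..T}" for t
    proof (rule LIMSEQ_unique)
      show "(\<lambda>n. 1 / \<epsilon> n * (LINT s:{0..t}|lebesgue.
          pairing r (DF s \<omega>) (\<lambda>\<theta>. segment X (s + \<epsilon> n) \<omega> \<theta> - segment X s \<omega> \<theta>))) \<longlonglongrightarrow> Z t \<omega>"
        using elim(1) t by blast
      show "(\<lambda>n. 1 / \<epsilon> n * (LINT s:{0..t}|lebesgue.
          pairing r (DF s \<omega>) (\<lambda>\<theta>. segment X (s + \<epsilon> n) \<omega> \<theta> - segment X s \<omega> \<theta>)))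
        \<longlonglongrightarrow> (LINT s:{0..t}|lebesgue. pairing r (DF s \<omega>) (weak_deriv p r (segment X s \<omega>)))"
        unfolding DF_def seg by (rule filterlim_compose[OF path(5)[OF t] \<epsilon>(1)])
    qed
    then show ?case
      using path(1-4) unfolding DF_def seg by auto
  qed
qed

end
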